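(* Fix $p\in(0,1)$ and $h\in\mathbb{N}$. There is a function $\alpha(n)$ with $\alpha(n)\to0$ as $n\to\infty$ such that for every $n$, if $G\in\mathbb{G}(n,p)$ and $X_{K_h}$ denotes the number of copies of $K_h$ in $G$, then for all $x\in\mathbb{N}$, \[ \Pr\left(X_{K_h}=x\right)\le n^{\alpha(n)+1-h}. \]
   Context: $\mathbb{G}(n,p)$ is the binomial random graph on vertex set $\{1,\dots,n\}$ in which each pair of vertices is an edge independently with probability $p$. $K_h$ is the complete graph on $h$ vertices; a copy of $K_h$ in $G$ is a set of $h$ pairwise adjacent vertices. *)

theory Defs
  imports "HOL-Probability.Probability"
begin

text \<open>A graph on the vertex set \<open>{1..n}\<close> is represented by its set of edges, each edge being
  a two-element set of vertices.\<close>

definition vertex_pairs :: "nat \<Rightarrow> nat set set" where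
  "vertex_pairs n = {e. e \<subseteq> {1..n} \<and> card e = 2}"

text \<open>The product over all pairs in \<open>vertex_pairs n\<close> of Bernoulli variables makes the pairs edges
  independently; the value \<open>False\<close> is the default outside \<open>vertex_pairs n\<close>.\<close>

definition random_graph :: "nat \<Rightarrow> real \<Rightarrow> nat set set pmf" where
  "random_graph n p =
     map_pmf (\<lambda>f. {e \<in> vertex_pairs n. f e})
       (Pi_pmf (vertex_pairs n) False (\<lambda>_. bernoulli_pmf p))"

definition clique_copies :: "nat \<Rightarrow> nat \<Rightarrow> nat set set \<Rightarrow> nat set set" where
  "clique_copies h n E =
     {S. S \<subseteq> {1..n} \<and> card S = h \<and> (\<forall>u\<in>S. \<forall>v\<in>S. u \<noteq> v \<longrightarrow> {u, v} \<in> E)}"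

definition clique_count :: "nat \<Rightarrow> nat \<Rightarrow> nat set set \<Rightarrow> nat" where
  "clique_count h n E = card (clique_copies h n E)"

end

theory Submission
  imports Defs "HOL-Real_Asymp.Real_Asymp"
begin

text \<open>Let \<open>X\<close> be the number of copies of \<open>K\<^sub>h\<close> and let \<open>1 \<le> k < h\<close>. For \<open>\<bar>\<theta>\<bar>\<close> between
  \<open>n powr (e - k)\<close> and \<open>n powr (1 - k - e)\<close>, the characteristic function of \<open>X\<close> at \<open>\<theta>\<close> decays faster
  than any power of \<open>n\<close>. Indeed, fix a clique \<open>C\<close> with \<open>h - 1 - k\<close> vertices and a set \<open>A\<close> of suitable
  size disjoint from it. Applying Cauchy-Schwarz once for each \<open>c \<in> C\<close>, to the edges between \<open>c\<close> and \<open>A\<close>,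
  cancels all cliques not containing \<open>C\<close>. Let \<open>U\<close> be the set of vertices of \<open>A\<close> that are joined to all of
  \<open>C\<close> in the first copy and to none of \<open>C\<close> in the second one. As a function of the edges inside \<open>U\<close>, the
  remaining phase counts cliques containing \<open>C\<close> with positive sign; each such edge lies in about
  \<open>n ^ (k - 1)\<close> of them, and this number hardly depends on the other edges inside \<open>U\<close>. So the phase is
  almost linear, and its linear part has a tiny characteristic function. Inverting these estimates
  for \<open>k = h - 1, ..., 1\<close> in turn, the probability of a window of length about \<open>n ^ (k - 1)\<close> is, up to
  \<open>n powr (4 * e)\<close>, at most \<open>1 / n\<close> times that of a window of length about \<open>n ^ k\<close>.\<close>

section \<open>Averages over random subsets\<close>

text \<open>Write a = |\<theta>| n^(k-1), the order of the phase carried by one edge inside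
  \<open>U\<close>, and q for the size of \<open>A\<close>. The linear part of the phase has
  variance of order (a q)^2, which must be large; the rest fluctuates by about (a q) (q/n), which
  must be small. With a q = n^(e/4) the latter is n^(e/2) / (a n), at most n^(-e/2) once a \<ge>
  n^(e-1). The upper limit a \<le> n^(-e) keeps every single phase below 1, so that no edge wraps
  around the circle, and makes q a positive power of n. This is the origin of the range of \<theta>.
  The exponent k-1 is a count: \<open>C\<close> and one edge leave h - (h-1-k) - 2 = k-1 free
  vertices. Two obstacles shape the rest. \<open>C\<close> must not depend on the edges averaged
  over, so it is sought outside \<open>A\<close> and the edges are exposed in blocks. And each
  Cauchy-Schwarz squares, so only the power 2^r of the characteristic function is controlled, r =
  |C|; the inner estimate must therefore beat arbitrary powers of n. A second-order estimate would
  give one fixed power only, hence a Taylor expansion of freely chosen degree.\<close>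

locale bernoulli_param =
  fixes p :: real
  assumes p_pos: "0 < p" and p_less_1: "p < 1"
begin

text \<open>Expectation over a p-random subset of \<open>M\<close>, as a finite sum with values in
  any normed space: probabilities and characteristic functions share one calculus, free of
  measurability. The link to the pmf is made only in
  \<open>prob_random_graph_eq_avg\<close>.\<close>

definition avg :: "'a set \<Rightarrow> ('a set \<Rightarrow> 'b::real_normed_vector) \<Rightarrow> 'b" where
  "avg M g = (\<Sum>E\<in>Pow M. (p ^ card E * (1 - p) ^ card (M - E)) *\<^sub>R g E)"

lemma avg_empty [simp]: "avg {} g = g {}"
  by (simp add: avg_def)

text \<open>Conditioning on whether \<open>e\<close> is chosen. This recursion drives the later
  inductions over the ground set.\<close>

lemma avg_insert:
  assumes "finite M" "e \<notin> M"
  shows "avg (insert e M) g = p *\<^sub>R avg M (\<lambda>E. g (insert e E)) + (1 - p) *\<^sub>R avg M g"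
proof -
  let ?w = "\<lambda>M E. p ^ card E * (1 - p) ^ card (M - E)"
  have dis: "Pow M \<inter> insert e ` Pow M = {}" using assms by auto
  have inj: "inj_on (insert e) (Pow M)"
    using assms(2) by (intro inj_onI) (metis PowD insert_ident subsetD)
  have "avg (insert e M) g = (\<Sum>E\<in>Pow M. ?w (insert e M) E *\<^sub>R g E)
      + (\<Sum>E\<in>insert e ` Pow M. ?w (insert e M) E *\<^sub>R g E)"
    unfolding avg_def Pow_insert by (rule sum.union_disjoint) (use assms dis in auto)
  also have "(\<Sum>E\<in>insert e ` Pow M. ?w (insert e M) E *\<^sub>R g E)
      = (\<Sum>E\<in>Pow M. ?w (insert e M) (insert e E) *\<^sub>R g (insert e E))"
    by (simp add: sum.reindex[OF inj])
  also have "\<dots> = (\<Sum>E\<in>Pow M. p *\<^sub>R ?w M E *\<^sub>R g (insert e E))"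
  proof (rule sum.cong)
    fix E assume E: "E \<in> Pow M"
    then have "finite E" "e \<notin> E" using assms finite_subset by auto
    moreover have "insert e M - insert e E = M - E" using assms by auto
    ultimately show "?w (insert e M) (insert e E) *\<^sub>R g (insert e E) = p *\<^sub>R ?w M E *\<^sub>R g (insert e E)"
      by simp
  qed simp
  also have "\<dots> = p *\<^sub>R avg M (\<lambda>E. g (insert e E))"
    by (simp add: avg_def scaleR_sum_right)
  also have "(\<Sum>E\<in>Pow M. ?w (insert e M) E *\<^sub>R g E) = (\<Sum>E\<in>Pow M. (1 - p) *\<^sub>R ?w M E *\<^sub>R g E)"
  proof (rule sum.cong)
    fix E assume E: "E \<in> Pow M"
    then have "insert e M - E = insert e (M - E)" using assms by auto
    then have "card (insert e M - E) = Suc (card (M - E))" using assms by simp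
    then show "?w (insert e M) E *\<^sub>R g E = (1 - p) *\<^sub>R ?w M E *\<^sub>R g E" by (simp add: mult_ac)
  qed simp
  also have "\<dots> = (1 - p) *\<^sub>R avg M g"
    by (simp add: avg_def scaleR_sum_right)
  finally show ?thesis by simp
qed

lemma avg_cong:
  assumes "M = N" "\<And>E. E \<subseteq> N \<Longrightarrow> f E = g E"
  shows "avg M f = avg N g"
  unfolding avg_def using assms by (intro sum.cong) auto

lemma avg_add: "avg M (\<lambda>E. f E + g E) = avg M f + avg M g"
  by (simp add: avg_def scaleR_add_right sum.distrib)

lemma avg_diff: "avg M (\<lambda>E. f E - g E) = avg M f - avg M g"
  by (simp add: avg_def scaleR_diff_right sum_subtractf)

lemma avg_mult_left: "avg M (\<lambda>E. c * g E) = c * avg M g"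
  for c :: "'b::real_normed_algebra"
  by (simp add: avg_def sum_distrib_left)

lemma avg_mult_right: "avg M (\<lambda>E. g E * c) = avg M g * c"
  for c :: "'b::real_normed_algebra"
  by (simp add: avg_def sum_distrib_right)

lemma avg_sum: "avg M (\<lambda>E. \<Sum>i\<in>I. f i E) = (\<Sum>i\<in>I. avg M (f i))"
  unfolding avg_def scaleR_sum_right by (rule sum.swap)

lemma avg_swap: "avg M (\<lambda>E. avg N (\<lambda>F. g E F)) = avg N (\<lambda>F. avg M (\<lambda>E. g E F))"
  unfolding avg_def scaleR_sum_right
  by (subst sum.swap) (simp add: mult.commute)

lemma avg_const [simp]: "finite M \<Longrightarrow> avg M (\<lambda>_. c) = c"
  by (induction M rule: finite_induct)
     (simp_all add: avg_insert flip: scaleR_add_left)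

lemma avg_mono:
  fixes f g :: "'a set \<Rightarrow> real"
  assumes "\<And>E. E \<subseteq> M \<Longrightarrow> f E \<le> g E"
  shows "avg M f \<le> avg M g"
  unfolding avg_def using assms p_pos p_less_1
  by (intro sum_mono) (auto intro!: mult_left_mono)

lemma avg_nonneg:
  fixes f :: "'a set \<Rightarrow> real"
  assumes "\<And>E. E \<subseteq> M \<Longrightarrow> 0 \<le> f E"
  shows "0 \<le> avg M f"
  using avg_mono[of M "\<lambda>_. 0" f] assms by (simp add: avg_def)

lemma norm_avg_le: "norm (avg M g) \<le> avg M (\<lambda>E. norm (g E))"
  unfolding avg_def using p_pos p_less_1
  by (intro order.trans[OF norm_sum] sum_mono) (simp add: abs_mult)

lemma avg_le_const:
  fixes f :: "'a set \<Rightarrow> real"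
  assumes "finite M" "\<And>E. E \<subseteq> M \<Longrightarrow> f E \<le> c"
  shows "avg M f \<le> c"
  using avg_mono[of M f "\<lambda>_. c"] assms by simp

text \<open>Fubini for independent blocks of edges; every exposure of edges in stages goes through
  it.\<close>

lemma avg_Un:
  assumes "finite M" "finite N" "M \<inter> N = {}"
  shows "avg (M \<union> N) g = avg M (\<lambda>E. avg N (\<lambda>F. g (E \<union> F)))"
  using assms
proof (induction M arbitrary: g rule: finite_induct)
  case (insert e M)
  then show ?case
    by (simp add: avg_insert)
qed simp

lemma avg_of_real: "avg M (\<lambda>E. complex_of_real (f E)) = complex_of_real (avg M f)"
  by (simp add: avg_def scaleR_conv_of_real)

lemma avg_cnj: "cnj (avg M f) = avg M (\<lambda>E. cnj (f E))"
  by (simp add: avg_def scaleR_conv_of_real)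

lemma square_avg_le:
  fixes f :: "'a set \<Rightarrow> real"
  assumes "finite M"
  shows "(avg M f)\<^sup>2 \<le> avg M (\<lambda>E. (f E)\<^sup>2)"
proof -
  let ?m = "avg M f"
  have "0 \<le> avg M (\<lambda>E. (f E - ?m)\<^sup>2)" by (rule avg_nonneg) simp
  also have "\<dots> = avg M (\<lambda>E. ((f E)\<^sup>2 + ?m\<^sup>2) - (2 * ?m) * f E)"
    by (intro avg_cong) (auto simp: power2_diff algebra_simps)
  also have "\<dots> = avg M (\<lambda>E. (f E)\<^sup>2) + ?m\<^sup>2 - 2 * ?m * ?m"
    by (simp only: avg_diff avg_add avg_mult_left avg_const[OF assms])
  finally show ?thesis by (simp add: power2_eq_square)
qed

text \<open>Jensen by iterating \<open>square_avg_le\<close>. Powers of two suffice, since the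
  exponents come from repeated Cauchy-Schwarz.\<close>

lemma power_avg_le:
  fixes f :: "'a set \<Rightarrow> real"
  assumes "finite M" "\<And>E. E \<subseteq> M \<Longrightarrow> 0 \<le> f E"
  shows "(avg M f) ^ (2 ^ r) \<le> avg M (\<lambda>E. f E ^ (2 ^ r))"
proof (induction r)
  case (Suc r)
  have "(avg M f) ^ (2 ^ Suc r) = ((avg M f) ^ (2 ^ r))\<^sup>2"
    by (simp add: power_mult [symmetric] mult.commute)
  also have "\<dots> \<le> (avg M (\<lambda>E. f E ^ (2 ^ r)))\<^sup>2"
    using assms by (intro power_mono Suc) (simp add: avg_nonneg)
  also have "\<dots> \<le> avg M (\<lambda>E. (f E ^ (2 ^ r))\<^sup>2)"
    by (rule square_avg_le) fact
  also have "\<dots> = avg M (\<lambda>E. f E ^ (2 ^ Suc r))"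
    by (simp add: power_mult [symmetric] mult.commute)
  finally show ?case .
qed simp

text \<open>Probability generating function of a binomial variable with \<open>card W\<close>
  trials.\<close>

lemma avg_power_card:
  fixes t :: real
  assumes "finite M" "W \<subseteq> M"
  shows "avg M (\<lambda>x. t ^ card (W \<inter> x)) = (1 - p + p * t) ^ card W"
  using assms
proof (induction M arbitrary: W rule: finite_induct)
  case (insert e M)
  show ?case
  proof (cases "e \<in> W")
    case True
    define W' where "W' = W - {e}"
    have W: "W = insert e W'" "e \<notin> W'" "W' \<subseteq> M" "finite W'"
      using True insert by (auto simp: W'_def intro: finite_subset)
    have "avg M (\<lambda>x. t ^ card (insert e W' \<inter> insert e x)) = avg M (\<lambda>x. t * t ^ card (W' \<inter> x))"
    proof (rule avg_cong)
      fix x assume "x \<subseteq> M"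
      then have "insert e W' \<inter> insert e x = insert e (W' \<inter> x)" "e \<notin> W' \<inter> x" "finite (W' \<inter> x)"
        using W insert by auto
      then show "t ^ card (insert e W' \<inter> insert e x) = t * t ^ card (W' \<inter> x)" by simp
    qed simp
    moreover have "avg M (\<lambda>x. t ^ card (insert e W' \<inter> x)) = avg M (\<lambda>x. t ^ card (W' \<inter> x))"
    proof (rule avg_cong)
      fix x assume "x \<subseteq> M"
      then have "insert e W' \<inter> x = W' \<inter> x" using insert by auto
      then show "t ^ card (insert e W' \<inter> x) = t ^ card (W' \<inter> x)" by simp
    qed simp
    ultimately show ?thesis
      using insert W by (simp add: avg_insert avg_mult_left insert.IH[OF W(3)] algebra_simps)
  next
    case False
    then have "W \<subseteq> M" using insert by auto
    moreover have "W \<inter> insert e x = W \<inter> x" for x using False by auto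
    ultimately show ?thesis
      using insert by (simp add: avg_insert flip: scaleR_add_left) (simp add: algebra_simps)
  qed
qed simp

lemma avg_power_card_diff:
  fixes s :: real
  assumes "finite M" "W \<subseteq> M" "0 < s"
  shows "avg M (\<lambda>x. s ^ card (W - x)) = (p + (1 - p) * s) ^ card W"
proof -
  have False: "s \<noteq> 0" using assms by simp
  have fW: "finite W" using assms finite_subset by auto
  \<comment> \<open>Missed elements are the complement of hit ones, so the previous generating
    function is evaluated at 1/s; this is where s must be nonzero.\<close>
  have "avg M (\<lambda>x. s ^ card (W - x)) = avg M (\<lambda>x. s ^ card W * (1 / s) ^ card (W \<inter> x))"
  proof (rule avg_cong)
    fix x assume "x \<subseteq> M"
    have "card W = card (W - x) + card (W \<inter> x)"
      using fW by (simp add: card_Diff_subset_Int card_mono)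
    then show "s ^ card (W - x) = s ^ card W * (1 / s) ^ card (W \<inter> x)"
      using False by (simp add: power_add power_divide)
  qed simp
  also have "\<dots> = s ^ card W * (1 - p + p * (1 / s)) ^ card W"
    by (simp only: avg_mult_left avg_power_card[OF assms(1,2)])
  also have "\<dots> = (p + (1 - p) * s) ^ card W"
    unfolding power_mult_distrib[symmetric] using False by (simp add: algebra_simps)
  finally show ?thesis .
qed

text \<open>An element counts when it lies in the first copy but not in the second, which has
  probability p (1 - p). This governs how \<open>U\<close> shrinks in one round of
  decoupling.\<close>

lemma avg_avg_power_card:
  fixes s :: real
  assumes "finite M" "W \<subseteq> M" "0 < s"
  shows "avg M (\<lambda>x. avg M (\<lambda>x'. s ^ card (W \<inter> x - x'))) = (1 - p * (1 - p) * (1 - s)) ^ card W"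
proof -
  have "avg M (\<lambda>x. avg M (\<lambda>x'. s ^ card (W \<inter> x - x'))) = avg M (\<lambda>x. (p + (1 - p) * s) ^ card (W \<inter> x))"
    using assms by (intro avg_cong avg_power_card_diff) auto
  also have "\<dots> = (1 - p + p * (p + (1 - p) * s)) ^ card W"
    by (rule avg_power_card[OF assms(1,2)])
  also have "1 - p + p * (p + (1 - p) * s) = 1 - p * (1 - p) * (1 - s)"
    by (simp add: algebra_simps)
  finally show ?thesis .
qed

end

section \<open>Almost linear phases\<close>

text \<open>For negative x put t = -x: the product (1 - t + t^2) (1 + t + t^2/2) is at least 1, and
  its second factor is at most exp t.\<close>

lemma exp_le_quadratic:
  fixes x :: real
  assumes "\<bar>x\<bar> \<le> 1"
  shows "exp x \<le> 1 + x + x\<^sup>2"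
proof (cases "0 \<le> x")
  case True
  then show ?thesis using assms exp_bound by simp
next
  case False
  define t where "t = - x"
  have t: "0 \<le> t" "t \<le> 1" using False assms by (auto simp: t_def)
  have "1 + t + t\<^sup>2 / 2 \<le> exp t" by (rule exp_lower_Taylor_quadratic) (fact t)
  then have "(1 - t + t\<^sup>2) * (1 + t + t\<^sup>2 / 2) \<le> (1 - t + t\<^sup>2) * exp t"
    using t by (intro mult_left_mono) auto
  moreover have "(1 - t + t\<^sup>2) * (1 + t + t\<^sup>2 / 2) = 1 + t\<^sup>2 / 2 + t * t\<^sup>2 / 2 + t\<^sup>2 * t\<^sup>2 / 2"
    by (simp add: field_simps power2_eq_square)
  moreover have "0 \<le> t\<^sup>2 / 2 + t * t\<^sup>2 / 2 + t\<^sup>2 * t\<^sup>2 / 2" using t by simp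
  ultimately have "1 \<le> (1 - t + t\<^sup>2) * exp t" by linarith
  then have "exp (- t) \<le> 1 - t + t\<^sup>2"
    by (simp add: exp_minus field_simps)
  then show ?thesis by (simp add: t_def)
qed

lemma power_div_fact_le_exp:
  fixes x :: real
  assumes "0 \<le> x"
  shows "x ^ n / fact n \<le> exp x"
proof -
  have "(\<Sum>k\<in>{n}. inverse (fact k) *\<^sub>R x ^ k) \<le> (\<Sum>k. inverse (fact k) *\<^sub>R x ^ k)"
    using assms by (intro sum_le_suminf summable_exp_generic) auto
  then show ?thesis by (simp add: exp_def field_simps)
qed

lemma one_minus_cos_ge:
  fixes u :: real
  assumes "\<bar>u\<bar> \<le> 1"
  shows "u\<^sup>2 / 4 \<le> 1 - cos u"
proof -
  have "\<bar>Re (iexp u - (\<Sum>k\<le>3. (\<i> * u) ^ k / fact k))\<bar> \<le> \<bar>u\<bar> ^ 4 / 24"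
    using order.trans[OF abs_Re_le_cmod iexp_approx1[of u 3]] by (simp add: fact_numeral)
  moreover have "Re (\<Sum>k\<le>3. (\<i> * u) ^ k / fact k) = 1 - u\<^sup>2 / 2"
    by (simp add: numeral_eq_Suc power2_eq_square)
  ultimately have "\<bar>cos u - (1 - u\<^sup>2 / 2)\<bar> \<le> \<bar>u\<bar> ^ 4 / 24"
    by (simp add: Re_exp)
  moreover have "\<bar>u\<bar> ^ 4 \<le> \<bar>u\<bar> ^ 2" using assms by (intro power_decreasing) auto
  moreover have "\<bar>u\<bar> ^ 2 = u\<^sup>2" by simp
  ultimately show ?thesis by linarith
qed

section \<open>Decay of linear phases, concentration, and their combination\<close>

context bernoulli_param
begin

text \<open>The squared modulus is 1 - 2 p (1 - p) (1 - cos u), and |u| \<le> 1 makes 1 - cos u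
  comparable to u^2.\<close>

lemma norm_bernoulli_cis_le:
  assumes "\<bar>u\<bar> \<le> 1" "0 \<le> \<tau>" "\<tau> \<le> \<bar>u\<bar>"
  shows "norm (1 - p + p * cis u) \<le> exp (- (p * (1 - p) * \<tau>\<^sup>2 / 4))"
proof -
  have "(norm (1 - p + p * cis u))\<^sup>2 = (1 - p + p * cos u)\<^sup>2 + (p * sin u)\<^sup>2"
    by (simp add: cmod_power2)
  also have "\<dots> = (1 - p)\<^sup>2 + 2 * (1 - p) * p * cos u + p\<^sup>2 * ((cos u)\<^sup>2 + (sin u)\<^sup>2)"
    by (simp only: power2_sum power_mult_distrib distrib_left)
  also have "(cos u)\<^sup>2 + (sin u)\<^sup>2 = 1" by simp
  also have "(1 - p)\<^sup>2 + 2 * (1 - p) * p * cos u + p\<^sup>2 * 1 = 1 - 2 * p * (1 - p) * (1 - cos u)"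
    by (simp add: power2_eq_square algebra_simps)
  also have "\<dots> \<le> 1 - 2 * p * (1 - p) * (\<tau>\<^sup>2 / 4)"
  proof -
    have "\<tau>\<^sup>2 \<le> u\<^sup>2" using assms by (metis abs_le_square_iff abs_of_nonneg)
    then have "\<tau>\<^sup>2 / 4 \<le> 1 - cos u" using one_minus_cos_ge[OF assms(1)] by simp
    then have "2 * p * (1 - p) * (\<tau>\<^sup>2 / 4) \<le> 2 * p * (1 - p) * (1 - cos u)"
      using p_pos p_less_1 by (intro mult_left_mono) auto
    then show ?thesis by simp
  qed
  also have "\<dots> \<le> exp (- (2 * p * (1 - p) * (\<tau>\<^sup>2 / 4)))"
    using exp_ge_add_one_self[of "- (2 * p * (1 - p) * (\<tau>\<^sup>2 / 4))"] by simp
  also have "\<dots> = (exp (- (p * (1 - p) * \<tau>\<^sup>2 / 4)))\<^sup>2"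
    by (simp add: power2_eq_square flip: exp_add)
  finally show ?thesis by (rule power2_le_imp_le) simp
qed

text \<open>Exponential moment bound for bounded differences, proved by averaging out one coordinate
  at a time; each coordinate costs a factor exp (l^2 c^2).\<close>

lemma avg_exp_deviation_le:
  fixes f :: "'a set \<Rightarrow> real"
  assumes "finite M" "\<And>e y. e \<in> M \<Longrightarrow> y \<subseteq> M - {e} \<Longrightarrow> \<bar>f (insert e y) - f y\<bar> \<le> c"
    and "\<bar>l\<bar> * c \<le> 1"
  shows "avg M (\<lambda>y. exp (l * (f y - avg M f))) \<le> exp (l\<^sup>2 * c\<^sup>2 * card M)"
  using assms(1,2)
proof (induction M arbitrary: f rule: finite_induct)
  case (insert e M)
  \<comment> \<open>The conditional mean given the other coordinates: it has the same mean and the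
    same Lipschitz constant, so the induction hypothesis applies to it.\<close>
  define g where "g = (\<lambda>y. p * f (insert e y) + (1 - p) * f y)"
  define \<mu> where "\<mu> = avg (insert e M) f"
  have \<mu>: "\<mu> = avg M g"
    using insert by (simp add: \<mu>_def g_def avg_insert avg_add avg_mult_left)
  have g_lip: "\<bar>g (insert a y) - g y\<bar> \<le> c" if "a \<in> M" "y \<subseteq> M - {a}" for a y
  proof -
    have 1: "\<bar>f (insert a (insert e y)) - f (insert e y)\<bar> \<le> c"
      using that insert.hyps by (intro insert.prems) auto
    have 2: "\<bar>f (insert a y) - f y\<bar> \<le> c"
      using that insert.hyps by (intro insert.prems) auto
    have "\<bar>g (insert a y) - g y\<bar> = \<bar>p * (f (insert a (insert e y)) - f (insert e y))
        + (1 - p) * (f (insert a y) - f y)\<bar>"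
      by (simp add: g_def insert_commute algebra_simps)
    also have "\<dots> \<le> p * c + (1 - p) * c"
      using p_pos p_less_1 1 2
      by (intro order.trans[OF abs_triangle_ineq] add_mono) (simp_all add: abs_mult)
    finally show ?thesis by (simp add: algebra_simps)
  qed
  have step: "p * exp (l * (f (insert e y) - \<mu>)) + (1 - p) * exp (l * (f y - \<mu>))
      \<le> exp (l\<^sup>2 * c\<^sup>2) * exp (l * (g y - \<mu>))" if "y \<subseteq> M" for y
  proof -
    define \<Delta> where "\<Delta> = f (insert e y) - f y"
    have "\<bar>\<Delta>\<bar> \<le> c" unfolding \<Delta>_def using that insert.hyps by (intro insert.prems) auto
    define a where "a = l * ((1 - p) * \<Delta>)"
    define b where "b = - (l * (p * \<Delta>))"
    have "\<bar>(1 - p) * \<Delta>\<bar> \<le> 1 * c" unfolding abs_mult using p_pos p_less_1 \<open>\<bar>\<Delta>\<bar> \<le> c\<close> by (intro mult_mono) auto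
    moreover have "\<bar>p * \<Delta>\<bar> \<le> 1 * c" unfolding abs_mult using p_pos p_less_1 \<open>\<bar>\<Delta>\<bar> \<le> c\<close> by (intro mult_mono) auto
    ultimately have ab: "\<bar>a\<bar> \<le> \<bar>l\<bar> * c" "\<bar>b\<bar> \<le> \<bar>l\<bar> * c"
      unfolding a_def b_def abs_mult abs_minus by (auto intro!: mult_left_mono simp: abs_mult)
    have sq: "a\<^sup>2 \<le> l\<^sup>2 * c\<^sup>2" "b\<^sup>2 \<le> l\<^sup>2 * c\<^sup>2"
      using power_mono[OF ab(1), of 2] power_mono[OF ab(2), of 2] by (simp_all add: power_mult_distrib)
    have fa: "l * (f (insert e y) - \<mu>) = l * (g y - \<mu>) + a"
      and fb: "l * (f y - \<mu>) = l * (g y - \<mu>) + b"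
      by (simp_all add: g_def a_def b_def \<Delta>_def algebra_simps)
    have "p * exp a + (1 - p) * exp b \<le> p * (1 + a + l\<^sup>2 * c\<^sup>2) + (1 - p) * (1 + b + l\<^sup>2 * c\<^sup>2)"
      using exp_le_quadratic[of a] exp_le_quadratic[of b] ab assms(3) sq p_pos p_less_1
      by (intro add_mono mult_left_mono) auto
    \<comment> \<open>The deviations \<open>a\<close> and \<open>b\<close> from the conditional mean
      satisfy p a + (1 - p) b = 0, so no linear term survives.\<close>
    also have "\<dots> = 1 + l\<^sup>2 * c\<^sup>2" by (simp add: a_def b_def algebra_simps)
    also have "\<dots> \<le> exp (l\<^sup>2 * c\<^sup>2)" by (rule exp_ge_add_one_self)
    finally have "(p * exp a + (1 - p) * exp b) * exp (l * (g y - \<mu>)) \<le> exp (l\<^sup>2 * c\<^sup>2) * exp (l * (g y - \<mu>))"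
      by (rule mult_right_mono) simp
    then show ?thesis unfolding fa fb exp_add by (simp add: algebra_simps)
  qed
  have "avg (insert e M) (\<lambda>y. exp (l * (f y - \<mu>)))
      = avg M (\<lambda>y. p * exp (l * (f (insert e y) - \<mu>)) + (1 - p) * exp (l * (f y - \<mu>)))"
    using insert.hyps by (simp add: avg_insert avg_add avg_mult_left)
  also have "\<dots> \<le> avg M (\<lambda>y. exp (l\<^sup>2 * c\<^sup>2) * exp (l * (g y - \<mu>)))"
    by (rule avg_mono) (rule step)
  also have "\<dots> \<le> exp (l\<^sup>2 * c\<^sup>2) * exp (l\<^sup>2 * c\<^sup>2 * card M)"
    unfolding avg_mult_left \<mu> by (intro mult_left_mono insert.IH g_lip) auto
  also have "\<dots> = exp (l\<^sup>2 * c\<^sup>2 * card (insert e M))"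
    using insert.hyps by (simp add: algebra_simps flip: exp_add)
  finally show ?case unfolding \<mu>_def .
qed simp

text \<open>Moments from the exponential moments at l and -l, by |x|^k \<le> k! exp |x|. The 6
  bounds 2 exp 1.\<close>

lemma avg_abs_deviation_power_le:
  fixes f :: "'a set \<Rightarrow> real"
  assumes "finite M" "M \<noteq> {}" "0 < c"
    and lip: "\<And>e y. e \<in> M \<Longrightarrow> y \<subseteq> M - {e} \<Longrightarrow> \<bar>f (insert e y) - f y\<bar> \<le> c"
  shows "avg M (\<lambda>y. \<bar>f y - avg M f\<bar> ^ k) \<le> 6 * fact k * (c * sqrt (card M)) ^ k"
proof -
  define s where "s = c * sqrt (card M)"
  \<comment> \<open>The inverse of the typical deviation; it turns the exponent l^2 c^2
    \<open>card M\<close> into 1.\<close>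
  define l where "l = 1 / s"
  have m: "1 \<le> sqrt (card M)" using assms by (simp add: Suc_leI card_gt_0_iff)
  then have s: "0 < s" "c \<le> s" using assms by (simp_all add: s_def)
  have lc: "\<bar>l\<bar> * c \<le> 1" using s by (simp add: l_def)
  have lcm: "l\<^sup>2 * c\<^sup>2 * card M = 1"
    using assms m by (simp add: l_def s_def power_divide power_mult_distrib card_gt_0_iff)
  have E: "avg M (\<lambda>y. exp (l * (f y - avg M f))) \<le> exp 1"
    using avg_exp_deviation_le[OF assms(1) lip lc] by (simp add: lcm)
  have E': "avg M (\<lambda>y. exp (- l * (f y - avg M f))) \<le> exp 1"
    using avg_exp_deviation_le[OF assms(1) lip, of "-l"] lc by (simp add: lcm)
  have "avg M (\<lambda>y. \<bar>f y - avg M f\<bar> ^ k)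
      \<le> avg M (\<lambda>y. (fact k * s ^ k) * (exp (l * (f y - avg M f)) + exp (- l * (f y - avg M f))))"
  proof (rule avg_mono)
    fix y
    define x where "x = l * (f y - avg M f)"
    have "\<bar>x\<bar> ^ k / fact k \<le> exp \<bar>x\<bar>" by (rule power_div_fact_le_exp) simp
    also have "\<dots> \<le> exp x + exp (- x)" by (simp add: abs_if)
    finally have "\<bar>x\<bar> ^ k \<le> fact k * (exp x + exp (- x))" by (simp add: field_simps)
    moreover have "\<bar>f y - avg M f\<bar> = s * \<bar>x\<bar>" using s by (simp add: x_def l_def abs_mult)
    ultimately show "\<bar>f y - avg M f\<bar> ^ k
        \<le> fact k * s ^ k * (exp (l * (f y - avg M f)) + exp (- l * (f y - avg M f)))"
      using s by (simp add: power_mult_distrib x_def mult.assoc mult.left_commute[of "s ^ k"])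
  qed
  also have "\<dots> \<le> (fact k * s ^ k) * (exp 1 + exp 1)"
    unfolding avg_mult_left avg_add using E E' s by (intro mult_left_mono add_mono) auto
  also have "\<dots> \<le> (fact k * s ^ k) * 6"
    using s e_less_272 by (intro mult_left_mono) auto
  finally show ?thesis by (simp add: s_def mult_ac)
qed

text \<open>The average factorises over coordinates. Those in \<open>J\<close> are forced and
  contribute a factor of modulus p, bounded by 1; each of the others still gives a factor
  \<kappa>.\<close>

lemma norm_avg_prod_monomial_le:
  fixes z :: "'a \<Rightarrow> complex"
  assumes "finite M" "J \<subseteq> M" "0 \<le> \<kappa>" "\<kappa> \<le> 1"
    and "\<And>e. e \<in> M \<Longrightarrow> norm (z e) = 1"
    and "\<And>e. e \<in> M \<Longrightarrow> norm (1 - p + p * z e) \<le> \<kappa>"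
  shows "norm (avg M (\<lambda>y. (\<Prod>e\<in>y. z e) * of_bool (J \<subseteq> y))) \<le> \<kappa> ^ (card M - card J)"
  using assms(1,2,5,6)
proof (induction M arbitrary: J rule: finite_induct)
  case (insert e M)
  have pr: "(\<Prod>a\<in>insert e y. z a) = z e * (\<Prod>a\<in>y. z a)" if "y \<subseteq> M" for y
    using that insert.hyps by (intro prod.insert) (auto intro: finite_subset)
  show ?case
  proof (cases "e \<in> J")
    case True
    define J' where "J' = J - {e}"
    have J: "J = insert e J'" "e \<notin> J'" "J' \<subseteq> M" "finite J'"
      using True insert by (auto simp: J'_def intro: finite_subset)
    have "avg M (\<lambda>y. (\<Prod>a\<in>insert e y. z a) * of_bool (J \<subseteq> insert e y))
        = avg M (\<lambda>y. z e * ((\<Prod>a\<in>y. z a) * of_bool (J' \<subseteq> y)))"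
      using J insert.hyps by (intro avg_cong) (auto simp: pr mult.assoc)
    moreover have "avg M (\<lambda>y. (\<Prod>a\<in>y. z a) * of_bool (J \<subseteq> y)) = avg M (\<lambda>y. 0)"
      using J insert.hyps by (intro avg_cong) auto
    ultimately have "norm (avg (insert e M) (\<lambda>y. (\<Prod>a\<in>y. z a) * of_bool (J \<subseteq> y)))
        = p * norm (avg M (\<lambda>y. (\<Prod>a\<in>y. z a) * of_bool (J' \<subseteq> y)))"
      using insert p_pos by (simp add: avg_insert avg_mult_left norm_mult)
    also have "\<dots> \<le> 1 * \<kappa> ^ (card M - card J')"
      using p_pos p_less_1 insert J by (intro mult_mono insert.IH) auto
    finally show ?thesis using J insert.hyps by simp
  next
    case False
    have J: "J \<subseteq> M" using False insert by auto
    have cJ: "card J \<le> card M" using J insert.hyps by (simp add: card_mono)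
    have "avg M (\<lambda>y. (\<Prod>a\<in>insert e y. z a) * of_bool (J \<subseteq> insert e y))
        = avg M (\<lambda>y. z e * ((\<Prod>a\<in>y. z a) * of_bool (J \<subseteq> y)))"
      using False by (intro avg_cong) (auto simp: pr mult.assoc)
    then have "avg (insert e M) (\<lambda>y. (\<Prod>a\<in>y. z a) * of_bool (J \<subseteq> y))
        = (1 - p + p * z e) * avg M (\<lambda>y. (\<Prod>a\<in>y. z a) * of_bool (J \<subseteq> y))"
      using insert by (simp add: avg_insert avg_mult_left scaleR_conv_of_real algebra_simps)
    also have "norm \<dots> \<le> \<kappa> * \<kappa> ^ (card M - card J)"
      unfolding norm_mult using insert J assms by (intro mult_mono insert.IH) auto
    also have "\<dots> = \<kappa> ^ (card (insert e M) - card J)"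
      using insert.hyps cJ by (simp add: Suc_diff_le)
    finally show ?thesis .
  qed
qed simp

text \<open>Induction on i, peeling off one factor Q - \<mu>. A term of Q enlarges the forced set
  \<open>J0\<close> by at most d coordinates, the term \<mu> leaves it alone, and the coefficients
  sum to at most 2 B. So i factors cost (2 B)^i and at most i d coordinates.\<close>

lemma norm_avg_prod_power_le:
  fixes z :: "'a \<Rightarrow> complex" and I :: "'t set" and J :: "'t \<Rightarrow> 'a set" and u :: "'t \<Rightarrow> real" and B :: real
  defines "Q \<equiv> \<lambda>y. \<Sum>T\<in>I. u T * of_bool (J T \<subseteq> y)"
  assumes "finite M" "J0 \<subseteq> M" "0 \<le> \<kappa>" "\<kappa> \<le> 1"
    and z: "\<And>e. e \<in> M \<Longrightarrow> norm (z e) = 1"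
      "\<And>e. e \<in> M \<Longrightarrow> norm (1 - p + p * z e) \<le> \<kappa>"
    and J: "\<And>T. T \<in> I \<Longrightarrow> J T \<subseteq> M" "\<And>T. T \<in> I \<Longrightarrow> card (J T) \<le> d"
    and u: "\<And>T. T \<in> I \<Longrightarrow> 0 \<le> u T" "(\<Sum>T\<in>I. u T) \<le> B"
    and \<mu>: "\<bar>\<mu>\<bar> \<le> B"
  shows "norm (avg M (\<lambda>y. (\<Prod>e\<in>y. z e) * of_real (Q y - \<mu>) ^ i * of_bool (J0 \<subseteq> y)))
    \<le> (2 * B) ^ i * \<kappa> ^ (card M - card J0 - i * d)"
  using assms(3)
proof (induction i arbitrary: J0)
  case 0
  show ?case
    using norm_avg_prod_monomial_le[OF assms(2) 0 assms(4,5) z] by simp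
next
  case (Suc i)
  define W where "W J0 = avg M (\<lambda>y. (\<Prod>e\<in>y. z e) * of_real (Q y - \<mu>) ^ i * of_bool (J0 \<subseteq> y))" for J0
  have B: "0 \<le> B" using \<mu> by linarith
  have "avg M (\<lambda>y. (\<Prod>e\<in>y. z e) * of_real (Q y - \<mu>) ^ Suc i * of_bool (J0 \<subseteq> y))
      = avg M (\<lambda>y. (\<Sum>T\<in>I. of_real (u T) * ((\<Prod>e\<in>y. z e) * of_real (Q y - \<mu>) ^ i * of_bool (J0 \<union> J T \<subseteq> y)))
          - of_real \<mu> * ((\<Prod>e\<in>y. z e) * of_real (Q y - \<mu>) ^ i * of_bool (J0 \<subseteq> y)))"
  proof (rule avg_cong)
    fix y
    let ?P = "(\<Prod>e\<in>y. z e) * of_real (Q y - \<mu>) ^ i"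
    have "of_real (Q y) * of_bool (J0 \<subseteq> y) = (\<Sum>T\<in>I. complex_of_real (u T) * of_bool (J0 \<union> J T \<subseteq> y))"
      by (auto simp: Q_def intro!: sum.cong)
    then have "?P * (of_real (Q y) * of_bool (J0 \<subseteq> y))
        = (\<Sum>T\<in>I. of_real (u T) * (?P * of_bool (J0 \<union> J T \<subseteq> y)))"
      by (simp add: sum_distrib_left mult_ac)
    then show "(\<Prod>e\<in>y. z e) * of_real (Q y - \<mu>) ^ Suc i * of_bool (J0 \<subseteq> y)
      = (\<Sum>T\<in>I. of_real (u T) * (?P * of_bool (J0 \<union> J T \<subseteq> y))) - of_real \<mu> * (?P * of_bool (J0 \<subseteq> y))"
      by (simp add: algebra_simps)
  qed simp
  also have "\<dots> = (\<Sum>T\<in>I. of_real (u T) * W (J0 \<union> J T)) - of_real \<mu> * W J0"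
    unfolding avg_diff avg_sum avg_mult_left W_def ..
  also have "norm \<dots> \<le> (\<Sum>T\<in>I. u T * ((2 * B) ^ i * \<kappa> ^ (card M - card J0 - Suc i * d)))
      + B * ((2 * B) ^ i * \<kappa> ^ (card M - card J0 - Suc i * d))"
  proof (intro order.trans[OF norm_triangle_ineq4] add_mono order.trans[OF norm_sum] sum_mono)
    fix T assume T: "T \<in> I"
    have "norm (W (J0 \<union> J T)) \<le> (2 * B) ^ i * \<kappa> ^ (card M - card (J0 \<union> J T) - i * d)"
      unfolding W_def using Suc.prems J T by (intro Suc.IH) auto
    also have "\<dots> \<le> (2 * B) ^ i * \<kappa> ^ (card M - card J0 - Suc i * d)"
    proof (intro mult_left_mono power_decreasing assms)
      have "card (J0 \<union> J T) \<le> card J0 + d"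
        using card_Un_le[of J0 "J T"] J(2)[OF T] by linarith
      then show "card M - card J0 - Suc i * d \<le> card M - card (J0 \<union> J T) - i * d" by simp
    qed (use B in simp)
    finally show "norm (complex_of_real (u T) * W (J0 \<union> J T)) \<le> u T * ((2 * B) ^ i * \<kappa> ^ (card M - card J0 - Suc i * d))"
      using u(1)[OF T] by (simp add: norm_mult mult_left_mono)
  next
    have "norm (W J0) \<le> (2 * B) ^ i * \<kappa> ^ (card M - card J0 - i * d)"
      unfolding W_def by (rule Suc.IH) fact
    also have "\<dots> \<le> (2 * B) ^ i * \<kappa> ^ (card M - card J0 - Suc i * d)"
      using B assms by (intro mult_left_mono power_decreasing) auto
    finally show "norm (complex_of_real \<mu> * W J0) \<le> B * ((2 * B) ^ i * \<kappa> ^ (card M - card J0 - Suc i * d))"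
      using \<mu> B unfolding norm_mult by (intro mult_mono) auto
  qed
  also have "\<dots> \<le> B * ((2 * B) ^ i * \<kappa> ^ (card M - card J0 - Suc i * d))
      + B * ((2 * B) ^ i * \<kappa> ^ (card M - card J0 - Suc i * d))"
    unfolding sum_distrib_right[symmetric] using u(2) B assms
    by (intro add_mono mult_right_mono mult_nonneg_nonneg) auto
  finally show ?case by (simp add: algebra_simps)
qed

text \<open>The phase is linear up to a perturbation \<open>Q\<close> of small Lipschitz constant. Expanding
  \<open>cis (\<theta> * (Q - \<mu>))\<close> into its Taylor series, every monomial of the Taylor polynomial fixes only
  boundedly many coordinates, so the remaining ones still produce the decay of the linear part,
  while the remainder is controlled by the moments of \<open>Q - \<mu>\<close>.\<close>

lemma norm_avg_cis_almost_linear_le: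
  fixes I :: "'t set" and J :: "'t \<Rightarrow> 'a set" and u :: "'t \<Rightarrow> real" and b :: "'a \<Rightarrow> real"
    and B c c0 \<theta> \<tau> :: real
  defines "Q \<equiv> \<lambda>y. \<Sum>T\<in>I. u T * of_bool (J T \<subseteq> y)"
  assumes fin: "finite M" "M \<noteq> {}" "finite I" and \<tau>: "0 \<le> \<tau>" and c: "0 < c"
    and b: "\<And>e. e \<in> M \<Longrightarrow> \<bar>\<theta> * b e\<bar> \<le> 1" "\<And>e. e \<in> M \<Longrightarrow> \<tau> \<le> \<bar>\<theta> * b e\<bar>"
    and J: "\<And>T. T \<in> I \<Longrightarrow> J T \<subseteq> M" "\<And>T. T \<in> I \<Longrightarrow> card (J T) \<le> d"
    and u: "\<And>T. T \<in> I \<Longrightarrow> 0 \<le> u T" "(\<Sum>T\<in>I. u T) \<le> B"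
    and lip: "\<And>e. e \<in> M \<Longrightarrow> (\<Sum>T\<in>{T\<in>I. e \<in> J T}. u T) \<le> c"
  shows "norm (avg M (\<lambda>y. cis (\<theta> * (c0 + (\<Sum>e\<in>y. b e) + Q y))))
    \<le> Suc n * (1 + 2 * B * \<bar>\<theta>\<bar>) ^ n * exp (- (p * (1 - p) * \<tau>\<^sup>2 / 4)) ^ (card M - n * d)
      + 6 * (\<bar>\<theta>\<bar> * (c * sqrt (card M))) ^ Suc n"
proof -
  define \<kappa> where "\<kappa> = exp (- (p * (1 - p) * \<tau>\<^sup>2 / 4))"
  define \<mu> where "\<mu> = avg M Q"
  define z where "z e = cis (\<theta> * b e)" for e
  define G where "G y = (\<Prod>e\<in>y. z e)" for y
  have \<kappa>: "0 \<le> \<kappa>" "\<kappa> \<le> 1" using p_pos p_less_1 by (auto simp: \<kappa>_def)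
  have z: "norm (z e) = 1" for e by (simp add: z_def)
  have z': "norm (1 - p + p * z e) \<le> \<kappa>" if "e \<in> M" for e
    unfolding z_def \<kappa>_def using b[OF that] \<tau> by (intro norm_bernoulli_cis_le) auto
  have Q: "0 \<le> Q y" "Q y \<le> B" for y
  proof -
    show "0 \<le> Q y" unfolding Q_def using u by (intro sum_nonneg) auto
    have "Q y \<le> (\<Sum>T\<in>I. u T)" unfolding Q_def using u by (intro sum_mono) auto
    then show "Q y \<le> B" using u by linarith
  qed
  have "0 \<le> \<mu>" "\<mu> \<le> B" unfolding \<mu>_def using Q fin by (auto intro: avg_nonneg avg_le_const)
  then have \<mu>: "\<bar>\<mu>\<bar> \<le> B" and B: "0 \<le> B" by auto
  have Q_lip: "\<bar>Q (insert e y) - Q y\<bar> \<le> c" if e: "e \<in> M" "y \<subseteq> M - {e}" for e y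
  proof -
    have "Q (insert e y) - Q y = (\<Sum>T\<in>I. u T * (of_bool (J T \<subseteq> insert e y) - of_bool (J T \<subseteq> y)))"
      by (simp add: Q_def sum_subtractf algebra_simps)
    also have "\<bar>\<dots>\<bar> \<le> (\<Sum>T\<in>I. if e \<in> J T then u T else 0)"
      using u e by (intro order.trans[OF sum_abs] sum_mono) auto
    also have "\<dots> = (\<Sum>T\<in>{T\<in>I. e \<in> J T}. u T)" using fin by (simp add: sum.inter_filter)
    finally show ?thesis using lip[OF e(1)] by linarith
  qed
  have G: "norm (G y) = 1" for y by (simp add: G_def prod_norm[symmetric] z)
  have cis_sum: "cis (\<theta> * (\<Sum>e\<in>y. b e)) = G y" if "y \<subseteq> M" for y
  proof -
    have "finite y" using that fin finite_subset by auto
    then show ?thesis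
      by (induction y rule: finite_induct) (auto simp: G_def z_def distrib_left simp flip: cis_mult)
  qed
  \<comment> \<open>The Taylor polynomial of \<open>cis\<close>. Here \<open>n\<close> is its
    degree, not the number of vertices.\<close>
  define P where "P x = (\<Sum>k\<le>n. (\<i> * of_real x) ^ k / fact k)" for x :: real
  have "avg M (\<lambda>y. cis (\<theta> * (c0 + (\<Sum>e\<in>y. b e) + Q y)))
      = avg M (\<lambda>y. cis (\<theta> * (c0 + \<mu>)) * (G y * cis (\<theta> * (Q y - \<mu>))))"
    by (intro avg_cong) (auto simp: cis_sum[symmetric] cis_mult algebra_simps)
  then have "norm (avg M (\<lambda>y. cis (\<theta> * (c0 + (\<Sum>e\<in>y. b e) + Q y))))
      = norm (avg M (\<lambda>y. G y * cis (\<theta> * (Q y - \<mu>))))"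
    by (simp add: avg_mult_left norm_mult)
  also have "avg M (\<lambda>y. G y * cis (\<theta> * (Q y - \<mu>)))
      = avg M (\<lambda>y. G y * P (\<theta> * (Q y - \<mu>)))
        + avg M (\<lambda>y. G y * (cis (\<theta> * (Q y - \<mu>)) - P (\<theta> * (Q y - \<mu>))))"
    unfolding avg_add[symmetric] by (simp add: algebra_simps)
  also have "norm \<dots> \<le> Suc n * ((1 + 2 * B * \<bar>\<theta>\<bar>) ^ n * \<kappa> ^ (card M - n * d))
      + 6 * (\<bar>\<theta>\<bar> * (c * sqrt (card M))) ^ Suc n"
  proof (intro order.trans[OF norm_triangle_ineq] add_mono)
    \<comment> \<open>The indicator of {} \<subseteq> y is constantly 1; it brings the terms into
      the form of \<open>norm_avg_prod_power_le\<close> with nothing forced at the start.\<close>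
    have "avg M (\<lambda>y. G y * P (\<theta> * (Q y - \<mu>)))
        = avg M (\<lambda>y. \<Sum>k\<le>n. ((\<i> * \<theta>) ^ k / fact k) * (G y * of_real (Q y - \<mu>) ^ k * of_bool ({} \<subseteq> y)))"
      by (intro avg_cong) (auto simp: P_def sum_distrib_left power_mult_distrib mult_ac)
    also have "\<dots> = (\<Sum>k\<le>n. ((\<i> * \<theta>) ^ k / fact k) * avg M (\<lambda>y. G y * of_real (Q y - \<mu>) ^ k * of_bool ({} \<subseteq> y)))"
      by (simp only: avg_sum avg_mult_left)
    also have "norm \<dots> \<le> (\<Sum>k\<le>n. (1 + 2 * B * \<bar>\<theta>\<bar>) ^ n * \<kappa> ^ (card M - n * d))"
    proof (intro order.trans[OF norm_sum] sum_mono)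
      fix k assume k: "k \<in> {..n}"
      have "norm (((\<i> * \<theta>) ^ k / fact k) * avg M (\<lambda>y. G y * of_real (Q y - \<mu>) ^ k * of_bool ({} \<subseteq> y)))
          \<le> \<bar>\<theta>\<bar> ^ k * ((2 * B) ^ k * \<kappa> ^ (card M - card ({} :: 'a set) - k * d))"
      proof -
        have 1: "norm ((\<i> * complex_of_real \<theta>) ^ k / fact k) \<le> \<bar>\<theta>\<bar> ^ k"
        proof -
          have "norm ((\<i> * complex_of_real \<theta>) ^ k / fact k) = \<bar>\<theta>\<bar> ^ k / fact k"
            by (simp add: norm_divide norm_power norm_mult)
          also have "\<dots> \<le> \<bar>\<theta>\<bar> ^ k / 1" by (intro divide_left_mono) (auto simp: fact_ge_1)
          finally show ?thesis by simp
        qed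
        have 2: "norm (avg M (\<lambda>y. G y * of_real (Q y - \<mu>) ^ k * of_bool ({} \<subseteq> y)))
            \<le> (2 * B) ^ k * \<kappa> ^ (card M - card ({} :: 'a set) - k * d)"
          unfolding G_def Q_def
          by (rule norm_avg_prod_power_le) (use fin \<kappa> z z' J u \<mu> in auto)
        show ?thesis unfolding norm_mult by (rule mult_mono[OF 1 2]) auto
      qed
      also have "\<dots> = (2 * B * \<bar>\<theta>\<bar>) ^ k * \<kappa> ^ (card M - k * d)"
        by (simp add: power_mult_distrib mult_ac)
      also have "\<dots> \<le> (1 + 2 * B * \<bar>\<theta>\<bar>) ^ n * \<kappa> ^ (card M - n * d)"
      proof (intro mult_mono)
        have "(2 * B * \<bar>\<theta>\<bar>) ^ k \<le> (1 + 2 * B * \<bar>\<theta>\<bar>) ^ k" using B by (intro power_mono) auto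
        also have "\<dots> \<le> (1 + 2 * B * \<bar>\<theta>\<bar>) ^ n" using B k by (intro power_increasing) auto
        finally show "(2 * B * \<bar>\<theta>\<bar>) ^ k \<le> (1 + 2 * B * \<bar>\<theta>\<bar>) ^ n" .
        show "\<kappa> ^ (card M - k * d) \<le> \<kappa> ^ (card M - n * d)"
          using \<kappa> k by (intro power_decreasing diff_le_mono2 mult_right_mono) auto
      qed (use B \<kappa> in auto)
      finally show "norm (((\<i> * \<theta>) ^ k / fact k) * avg M (\<lambda>y. G y * of_real (Q y - \<mu>) ^ k * of_bool ({} \<subseteq> y)))
          \<le> (1 + 2 * B * \<bar>\<theta>\<bar>) ^ n * \<kappa> ^ (card M - n * d)" .
    qed
    finally show "norm (avg M (\<lambda>y. G y * P (\<theta> * (Q y - \<mu>)))) \<le> Suc n * ((1 + 2 * B * \<bar>\<theta>\<bar>) ^ n * \<kappa> ^ (card M - n * d))"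
      by simp
  next
    have "norm (avg M (\<lambda>y. G y * (cis (\<theta> * (Q y - \<mu>)) - P (\<theta> * (Q y - \<mu>)))))
        \<le> avg M (\<lambda>y. (\<bar>\<theta>\<bar> ^ Suc n / fact (Suc n)) * \<bar>Q y - \<mu>\<bar> ^ Suc n)"
    proof (intro order.trans[OF norm_avg_le] avg_mono)
      fix y
      show "norm (G y * (cis (\<theta> * (Q y - \<mu>)) - P (\<theta> * (Q y - \<mu>))))
          \<le> (\<bar>\<theta>\<bar> ^ Suc n / fact (Suc n)) * \<bar>Q y - \<mu>\<bar> ^ Suc n"
        using iexp_approx1[of "\<theta> * (Q y - \<mu>)" n]
        unfolding norm_mult G P_def cis_conv_exp abs_mult power_mult_distrib by simp
    qed
    also have "\<dots> \<le> (\<bar>\<theta>\<bar> ^ Suc n / fact (Suc n)) * (6 * fact (Suc n) * (c * sqrt (card M)) ^ Suc n)"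
      unfolding avg_mult_left \<mu>_def
      by (intro mult_left_mono avg_abs_deviation_power_le fin c Q_lip) auto
    also have "\<dots> = 6 * (\<bar>\<theta>\<bar> * (c * sqrt (card M))) ^ Suc n"
      by (simp add: power_mult_distrib field_simps del: power_Suc fact_Suc)
    finally show "norm (avg M (\<lambda>y. G y * (cis (\<theta> * (Q y - \<mu>)) - P (\<theta> * (Q y - \<mu>)))))
        \<le> 6 * (\<bar>\<theta>\<bar> * (c * sqrt (card M))) ^ Suc n" .
  qed
  finally show ?thesis by (simp add: \<kappa>_def mult_ac)
qed

end

section \<open>Weighted sums over vertex sets as almost linear phases\<close>

definition pairs :: "'a set \<Rightarrow> 'a set set" where
  "pairs A = {e. e \<subseteq> A \<and> card e = 2}"

lemma finite_pairs [simp]: "finite A \<Longrightarrow> finite (pairs A)"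
  by (auto simp: pairs_def intro: finite_subset[of _ "Pow A"])

lemma card_pairs: "finite A \<Longrightarrow> card (pairs A) = card A choose 2"
  unfolding pairs_def by (rule n_subsets)

lemma pairs_mono: "A \<subseteq> B \<Longrightarrow> pairs A \<subseteq> pairs B"
  by (auto simp: pairs_def)

lemma pairs_card_2: "card e = 2 \<Longrightarrow> pairs e = {e}"
  using card_subset_eq[of e] card_ge_0_finite[of e] by (auto simp: pairs_def)

lemma pairs_card_le_1: "finite A \<Longrightarrow> card A \<le> 1 \<Longrightarrow> pairs A = {}"
  by (auto simp: pairs_def dest: card_mono)

lemma card_supersets_le:
  assumes "finite V" "P \<subseteq> V" "card P \<le> h"
  shows "card {T. T \<subseteq> V \<and> card T = h \<and> P \<subseteq> T} \<le> card V ^ (h - card P)"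
proof -
  have finP: "finite P" using assms finite_subset by auto
  have "card {T. T \<subseteq> V \<and> card T = h \<and> P \<subseteq> T} \<le> card {S. S \<subseteq> V \<and> card S = h - card P}"
  proof (rule card_inj_on_le[where f = "\<lambda>T. T - P"])
    show "inj_on (\<lambda>T. T - P) {T. T \<subseteq> V \<and> card T = h \<and> P \<subseteq> T}"
      by (intro inj_onI) blast
    show "(\<lambda>T. T - P) ` {T. T \<subseteq> V \<and> card T = h \<and> P \<subseteq> T} \<subseteq> {S. S \<subseteq> V \<and> card S = h - card P}"
      using finP by (auto simp: card_Diff_subset)
  qed (use assms in auto)
  also have "\<dots> = card V choose (h - card P)" by (rule n_subsets) fact
  also have "\<dots> \<le> card V ^ (h - card P)"
    by (cases "h - card P \<le> card V") (auto intro: binomial_le_pow simp: binomial_eq_0)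
  finally show ?thesis .
qed

context bernoulli_param
begin

text \<open>With the edges of \<open>A\<close> outside \<open>pairs U\<close> fixed, a set T
  contributes a constant, a linear term or a perturbation according as it meets \<open>U\<close> in
  at most one, exactly two or at least three vertices. A linear coefficient lies between \<beta> and
  n^(k-1), and an edge affects at most |A| n^(k-2) perturbation terms, which gives the Lipschitz
  constant.\<close>

lemma norm_avg_cis_supersets_le:
  fixes V A U C :: "'a set" and v :: "'a set \<Rightarrow> real" and \<theta> \<beta> :: real and h k N :: nat
  defines "\<T> \<equiv> {T. T \<subseteq> V \<and> card T = h}" and "n \<equiv> card V"
  assumes fin: "finite V" and sub: "A \<subseteq> V" "U \<subseteq> A" "C \<subseteq> V" "C \<inter> A = {}"
    and h: "h = card C + k + 1" "1 \<le> k" and \<beta>: "0 \<le> \<beta>"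
    and v: "\<And>T. T \<in> \<T> \<Longrightarrow> T \<inter> U \<noteq> {} \<Longrightarrow> v T = 0 \<or> v T = 1"
      "\<And>T. T \<in> \<T> \<Longrightarrow> T \<inter> U \<noteq> {} \<Longrightarrow> v T \<noteq> 0 \<Longrightarrow> C \<subseteq> T"
    and low: "\<And>e. e \<in> pairs U \<Longrightarrow> \<beta> \<le> card {T \<in> \<T>. T \<inter> A = e \<and> v T = 1}"
    and \<theta>: "\<bar>\<theta>\<bar> * real n ^ (k - 1) \<le> 1" and U: "pairs U \<noteq> {}"
  shows "norm (avg (pairs A) (\<lambda>y. cis (\<theta> * (\<Sum>T\<in>\<T>. v T * of_bool (pairs (T \<inter> A) \<subseteq> y)))))
    \<le> Suc N * (1 + 2 * real n ^ h * \<bar>\<theta>\<bar>) ^ N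
        * exp (- (p * (1 - p) * (\<bar>\<theta>\<bar> * \<beta>)\<^sup>2 / 4)) ^ (card (pairs U) - N * h\<^sup>2)
      + 6 * (\<bar>\<theta>\<bar> * (card A * real n ^ (k - 1) / n * sqrt (card (pairs U)))) ^ Suc N"
    (is "_ \<le> ?bound")
proof -
  have finA: "finite A" and finU: "finite U" and finC: "finite C"
    using fin sub by (auto intro: finite_subset)
  have fin\<T>: "finite \<T>" using fin by (auto simp: \<T>_def intro: finite_subset[of _ "Pow V"])
  have UV: "U \<subseteq> V" using sub by auto
  have finT: "finite T" if "T \<in> \<T>" for T using that fin by (auto simp: \<T>_def intro: finite_subset)
  obtain a0 where a0: "a0 \<in> U" using U by (auto simp: pairs_def) (metis card.empty ex_in_conv subset_empty zero_neq_numeral)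
  have n0: "0 < n" using a0 UV fin by (auto simp: n_def card_gt_0_iff)
  have A0: "0 < card A" using a0 sub finA by (auto simp: card_gt_0_iff)
  have cardU: "card U \<le> card A" using sub finA by (simp add: card_mono)
  have PU: "pairs U \<subseteq> pairs A" using sub by (intro pairs_mono)
  have count: "card {T \<in> \<T>. P \<subseteq> T} \<le> n ^ (h - card P)" if "P \<subseteq> V" "card P \<le> h" for P
    using card_supersets_le[OF fin that] by (simp add: \<T>_def n_def conj_assoc)
  have "avg (pairs A) (\<lambda>y. cis (\<theta> * (\<Sum>T\<in>\<T>. v T * of_bool (pairs (T \<inter> A) \<subseteq> y))))
    = avg (pairs A - pairs U \<union> pairs U) (\<lambda>y. cis (\<theta> * (\<Sum>T\<in>\<T>. v T * of_bool (pairs (T \<inter> A) \<subseteq> y))))"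
    using PU by (intro avg_cong) auto
  also have "\<dots> = avg (pairs A - pairs U) (\<lambda>y'. avg (pairs U)
      (\<lambda>y. cis (\<theta> * (\<Sum>T\<in>\<T>. v T * of_bool (pairs (T \<inter> A) \<subseteq> y' \<union> y)))))"
    using finA finU by (intro avg_Un) auto
  also have "norm \<dots> \<le> ?bound"
  proof (rule order.trans[OF norm_avg_le], rule avg_le_const)
    fix y' assume y': "y' \<subseteq> pairs A - pairs U"
    \<comment> \<open>The already fixed edges enter the weight, so that only a condition on edges
      inside \<open>U\<close> remains.\<close>
    define w where "w T = v T * of_bool (pairs (T \<inter> A) - pairs U \<subseteq> y')" for T
    define I where "I = {T \<in> \<T>. 3 \<le> card (T \<inter> U)}"
    define b where "b e = (\<Sum>T\<in>{T \<in> \<T>. T \<inter> U = e}. w T)" for e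
    \<comment> \<open>These sets impose no condition on y. Weights of sets missing \<open>U\<close>
      may be any real numbers; they only rotate the average and leave its norm unchanged.\<close>
    define c0 where "c0 = (\<Sum>T\<in>{T \<in> \<T>. card (T \<inter> U) \<le> 1}. w T)"
    have w01: "0 \<le> w T" "w T \<le> of_bool (C \<subseteq> T)" if "T \<in> \<T>" "T \<inter> U \<noteq> {}" for T
      using v[OF that] by (auto simp: w_def)
    have dec: "(\<Sum>T\<in>\<T>. v T * of_bool (pairs (T \<inter> A) \<subseteq> y' \<union> y))
        = c0 + (\<Sum>e\<in>y. b e) + (\<Sum>T\<in>I. w T * of_bool (pairs (T \<inter> U) \<subseteq> y))" if y: "y \<subseteq> pairs U" for y
    proof -
      have finy: "finite y" using y finU finite_subset by (meson finite_pairs)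
      have "(\<Sum>T\<in>\<T>. v T * of_bool (pairs (T \<inter> A) \<subseteq> y' \<union> y))
          = (\<Sum>T\<in>\<T>. w T * of_bool (pairs (T \<inter> U) \<subseteq> y))"
      proof (rule sum.cong)
        fix T
        have "pairs (T \<inter> A) \<inter> pairs U = pairs (T \<inter> U)" using sub by (auto simp: pairs_def)
        then have "pairs (T \<inter> A) \<subseteq> y' \<union> y \<longleftrightarrow> pairs (T \<inter> A) - pairs U \<subseteq> y' \<and> pairs (T \<inter> U) \<subseteq> y"
          using y y' by blast
        then show "v T * of_bool (pairs (T \<inter> A) \<subseteq> y' \<union> y) = w T * of_bool (pairs (T \<inter> U) \<subseteq> y)"
          by (simp add: w_def)
      qed simp
      also have "\<dots> = (\<Sum>T\<in>{T \<in> \<T>. card (T \<inter> U) \<le> 1}. w T * of_bool (pairs (T \<inter> U) \<subseteq> y))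
          + (\<Sum>T\<in>{T \<in> \<T>. card (T \<inter> U) = 2}. w T * of_bool (pairs (T \<inter> U) \<subseteq> y))
          + (\<Sum>T\<in>I. w T * of_bool (pairs (T \<inter> U) \<subseteq> y))"
      proof -
        have "\<T> = ({T \<in> \<T>. card (T \<inter> U) \<le> 1} \<union> {T \<in> \<T>. card (T \<inter> U) = 2}) \<union> I"
          by (auto simp: I_def)
        then show ?thesis
          using fin\<T> by (subst (1) \<open>\<T> = _\<close>, subst sum.union_disjoint, (auto simp: I_def)[3],
            subst sum.union_disjoint) auto
      qed
      also have "(\<Sum>T\<in>{T \<in> \<T>. card (T \<inter> U) \<le> 1}. w T * of_bool (pairs (T \<inter> U) \<subseteq> y)) = c0"
        unfolding c0_def using finU by (intro sum.cong) (auto simp: pairs_card_le_1)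
      also have "(\<Sum>T\<in>{T \<in> \<T>. card (T \<inter> U) = 2}. w T * of_bool (pairs (T \<inter> U) \<subseteq> y))
          = (\<Sum>T\<in>{T \<in> \<T>. T \<inter> U \<in> y}. w T)"
      proof -
        have "{T \<in> \<T>. T \<inter> U \<in> y} \<subseteq> {T \<in> \<T>. card (T \<inter> U) = 2}" using y by (auto simp: pairs_def)
        then show ?thesis
          using fin\<T> by (intro sum.mono_neutral_cong_right) (auto simp: pairs_card_2)
      qed
      also have "\<dots> = (\<Sum>e\<in>y. b e)"
        unfolding b_def using fin\<T> finy by (subst sum.group[symmetric, where g = "\<lambda>T. T \<inter> U" and T = y])
          (auto intro!: sum.cong)
      finally show ?thesis .
    qed
    have "avg (pairs U) (\<lambda>y. cis (\<theta> * (\<Sum>T\<in>\<T>. v T * of_bool (pairs (T \<inter> A) \<subseteq> y' \<union> y))))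
      = avg (pairs U) (\<lambda>y. cis (\<theta> * (c0 + (\<Sum>e\<in>y. b e) + (\<Sum>T\<in>I. w T * of_bool (pairs (T \<inter> U) \<subseteq> y)))))"
      by (intro avg_cong) (auto simp: dec)
    also have "norm \<dots> \<le> Suc N * (1 + 2 * real n ^ h * \<bar>\<theta>\<bar>) ^ N
        * exp (- (p * (1 - p) * (\<bar>\<theta>\<bar> * \<beta>)\<^sup>2 / 4)) ^ (card (pairs U) - N * h\<^sup>2)
      + 6 * (\<bar>\<theta>\<bar> * ((card A * real n ^ (k - 1) / n) * sqrt (card (pairs U)))) ^ Suc N"
    proof (rule norm_avg_cis_almost_linear_le)
      show "finite (pairs U)" "pairs U \<noteq> {}" using finU U by auto
      show "finite I" using fin\<T> by (simp add: I_def)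
      show "0 \<le> \<bar>\<theta>\<bar> * \<beta>" using \<beta> by simp
      show "0 < card A * real n ^ (k - 1) / n" using n0 A0 by simp
    next
      fix e assume e: "e \<in> pairs U"
      have e2: "card e = 2" "e \<subseteq> U" using e by (auto simp: pairs_def)
      have fine: "finite e" using e2 finU finite_subset by auto
      have Ce: "C \<inter> e = {}" using e2 sub by auto
      have cardCe: "card (C \<union> e) = card C + 2" using Ce fine finC e2 by (simp add: card_Un_disjoint)
      have meets: "T \<inter> U \<noteq> {}" if "T \<inter> U = e" for T using that e2 by auto
      have b0: "0 \<le> b e" unfolding b_def by (intro sum_nonneg) (use w01 meets in auto)
      have "b e \<le> (\<Sum>T\<in>{T \<in> \<T>. T \<inter> U = e}. of_bool (C \<subseteq> T))"
        unfolding b_def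
      proof (rule sum_mono)
        fix T assume "T \<in> {T \<in> \<T>. T \<inter> U = e}"
        then show "w T \<le> of_bool (C \<subseteq> T)" using meets[of T] by (intro w01) auto
      qed
      also have "\<dots> = card {T \<in> \<T>. T \<inter> U = e \<and> C \<subseteq> T}"
        using fin\<T> by (simp add: sum.If_cases of_bool_def Int_def conj_assoc)
      also have "\<dots> \<le> card {T \<in> \<T>. C \<union> e \<subseteq> T}"
        using fin\<T> by (intro of_nat_mono card_mono) auto
      also have "\<dots> \<le> n ^ (k - 1)"
        using count[of "C \<union> e"] cardCe sub e2 h by (intro of_nat_mono) (auto simp: numeral_2_eq_2)
      finally have "b e \<le> real n ^ (k - 1)" by simp
      then have "\<bar>\<theta>\<bar> * b e \<le> \<bar>\<theta>\<bar> * real n ^ (k - 1)" by (intro mult_left_mono) auto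
      then show "\<bar>\<theta> * b e\<bar> \<le> 1" using \<theta> b0 by (simp add: abs_mult)
      \<comment> \<open>A set meeting all of \<open>A\<close> in \<open>e\<close> alone needs no
        edge of \<open>A\<close> outside \<open>U\<close>, so its weight survives whatever y'
        is.\<close>
      have "\<beta> \<le> card {T \<in> \<T>. T \<inter> A = e \<and> v T = 1}" using low[OF e] .
      also have "\<dots> = (\<Sum>T\<in>{T \<in> \<T>. T \<inter> A = e \<and> v T = 1}. w T)"
      proof -
        have "w T = 1" if "T \<inter> A = e" "v T = 1" for T
          using that e by (auto simp: w_def pairs_card_2[OF e2(1)])
        then show ?thesis by simp
      qed
      also have "\<dots> \<le> b e"
        unfolding b_def
      proof (rule sum_mono2)
        show "{T \<in> \<T>. T \<inter> A = e \<and> v T = 1} \<subseteq> {T \<in> \<T>. T \<inter> U = e}" using e2 sub by auto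
      qed (use fin\<T> w01 meets in auto)
      finally have "\<bar>\<theta>\<bar> * \<beta> \<le> \<bar>\<theta>\<bar> * b e" by (intro mult_left_mono) auto
      then show "\<bar>\<theta>\<bar> * \<beta> \<le> \<bar>\<theta> * b e\<bar>" using b0 by (simp add: abs_mult)
      show "(\<Sum>T\<in>{T \<in> I. e \<in> pairs (T \<inter> U)}. w T) \<le> card A * real n ^ (k - 1) / n"
      proof -
        let ?S = "{T \<in> I. e \<in> pairs (T \<inter> U)}"
        have "(\<Sum>T\<in>?S. w T) \<le> (\<Sum>T\<in>?S. of_bool (C \<subseteq> T))"
        proof (rule sum_mono)
          fix T assume "T \<in> ?S"
          then have "T \<in> \<T>" "T \<inter> U \<noteq> {}" by (auto simp: I_def)
          then show "w T \<le> of_bool (C \<subseteq> T)" by (rule w01)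
        qed
        also have "\<dots> = card {T \<in> ?S. C \<subseteq> T}"
          using fin\<T> by (simp add: sum.If_cases of_bool_def Int_def I_def conj_assoc)
        also have "\<dots> \<le> card (\<Union>a\<in>U - e. {T \<in> \<T>. C \<union> insert a e \<subseteq> T})"
        proof (intro of_nat_mono card_mono)
          show "finite (\<Union>a\<in>U - e. {T \<in> \<T>. C \<union> insert a e \<subseteq> T})" using finU fin\<T> by auto
          show "{T \<in> ?S. C \<subseteq> T} \<subseteq> (\<Union>a\<in>U - e. {T \<in> \<T>. C \<union> insert a e \<subseteq> T})"
          proof
            fix T assume T: "T \<in> {T \<in> ?S. C \<subseteq> T}"
            then have "e \<subseteq> T" "T \<in> \<T>" "3 \<le> card (T \<inter> U)" by (auto simp: I_def pairs_def)
            then have "\<not> T \<inter> U \<subseteq> e" using card_mono[OF fine, of "T \<inter> U"] e2 by auto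
            then show "T \<in> (\<Union>a\<in>U - e. {T \<in> \<T>. C \<union> insert a e \<subseteq> T})"
              using T \<open>e \<subseteq> T\<close> \<open>T \<in> \<T>\<close> by auto
          qed
        qed
        also have "\<dots> \<le> (\<Sum>a\<in>U - e. real (card {T \<in> \<T>. C \<union> insert a e \<subseteq> T}))"
          using finU by (simp flip: of_nat_sum add: card_UN_le del: of_nat_sum)
        also have "\<dots> \<le> (\<Sum>a\<in>U - e. real n ^ (k - 1) / n)"
        proof (rule sum_mono)
          fix a assume a: "a \<in> U - e"
          have card3: "card (C \<union> insert a e) = card C + 3"
          proof -
            have "C \<inter> insert a e = {}" using a sub e2 by auto
            then show ?thesis using fine finC e2 a by (simp add: card_Un_disjoint)
          qed
          \<comment> \<open>The bound is n^(k-2), written as a quotient to cover k = 1: there C with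
            three further vertices exceeds h, and no set qualifies.\<close>
          show "real (card {T \<in> \<T>. C \<union> insert a e \<subseteq> T}) \<le> real n ^ (k - 1) / n"
          proof (cases "k = 1")
            case True
            have "\<not> C \<union> insert a e \<subseteq> T" if "T \<in> \<T>" for T
              using card_mono[OF finT[OF that], of "C \<union> insert a e"] card3 that True h by (auto simp: \<T>_def)
            then have empty: "{T \<in> \<T>. C \<union> insert a e \<subseteq> T} = {}" by blast
            show ?thesis unfolding empty by simp
          next
            case False
            then have k: "h - card (C \<union> insert a e) = k - 2" "k - 1 = Suc (k - 2)" "card (C \<union> insert a e) \<le> h"
              using h card3 by auto
            have "real (card {T \<in> \<T>. C \<union> insert a e \<subseteq> T}) \<le> n ^ (k - 2)"
              using count[of "C \<union> insert a e"] k sub e2 a UV by (intro of_nat_mono) auto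
            also have "\<dots> = real n ^ (k - 1) / n" using n0 unfolding k(2) by simp
            finally show ?thesis .
          qed
        qed
        also have "\<dots> \<le> card U * (real n ^ (k - 1) / n)"
          using finU by (simp add: mult_right_mono card_mono divide_right_mono)
        also have "\<dots> \<le> card A * (real n ^ (k - 1) / n)"
          using cardU by (intro mult_right_mono) auto
        finally show ?thesis by simp
      qed
    next
      fix T assume T: "T \<in> I"
      then have T': "T \<in> \<T>" "T \<inter> U \<noteq> {}" by (auto simp: I_def)
      show "pairs (T \<inter> U) \<subseteq> pairs U" by (rule pairs_mono) auto
      show "0 \<le> w T" using w01[OF T'] by simp
      have "card (T \<inter> U) \<le> h" using T' finT[OF T'(1)] card_mono[of T "T \<inter> U"] by (auto simp: \<T>_def)
      have "card (pairs (T \<inter> U)) = card (T \<inter> U) choose 2" using finU by (simp add: card_pairs)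
      also have "\<dots> \<le> card (T \<inter> U) ^ 2"
        using T by (intro binomial_le_pow) (simp add: I_def)
      also have "\<dots> \<le> h\<^sup>2" using \<open>card (T \<inter> U) \<le> h\<close> by (rule power_mono) simp
      finally show "card (pairs (T \<inter> U)) \<le> h\<^sup>2" .
    next
      have "(\<Sum>T\<in>I. w T) \<le> (\<Sum>T\<in>I. 1)"
      proof (rule sum_mono)
        fix T assume "T \<in> I"
        then have "T \<in> \<T>" "T \<inter> U \<noteq> {}" by (auto simp: I_def)
        from w01(2)[OF this] show "w T \<le> 1" by (auto simp: of_bool_def split: if_splits)
      qed
      also have "\<dots> \<le> real (card {T \<in> \<T>. {} \<subseteq> T})" using fin\<T> by (auto simp: I_def intro!: card_mono)
      also have "\<dots> \<le> n ^ h" using count[of "{}"] by (intro of_nat_mono) auto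
      finally show "(\<Sum>T\<in>I. w T) \<le> real n ^ h" by simp
    qed
    finally show "norm (avg (pairs U) (\<lambda>y. cis (\<theta> * (\<Sum>T\<in>\<T>. v T * of_bool (pairs (T \<inter> A) \<subseteq> y' \<union> y)))))
      \<le> ?bound" by simp
  qed (use finA in auto)
  finally show ?thesis .
qed

end

section \<open>Decoupling\<close>

definition star :: "'a \<Rightarrow> 'a set \<Rightarrow> 'a set set" where
  "star c A = (\<lambda>a. {c, a}) ` A"

lemma finite_star [simp]: "finite A \<Longrightarrow> finite (star c A)"
  by (simp add: star_def)

lemma inj_on_edge: "inj_on (\<lambda>a. {c, a}) A"
  by (auto simp: inj_on_def doubleton_eq_iff)

lemma star_disjoint: "c \<noteq> d \<Longrightarrow> c \<notin> A \<Longrightarrow> d \<notin> A \<Longrightarrow> star c A \<inter> star d A = {}"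
  by (auto simp: star_def doubleton_eq_iff)

lemma star_mono: "A \<subseteq> B \<Longrightarrow> star c A \<subseteq> star c B"
  by (auto simp: star_def)

text \<open>The invariant of the decoupling: \<open>P\<close> is the set of centres already treated, \<open>U\<close> the set of
  those vertices of \<open>A\<close> which have been joined to all of \<open>P\<close> in the first copy and to none of \<open>P\<close>
  in the second copy, and \<open>v T\<close> the resulting weight of the vertex set \<open>T\<close>.\<close>

definition decoupled ::
  "'a set set \<Rightarrow> 'a set \<Rightarrow> ('a set \<Rightarrow> bool) \<Rightarrow> 'a set \<Rightarrow> 'a set \<Rightarrow> ('a set \<Rightarrow> real) \<Rightarrow> bool" where
  "decoupled \<T> A \<Omega> P U v \<longleftrightarrow>
     (\<forall>T\<in>\<T>. T \<inter> U \<noteq> {} \<longrightarrow> (v T = 0 \<or> v T = 1) \<and> (v T \<noteq> 0 \<longrightarrow> P \<subseteq> T)) \<and>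
     (\<forall>T\<in>\<T>. T \<inter> A \<noteq> {} \<and> T \<inter> A \<subseteq> U \<and> P \<subseteq> T \<longrightarrow> v T = of_bool (\<Omega> T))"

text \<open>Why the cancellation works: if d is not in T, both indicators are 1 and the weight drops
  to 0. If d is in T and T contains a vertex a of the new \<open>U\<close>, the edge {d, a} is
  missing from x', so the subtracted indicator is 0 and no negative weight arises.\<close>

lemma decoupled_step:
  fixes d :: 'a
  assumes "decoupled \<T> A \<Omega> P U v" "U \<subseteq> A"
  defines "B \<equiv> \<lambda>T. if d \<in> T then star d (T \<inter> A) else {}"
  shows "decoupled \<T> A \<Omega> (insert d P) {a \<in> U. {d, a} \<in> x - x'}
    (\<lambda>T. v T * (of_bool (B T \<subseteq> x) - of_bool (B T \<subseteq> x')))"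
  unfolding decoupled_def
proof (intro conjI ballI impI)
  fix T assume T: "T \<in> \<T>" "T \<inter> {a \<in> U. {d, a} \<in> x - x'} \<noteq> {}"
  then obtain a where a: "a \<in> T" "a \<in> U" "{d, a} \<in> x" "{d, a} \<notin> x'" by auto
  have v: "v T = 0 \<or> v T = 1" "v T \<noteq> 0 \<longrightarrow> P \<subseteq> T"
    using assms(1) T a unfolding decoupled_def by auto
  have B: "\<not> B T \<subseteq> x'" if "d \<in> T" using that a assms(2) by (auto simp: B_def star_def)
  show "v T * (of_bool (B T \<subseteq> x) - of_bool (B T \<subseteq> x')) = 0 \<or> v T * (of_bool (B T \<subseteq> x) - of_bool (B T \<subseteq> x')) = 1"
    using v B by (cases "d \<in> T") (auto simp: B_def)
  show "v T * (of_bool (B T \<subseteq> x) - of_bool (B T \<subseteq> x')) \<noteq> 0 \<Longrightarrow> insert d P \<subseteq> T"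
    using v by (cases "d \<in> T") (auto simp: B_def)
next
  fix T assume T: "T \<in> \<T>" "T \<inter> A \<noteq> {} \<and> T \<inter> A \<subseteq> {a \<in> U. {d, a} \<in> x - x'} \<and> insert d P \<subseteq> T"
  then have "v T = of_bool (\<Omega> T)"
    using assms(1) unfolding decoupled_def by blast
  moreover have "B T \<subseteq> x" "\<not> B T \<subseteq> x'" using T by (auto simp: B_def star_def)
  ultimately show "v T * (of_bool (B T \<subseteq> x) - of_bool (B T \<subseteq> x')) = of_bool (\<Omega> T)" by simp
qed

context bernoulli_param
begin

lemma avg_swap3:
  "avg R (\<lambda>w. avg Y (\<lambda>y. avg M (\<lambda>x. g w y x))) = avg M (\<lambda>x. avg R (\<lambda>w. avg Y (\<lambda>y. g w y x)))"
proof -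
  have "avg R (\<lambda>w. avg Y (\<lambda>y. avg M (\<lambda>x. g w y x))) = avg R (\<lambda>w. avg M (\<lambda>x. avg Y (\<lambda>y. g w y x)))"
    by (rule avg_cong[OF refl]) (rule avg_swap)
  also have "\<dots> = avg M (\<lambda>x. avg R (\<lambda>w. avg Y (\<lambda>y. g w y x)))" by (rule avg_swap)
  finally show ?thesis .
qed

text \<open>Cauchy-Schwarz over w and y, which both copies share, while the square of the inner
  average becomes two independent copies of x. The norm is then moved inside the averages over x and
  x', so that the next round can treat w for each fixed pair.\<close>

lemma norm_avg_cis_decouple:
  assumes "finite R" "finite Y"
  shows "(norm (avg M (\<lambda>x. avg R (\<lambda>w. avg Y (\<lambda>y. cis (f x w y))))))\<^sup>2
    \<le> avg M (\<lambda>x. avg M (\<lambda>x'. norm (avg R (\<lambda>w. avg Y (\<lambda>y. cis (f x w y - f x' w y))))))"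
proof -
  define G where "G w y = avg M (\<lambda>x. cis (f x w y))" for w y
  have "norm (avg M (\<lambda>x. avg R (\<lambda>w. avg Y (\<lambda>y. cis (f x w y)))))
      = norm (avg R (\<lambda>w. avg Y (\<lambda>y. G w y)))"
    unfolding G_def by (rule arg_cong[OF avg_swap3[symmetric]])
  also have "\<dots> \<le> avg R (\<lambda>w. avg Y (\<lambda>y. norm (G w y)))"
    by (intro order.trans[OF norm_avg_le] avg_mono norm_avg_le)
  finally have "(norm (avg M (\<lambda>x. avg R (\<lambda>w. avg Y (\<lambda>y. cis (f x w y))))))\<^sup>2
      \<le> (avg R (\<lambda>w. avg Y (\<lambda>y. norm (G w y))))\<^sup>2"
    by (rule power_mono) simp
  also have "\<dots> \<le> avg R (\<lambda>w. avg Y (\<lambda>y. (norm (G w y))\<^sup>2))"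
    by (intro order.trans[OF square_avg_le] avg_mono square_avg_le assms)
  also have "\<dots> = norm (complex_of_real (avg R (\<lambda>w. avg Y (\<lambda>y. (norm (G w y))\<^sup>2))))"
    by (simp add: avg_nonneg)
  also have "complex_of_real (avg R (\<lambda>w. avg Y (\<lambda>y. (norm (G w y))\<^sup>2)))
      = avg R (\<lambda>w. avg Y (\<lambda>y. avg M (\<lambda>x. avg M (\<lambda>x'. cis (f x w y - f x' w y)))))"
    unfolding avg_of_real[symmetric]
  proof (intro avg_cong refl)
    fix w y
    have "complex_of_real ((norm (G w y))\<^sup>2) = G w y * cnj (G w y)"
      by (rule complex_norm_square)
    also have "\<dots> = avg M (\<lambda>x. avg M (\<lambda>x'. cis (f x w y) * cis (- f x' w y)))"
      unfolding avg_mult_left avg_mult_right by (simp add: G_def avg_cnj cis_cnj)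
    finally show "complex_of_real ((norm (G w y))\<^sup>2) = avg M (\<lambda>x. avg M (\<lambda>x'. cis (f x w y - f x' w y)))"
      by (simp add: cis_mult)
  qed
  also have "\<dots> = avg M (\<lambda>x. avg M (\<lambda>x'. avg R (\<lambda>w. avg Y (\<lambda>y. cis (f x w y - f x' w y)))))"
    by (subst avg_swap3, subst avg_swap3) (rule refl)
  also have "norm \<dots> \<le> avg M (\<lambda>x. avg M (\<lambda>x'. norm (avg R (\<lambda>w. avg Y (\<lambda>y. cis (f x w y - f x' w y))))))"
    by (intro order.trans[OF norm_avg_le] avg_mono norm_avg_le)
  finally show ?thesis .
qed

text \<open>Induction on the set \<open>D\<close> of centres not yet treated. The error K
  (1/2)^(card U) penalises a small final \<open>U\<close>. Treating one more centre keeps each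
  vertex with probability \<rho> = p (1 - p), so the base 1 - \<rho>^j / 2 becomes 1 - \<rho>^(j+1)
  / 2, starting from 1/2 at j = 0.\<close>

lemma norm_avg_stars_power_le:
  fixes \<T> :: "'a set set" and \<xi> :: "'a set \<Rightarrow> 'b set \<Rightarrow> real"
  assumes fin: "finite A" "finite Y" and C: "C \<inter> A = {}" and K: "0 \<le> K"
    and last: "\<And>U v. U \<subseteq> A \<Longrightarrow> decoupled \<T> A \<Omega> C U v \<Longrightarrow>
      norm (avg Y (\<lambda>y. cis (\<theta> * (\<Sum>T\<in>\<T>. v T * \<xi> T y)))) \<le> \<eta> + K * (1 / 2) ^ card U"
    and D: "finite D" "D \<inter> P = {}" "D \<union> P = C" "U \<subseteq> A" "decoupled \<T> A \<Omega> P U v"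
  shows "norm (avg (\<Union>c\<in>D. star c A) (\<lambda>x. avg Y (\<lambda>y. cis (\<theta> * (\<Sum>T\<in>\<T>.
      v T * of_bool ((\<Union>c\<in>D. if c \<in> T then star c (T \<inter> A) else {}) \<subseteq> x) * \<xi> T y))))) ^ (2 ^ card D)
    \<le> \<eta> + K * (1 - (p * (1 - p)) ^ card D / 2) ^ card U"
  using D
proof (induction D arbitrary: P U v rule: finite_induct)
  case empty
  then show ?case using last by simp
next
  case (insert d D)
  define \<rho> where "\<rho> = p * (1 - p)"
  define s where "s = 1 - \<rho> ^ card D / 2"
  have \<rho>: "0 < \<rho>" "\<rho> < 1"
    using p_pos p_less_1 mult_strict_mono[of p 1 "1 - p" 1] by (auto simp: \<rho>_def)
  then have s: "0 < s" using power_le_one[of \<rho> "card D"] by (simp add: s_def)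
  define M where "M = star d A"
  define R where "R = (\<Union>c\<in>D. star c A)"
  have fM: "finite M" and fR: "finite R" using fin insert.hyps by (auto simp: M_def R_def)
  have dC: "d \<notin> A" "\<And>c. c \<in> D \<Longrightarrow> c \<notin> A" using insert.prems C by auto
  have MR: "M \<inter> R = {}" 
  proof -
    have "star d A \<inter> star c A = {}" if "c \<in> D" for c
      using that dC insert.hyps by (intro star_disjoint) auto
    then show ?thesis by (auto simp: M_def R_def)
  qed
  define B where "B T = (if d \<in> T then star d (T \<inter> A) else {})" for T
  define B' where "B' T = (\<Union>c\<in>D. if c \<in> T then star c (T \<inter> A) else {})" for T
  have BM: "B T \<subseteq> M" for T by (auto simp: B_def M_def star_def)
  have B'R: "B' T \<subseteq> R" for T by (auto simp: B'_def R_def star_def)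
  define f where "f x w y = \<theta> * (\<Sum>T\<in>\<T>. v T * of_bool (B T \<subseteq> x) * of_bool (B' T \<subseteq> w) * \<xi> T y)" for x w y
  define N where "N x x' = norm (avg R (\<lambda>w. avg Y (\<lambda>y. cis (f x w y - f x' w y))))" for x x'
  let ?lhs = "avg (\<Union>c\<in>insert d D. star c A) (\<lambda>x. avg Y (\<lambda>y. cis (\<theta> * (\<Sum>T\<in>\<T>.
      v T * of_bool ((\<Union>c\<in>insert d D. if c \<in> T then star c (T \<inter> A) else {}) \<subseteq> x) * \<xi> T y))))"
  have "?lhs = avg (M \<union> R) (\<lambda>x. avg Y (\<lambda>y. cis (\<theta> * (\<Sum>T\<in>\<T>. v T * of_bool (B T \<union> B' T \<subseteq> x) * \<xi> T y))))"
    by (simp only: M_def R_def B_def B'_def UN_insert)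
  also have "\<dots> = avg M (\<lambda>x. avg R (\<lambda>w. avg Y (\<lambda>y. cis (\<theta> * (\<Sum>T\<in>\<T>. v T * of_bool (B T \<union> B' T \<subseteq> x \<union> w) * \<xi> T y)))))"
    using fM fR MR by (rule avg_Un)
  also have "\<dots> = avg M (\<lambda>x. avg R (\<lambda>w. avg Y (\<lambda>y. cis (f x w y))))"
  proof (intro avg_cong refl)
    fix x w y assume "x \<subseteq> M" "w \<subseteq> R"
    then have "B T \<union> B' T \<subseteq> x \<union> w \<longleftrightarrow> B T \<subseteq> x \<and> B' T \<subseteq> w" for T
      using BM[of T] B'R[of T] MR by blast
    then show "cis (\<theta> * (\<Sum>T\<in>\<T>. v T * of_bool (B T \<union> B' T \<subseteq> x \<union> w) * \<xi> T y)) = cis (f x w y)"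
      by (simp add: f_def of_bool_conj mult.assoc)
  qed
  finally have "norm ?lhs = norm (avg M (\<lambda>x. avg R (\<lambda>w. avg Y (\<lambda>y. cis (f x w y)))))" by simp
  then have "(norm ?lhs)\<^sup>2 \<le> avg M (\<lambda>x. avg M (\<lambda>x'. N x x'))"
    unfolding N_def using norm_avg_cis_decouple[OF fR fin(2)] by simp
  then have "((norm ?lhs)\<^sup>2) ^ (2 ^ card D) \<le> (avg M (\<lambda>x. avg M (\<lambda>x'. N x x'))) ^ (2 ^ card D)"
    by (rule power_mono) simp
  \<comment> \<open>Jensen moves the power inside, since the induction hypothesis bounds this power
    of the norm for each pair x, x'.\<close>
  also have "\<dots> \<le> avg M (\<lambda>x. avg M (\<lambda>x'. N x x' ^ (2 ^ card D)))"
    by (intro order.trans[OF power_avg_le] avg_mono power_avg_le avg_nonneg fM) (simp_all add: N_def)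
  also have "\<dots> \<le> avg M (\<lambda>x. avg M (\<lambda>x'. \<eta> + K * s ^ card (star d U \<inter> x - x')))"
  proof (intro avg_mono)
    fix x x' assume "x \<subseteq> M" "x' \<subseteq> M"
    define U' where "U' = {a \<in> U. {d, a} \<in> x - x'}"
    define v' where "v' T = v T * (of_bool (B T \<subseteq> x) - of_bool (B T \<subseteq> x'))" for T
    have "N x x' = norm (avg R (\<lambda>w. avg Y (\<lambda>y. cis (\<theta> * (\<Sum>T\<in>\<T>. v' T * of_bool (B' T \<subseteq> w) * \<xi> T y)))))"
      unfolding N_def f_def v'_def right_diff_distrib[symmetric] sum_subtractf[symmetric]
      by (simp add: algebra_simps)
    also have "\<dots> ^ (2 ^ card D) \<le> \<eta> + K * s ^ card U'"
      unfolding R_def B'_def s_def \<rho>_def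
    proof (rule insert.IH)
      show "decoupled \<T> A \<Omega> (Set.insert d P) U' v'"
        unfolding U'_def v'_def B_def using insert.prems by (intro decoupled_step)
    qed (use insert in \<open>auto simp: U'_def\<close>)
    also have "card U' = card (star d U \<inter> x - x')"
    proof -
      have "star d U \<inter> x - x' = (\<lambda>a. {d, a}) ` U'" by (auto simp: star_def U'_def)
      then show ?thesis by (simp add: card_image[OF inj_on_edge])
    qed
    finally show "N x x' ^ (2 ^ card D) \<le> \<eta> + K * s ^ card (star d U \<inter> x - x')" .
  qed
  also have "\<dots> = \<eta> + K * (1 - p * (1 - p) * (1 - s)) ^ card (star d U)"
    unfolding avg_add avg_mult_left avg_const[OF fM] using fM s insert.prems
    by (subst avg_avg_power_card) (simp_all add: M_def star_mono)
  also have "card (star d U) = card U" unfolding star_def by (rule card_image[OF inj_on_edge])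
  also have "1 - p * (1 - p) * (1 - s) = 1 - (p * (1 - p)) ^ card (insert d D) / 2"
    using insert.hyps by (simp add: s_def \<rho>_def)
  finally show ?case using insert.hyps by (simp add: power_mult[symmetric])
qed

end

section \<open>Common neighbours in the random graph\<close>

lemma clique_count_eq:
  "clique_count h n E = card {T \<in> {T. T \<subseteq> {1..n} \<and> card T = h}. pairs T \<subseteq> E}"
proof -
  have "pairs T \<subseteq> E \<longleftrightarrow> (\<forall>u\<in>T. \<forall>v\<in>T. u \<noteq> v \<longrightarrow> {u, v} \<in> E)" for T :: "nat set"
  proof
    assume sub: "pairs T \<subseteq> E"
    show "\<forall>u\<in>T. \<forall>v\<in>T. u \<noteq> v \<longrightarrow> {u, v} \<in> E"
    proof (intro ballI impI)
      fix u v assume "u \<in> T" "v \<in> T" "u \<noteq> v"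
      then have "{u, v} \<in> pairs T" by (simp add: pairs_def)
      then show "{u, v} \<in> E" using sub by blast
    qed
  qed (auto simp: pairs_def card_2_iff)
  then show ?thesis by (simp add: clique_count_def clique_copies_def conj_assoc)
qed

lemma star_Int_pairs_Union:
  assumes "C \<inter> A = {}"
  shows "pairs T \<inter> (\<Union>c\<in>C. star c A) = (\<Union>c\<in>C. if c \<in> T then star c (T \<inter> A) else {})"
    (is "?l = ?r")
proof
  show "?l \<subseteq> ?r" by (fastforce simp: pairs_def star_def)
  show "?r \<subseteq> ?l"
  proof
    fix e assume "e \<in> ?r"
    then obtain c a where ca: "c \<in> C" "c \<in> T" "a \<in> T" "a \<in> A" "e = {c, a}"
      by (auto simp: star_def split: if_splits)
    then have "c \<noteq> a" using assms by auto
    then show "e \<in> ?l" using ca by (auto simp: pairs_def star_def)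
  qed
qed

text \<open>\<open>R\<close> is later the complement of \<open>A\<close>, so that a common neighbour
  never relies on an edge inside \<open>A\<close>.\<close>

definition common_nbrs :: "'a set set \<Rightarrow> 'a set \<Rightarrow> 'a set \<Rightarrow> 'a set" where
  "common_nbrs G R S = {z \<in> R - S. star z S \<subseteq> G}"

text \<open>Greedy extension with double counting: every admissible j-set extends in at least t
  ways, and a set of size j + 1 arises from at most j + 1 such extensions, which accumulates to the
  factorial. \<open>S0\<close> itself need not be a clique.\<close>

lemma card_cliques_ge:
  fixes t :: real
  assumes fin: "finite R" "finite S0" and t: "0 \<le> t"
    and many: "\<And>S. S0 \<subseteq> S \<Longrightarrow> S \<subseteq> S0 \<union> R \<Longrightarrow> card S < card S0 + j \<Longrightarrow> t \<le> card (common_nbrs G R S)"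
  shows "t ^ j / fact j \<le> card {Z. Z \<subseteq> R - S0 \<and> card Z = j \<and> pairs Z \<subseteq> G \<and> (\<forall>z\<in>Z. star z S0 \<subseteq> G)}"
  using many
proof (induction j)
  case 0
  have "{Z. Z \<subseteq> R - S0 \<and> card Z = 0 \<and> pairs Z \<subseteq> G \<and> (\<forall>z\<in>Z. star z S0 \<subseteq> G)} = {{}}"
    using fin by (auto simp: pairs_def dest: finite_subset)
  then show ?case by simp
next
  case (Suc j)
  define \<Z> where "\<Z> i = {Z. Z \<subseteq> R - S0 \<and> card Z = i \<and> pairs Z \<subseteq> G \<and> (\<forall>z\<in>Z. star z S0 \<subseteq> G)}" for i
  have fin\<Z>: "finite (\<Z> i)" for i using fin by (auto simp: \<Z>_def intro: finite_subset[of _ "Pow R"])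
  have finZ: "finite Z" if "Z \<in> \<Z> i" for Z i using that fin by (auto simp: \<Z>_def intro: finite_subset)
  define W where "W Z = common_nbrs G R (S0 \<union> Z)" for Z
  have finW: "finite (W Z)" for Z using fin by (auto simp: W_def common_nbrs_def)
  have "t ^ j / fact j * t \<le> card (\<Z> j) * t"
    unfolding \<Z>_def using t by (intro mult_right_mono Suc.IH Suc.prems) auto
  also have "\<dots> = (\<Sum>Z\<in>\<Z> j. t)" by simp
  also have "\<dots> \<le> (\<Sum>Z\<in>\<Z> j. real (card (W Z)))"
  proof (rule sum_mono)
    fix Z assume Z: "Z \<in> \<Z> j"
    have "card (S0 \<union> Z) \<le> card S0 + j" using card_Un_le[of S0 Z] Z by (simp add: \<Z>_def)
    then show "t \<le> card (W Z)" unfolding W_def using Z by (intro Suc.prems) (auto simp: \<Z>_def)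
  qed
  also have "\<dots> = card (Sigma (\<Z> j) W)" using fin\<Z> finW by (simp add: card_SigmaI)
  also have "\<dots> \<le> card (Sigma (\<Z> (Suc j)) (\<lambda>Z. Z))"
  proof (intro of_nat_mono card_inj_on_le[where f = "\<lambda>(Z, z). (insert z Z, z)"])
    show "inj_on (\<lambda>(Z, z). (insert z Z, z)) (Sigma (\<Z> j) W)"
    proof (rule inj_onI)
      fix a b
      assume "a \<in> Sigma (\<Z> j) W" "b \<in> Sigma (\<Z> j) W"
        "(case a of (Z, z) \<Rightarrow> (insert z Z, z)) = (case b of (Z, z) \<Rightarrow> (insert z Z, z))"
      then obtain Z z Z' where ab: "a = (Z, z)" "b = (Z', z)" "z \<in> W Z" "z \<in> W Z'" "insert z Z = insert z Z'"
        by (cases a; cases b) auto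
      then have "z \<notin> Z" "z \<notin> Z'" by (auto simp: W_def common_nbrs_def)
      then show "a = b" using ab insert_ident by metis
    qed
    show "finite (Sigma (\<Z> (Suc j)) (\<lambda>Z. Z))" by (rule finite_SigmaI[OF fin\<Z> finZ])
    show "(\<lambda>(Z, z). (insert z Z, z)) ` Sigma (\<Z> j) W \<subseteq> Sigma (\<Z> (Suc j)) (\<lambda>Z. Z)"
    proof clarify
      fix Z z assume Z: "Z \<in> \<Z> j" and z: "z \<in> W Z"
      have zz: "z \<in> R" "z \<notin> S0" "z \<notin> Z" "star z (S0 \<union> Z) \<subseteq> G" using z by (auto simp: W_def common_nbrs_def)
      have "pairs (insert z Z) \<subseteq> G"
      proof
        fix e assume e: "e \<in> pairs (insert z Z)"
        show "e \<in> G"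
        proof (cases "z \<in> e")
          case True
          then obtain y where "e = {z, y}" "y \<in> Z" using e by (auto simp: pairs_def card_2_iff)
          then show ?thesis using zz by (auto simp: star_def)
        next
          case False
          then have "e \<in> pairs Z" using e by (auto simp: pairs_def)
          then show ?thesis using Z by (auto simp: \<Z>_def)
        qed
      qed
      then have "insert z Z \<in> \<Z> (Suc j)"
        using Z zz finZ[OF Z] by (auto simp: \<Z>_def star_def)
      then show "insert z Z \<in> \<Z> (Suc j) \<and> z \<in> insert z Z" by simp
    qed
  qed
  also have "card (Sigma (\<Z> (Suc j)) (\<lambda>Z. Z)) = (\<Sum>Z\<in>\<Z> (Suc j). card Z)"
    by (rule card_SigmaI[OF fin\<Z>]) (use finZ in blast)
  also have "\<dots> = (\<Sum>Z\<in>\<Z> (Suc j). Suc j)" by (intro sum.cong) (auto simp: \<Z>_def)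
  finally have le: "t ^ j / fact j * t \<le> real (card (\<Z> (Suc j))) * real (Suc j)"
    by (simp add: algebra_simps)
  have "t ^ Suc j / fact (Suc j) = (t ^ j / fact j * t) / real (Suc j)"
    by (simp only: power_Suc fact_Suc of_nat_mult divide_divide_eq_left times_divide_eq_left
        times_divide_eq_right mult.commute)
  also have "\<dots> \<le> real (card (\<Z> (Suc j)))"
    by (rule mult_imp_div_pos_le[OF _ le]) (rule of_nat_0_less_iff[THEN iffD2, OF zero_less_Suc])
  finally show ?case by (simp only: \<Z>_def)
qed

section \<open>Few common neighbours are unlikely\<close>

context bernoulli_param
begin

lemma avg_restrict:
  assumes "finite M" "N \<subseteq> M" "\<And>E. E \<subseteq> M \<Longrightarrow> g E = g (E \<inter> N)"
  shows "avg M g = avg N g"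
proof -
  have "avg M g = avg (N \<union> (M - N)) g" using assms by (intro avg_cong) auto
  also have "\<dots> = avg N (\<lambda>E. avg (M - N) (\<lambda>F. g (E \<union> F)))"
    using assms by (intro avg_Un) (auto intro: finite_subset)
  also have "\<dots> = avg N (\<lambda>E. avg (M - N) (\<lambda>F. g E))"
  proof (intro avg_cong refl)
    fix E F assume "E \<subseteq> N" "F \<subseteq> M - N"
    then have "(E \<union> F) \<inter> N = E" "E \<union> F \<subseteq> M" using assms by auto
    then show "g (E \<union> F) = g E" using assms(3)[of "E \<union> F"] by simp
  qed
  also have "\<dots> = avg N g" using assms by simp
  finally show ?thesis .
qed

lemma avg_superset:
  "finite M \<Longrightarrow> avg M (\<lambda>x. of_bool (M \<subseteq> x)) = p ^ card M"
proof (induction M rule: finite_induct)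
  case (insert e M)
  have "avg M (\<lambda>E. of_bool (insert e M \<subseteq> insert e E)) = avg M (\<lambda>x. of_bool (M \<subseteq> x) :: real)"
    using insert.hyps by (intro avg_cong) auto
  moreover have "avg M (\<lambda>x. of_bool (insert e M \<subseteq> x)) = avg M (\<lambda>x. 0 :: real)"
    using insert.hyps by (intro avg_cong) auto
  ultimately show ?case using insert by (simp add: avg_insert)
qed simp

text \<open>The stars from different z to \<open>S\<close> are disjoint, so each z is independently
  joined to all of \<open>S\<close> with probability p^(card S).\<close>

lemma avg_power_common_nbrs:
  fixes s :: real
  assumes "finite Z" "finite S" "Z \<inter> S = {}"
  shows "avg (\<Union>z\<in>Z. star z S) (\<lambda>G. s ^ card {z \<in> Z. star z S \<subseteq> G}) = (1 - p ^ card S * (1 - s)) ^ card Z"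
  using assms(1,3)
proof (induction Z rule: finite_induct)
  case (insert z Z)
  define R where "R = (\<Union>z\<in>Z. star z S)"
  have fR: "finite R" using insert.hyps assms by (auto simp: R_def)
  have dis: "star z S \<inter> R = {}" 
  proof -
    have "star z S \<inter> star y S = {}" if "y \<in> Z" for y
      using that insert by (intro star_disjoint) auto
    then show ?thesis by (auto simp: R_def)
  qed
  have "avg (\<Union>z\<in>insert z Z. star z S) (\<lambda>G. s ^ card {y \<in> insert z Z. star y S \<subseteq> G})
      = avg (star z S \<union> R) (\<lambda>G. s ^ card {y \<in> insert z Z. star y S \<subseteq> G})"
    by (simp add: R_def)
  also have "\<dots> = avg (star z S) (\<lambda>x. avg R (\<lambda>w. s ^ card {y \<in> insert z Z. star y S \<subseteq> x \<union> w}))"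
    using dis fR assms by (intro avg_Un) auto
  also have "\<dots> = avg (star z S) (\<lambda>x. avg R (\<lambda>w. (1 - (1 - s) * of_bool (star z S \<subseteq> x)) * s ^ card {y \<in> Z. star y S \<subseteq> w}))"
  proof (intro avg_cong refl)
    fix x w assume xw: "x \<subseteq> star z S" "w \<subseteq> R"
    have "star y S \<subseteq> R" if "y \<in> Z" for y using that by (auto simp: R_def)
    then have 1: "star y S \<subseteq> x \<union> w \<longleftrightarrow> star y S \<subseteq> w" if "y \<in> Z" for y
      using that xw dis by blast
    have 2: "star z S \<subseteq> x \<union> w \<longleftrightarrow> star z S \<subseteq> x" using xw dis by blast
    have "{y \<in> insert z Z. star y S \<subseteq> x \<union> w}
        = (if star z S \<subseteq> x then insert z {y \<in> Z. star y S \<subseteq> w} else {y \<in> Z. star y S \<subseteq> w})"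
      using 1 2 by auto
    then show "s ^ card {y \<in> insert z Z. star y S \<subseteq> x \<union> w}
        = (1 - (1 - s) * of_bool (star z S \<subseteq> x)) * s ^ card {y \<in> Z. star y S \<subseteq> w}"
      using insert.hyps by simp
  qed
  also have "\<dots> = avg (star z S) (\<lambda>x. 1 - (1 - s) * of_bool (star z S \<subseteq> x)) * (1 - p ^ card S * (1 - s)) ^ card Z"
    unfolding avg_mult_left avg_mult_right R_def using insert by simp
  also have "avg (star z S) (\<lambda>x. 1 - (1 - s) * of_bool (star z S \<subseteq> x)) = 1 - (1 - s) * p ^ card S"
    unfolding avg_diff avg_mult_left using assms
    by (simp add: avg_superset) (simp add: star_def card_image[OF inj_on_edge])
  finally show ?case using insert.hyps by (simp add: mult_ac)
qed simp

text \<open>Chernoff bound with base s = exp (-1): the indicator of X < t is at most exp (t - X).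
  Since 1 - s \<ge> 1/2, each of the at least \<open>card R - h\<close> candidates gives a factor of
  at most exp (-p^h / 2).\<close>

lemma avg_few_common_nbrs_le:
  fixes t :: real
  assumes "finite V" "R \<subseteq> V" "S \<subseteq> V" "card S \<le> h"
  shows "avg (pairs V) (\<lambda>G. of_bool (card (common_nbrs G R S) < t))
    \<le> exp (t - p ^ h * (real (card R) - real h) / 2)"
proof -
  define Z where "Z = R - S"
  have fin: "finite Z" "finite S" "finite R" using assms by (auto simp: Z_def intro: finite_subset)
  define s :: real where "s = exp (- 1)"
  have s: "0 < s" "s \<le> 1 / 2"
  proof -
    have "2 \<le> exp (1 :: real)" using exp_ge_add_one_self[of 1] by simp
    then show "0 < s" "s \<le> 1 / 2" by (simp_all add: s_def exp_minus field_simps)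
  qed
  let ?N = "\<Union>z\<in>Z. star z S"
  have NV: "?N \<subseteq> pairs V"
  proof
    fix e assume "e \<in> ?N"
    then obtain z y where "z \<in> Z" "y \<in> S" "e = {z, y}" by (auto simp: star_def)
    moreover from this have "z \<noteq> y" by (auto simp: Z_def)
    ultimately show "e \<in> pairs V" using assms by (auto simp: pairs_def Z_def)
  qed
  have "avg (pairs V) (\<lambda>G. of_bool (card (common_nbrs G R S) < t))
      \<le> avg (pairs V) (\<lambda>G. exp t * s ^ card {z \<in> Z. star z S \<subseteq> G})"
  proof (rule avg_mono)
    fix G
    define X where "X = card {z \<in> Z. star z S \<subseteq> G}"
    have "common_nbrs G R S = {z \<in> Z. star z S \<subseteq> G}" by (simp add: common_nbrs_def Z_def)
    moreover have "exp t * s ^ X = exp (t - X)" by (simp add: s_def exp_diff exp_minus power_inverse flip: exp_of_nat_mult)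
        (simp add: field_simps)
    ultimately show "of_bool (card (common_nbrs G R S) < t) \<le> exp t * s ^ card {z \<in> Z. star z S \<subseteq> G}"
      by (simp add: X_def of_bool_def)
  qed
  also have "\<dots> = exp t * avg (pairs V) (\<lambda>G. s ^ card {z \<in> Z. star z S \<subseteq> G})" by (rule avg_mult_left)
  also have "avg (pairs V) (\<lambda>G. s ^ card {z \<in> Z. star z S \<subseteq> G}) = avg ?N (\<lambda>G. s ^ card {z \<in> Z. star z S \<subseteq> G})"
  proof (rule avg_restrict)
    fix G
    have "{z \<in> Z. star z S \<subseteq> G} = {z \<in> Z. star z S \<subseteq> G \<inter> ?N}" by auto
    then show "s ^ card {z \<in> Z. star z S \<subseteq> G} = s ^ card {z \<in> Z. star z S \<subseteq> G \<inter> ?N}" by simp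
  qed (use NV assms in auto)
  also have "\<dots> = (1 - p ^ card S * (1 - s)) ^ card Z"
    using fin by (intro avg_power_common_nbrs) (auto simp: Z_def)
  also have "\<dots> \<le> exp (- (p ^ h / 2)) ^ card Z"
  proof (rule power_mono)
    have "p ^ h * (1 / 2) \<le> p ^ card S * (1 - s)"
      using s p_pos p_less_1 assms by (intro mult_mono power_decreasing) auto
    then have "1 - p ^ card S * (1 - s) \<le> 1 + - (p ^ h / 2)" by simp
    also have "\<dots> \<le> exp (- (p ^ h / 2))" by (rule exp_ge_add_one_self)
    finally show "1 - p ^ card S * (1 - s) \<le> exp (- (p ^ h / 2))" .
    have "p ^ card S * (1 - s) \<le> 1 * 1"
      using s p_pos p_less_1 by (intro mult_mono power_le_one) auto
    then show "0 \<le> 1 - p ^ card S * (1 - s)" by simp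
  qed
  also have "exp (- (p ^ h / 2)) ^ card Z = exp (- (p ^ h * card Z / 2))"
    by (simp flip: exp_of_nat_mult add: mult_ac)
  also have "\<dots> \<le> exp (- (p ^ h * (real (card R) - real h) / 2))"
  proof -
    have "card R - card S \<le> card Z" unfolding Z_def using fin by (intro diff_card_le_card_Diff)
    then have "real (card R) - real h \<le> card Z" using assms by linarith
    then have "p ^ h * (real (card R) - real h) \<le> p ^ h * card Z" using p_pos by (intro mult_left_mono) auto
    then show ?thesis by simp
  qed
  finally show ?thesis by (simp flip: exp_add)
qed

text \<open>Union bound over the polynomially many sets of size at most h.\<close>

lemma avg_ex_few_common_nbrs_le:
  fixes t :: real
  assumes "finite V" "R \<subseteq> V"
  shows "avg (pairs V) (\<lambda>G. of_bool (\<exists>S\<subseteq>V. card S \<le> h \<and> card (common_nbrs G R S) < t))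
    \<le> (real h + 1) * (real (card V) + 1) ^ h * exp (t - p ^ h * (real (card R) - real h) / 2)"
proof -
  let ?\<S> = "{S. S \<subseteq> V \<and> card S \<le> h}"
  have fin: "finite ?\<S>" using assms by (auto intro: finite_subset[of _ "Pow V"])
  have "avg (pairs V) (\<lambda>G. of_bool (\<exists>S\<subseteq>V. card S \<le> h \<and> card (common_nbrs G R S) < t))
      \<le> avg (pairs V) (\<lambda>G. \<Sum>S\<in>?\<S>. of_bool (card (common_nbrs G R S) < t) :: real)"
  proof (rule avg_mono)
    fix G
    show "of_bool (\<exists>S\<subseteq>V. card S \<le> h \<and> card (common_nbrs G R S) < t)
        \<le> (\<Sum>S\<in>?\<S>. of_bool (card (common_nbrs G R S) < t) :: real)"
    proof (cases "\<exists>S\<subseteq>V. card S \<le> h \<and> card (common_nbrs G R S) < t")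
      case True
      then obtain S where S: "S \<in> ?\<S>" "card (common_nbrs G R S) < t" by auto
      have "of_bool (card (common_nbrs G R S) < t) \<le> (\<Sum>S\<in>?\<S>. of_bool (card (common_nbrs G R S) < t) :: real)"
        using S fin by (intro member_le_sum) auto
      then show ?thesis using S True by simp
    qed (auto intro: sum_nonneg)
  qed
  also have "\<dots> = (\<Sum>S\<in>?\<S>. avg (pairs V) (\<lambda>G. of_bool (card (common_nbrs G R S) < t) :: real))"
    by (rule avg_sum)
  also have "\<dots> \<le> (\<Sum>S\<in>?\<S>. exp (t - p ^ h * (real (card R) - real h) / 2))"
    using assms by (intro sum_mono avg_few_common_nbrs_le) auto
  also have "\<dots> = card ?\<S> * exp (t - p ^ h * (real (card R) - real h) / 2)" by simp
  also have "\<dots> \<le> ((real h + 1) * (real (card V) + 1) ^ h) * exp (t - p ^ h * (real (card R) - real h) / 2)"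
  proof (rule mult_right_mono)
    have "?\<S> = (\<Union>i\<in>{..h}. {S. S \<subseteq> V \<and> card S = i})" by auto
    then have "card ?\<S> \<le> (\<Sum>i\<le>h. card {S. S \<subseteq> V \<and> card S = i})" by (simp add: card_UN_le)
    also have "\<dots> \<le> (\<Sum>i\<le>h. (card V + 1) ^ h)"
    proof (rule sum_mono)
      fix i assume i: "i \<in> {..h}"
      have "card {S. S \<subseteq> V \<and> card S = i} = card V choose i" using assms by (intro n_subsets)
      also have "\<dots> \<le> card V ^ i"
        by (cases "i \<le> card V") (auto intro: binomial_le_pow simp: binomial_eq_0)
      also have "\<dots> \<le> (card V + 1) ^ i" by (rule power_mono) auto
      also have "\<dots> \<le> (card V + 1) ^ h" using i by (intro power_increasing) auto
      finally show "card {S. S \<subseteq> V \<and> card S = i} \<le> (card V + 1) ^ h" .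
    qed
    finally have "card ?\<S> \<le> (h + 1) * (card V + 1) ^ h" by simp
    then have "real (card ?\<S>) \<le> real ((h + 1) * (card V + 1) ^ h)" by (rule of_nat_mono)
    then show "real (card ?\<S>) \<le> (real h + 1) * (real (card V) + 1) ^ h" by (simp add: algebra_simps)
  qed simp
  finally show ?thesis by simp
qed

end

section \<open>Decay of the characteristic function\<close>

context bernoulli_param
begin

text \<open>The first two summands bound the almost linear phase when the final set \<open>U\<close> of the
  decoupling has at least \<open>u\<close> vertices; the last one bounds the probability of \<open>card U < u\<close>.\<close>

definition clique_cis_bound ::
  "nat \<Rightarrow> nat \<Rightarrow> nat \<Rightarrow> nat \<Rightarrow> nat \<Rightarrow> nat \<Rightarrow> nat \<Rightarrow> real \<Rightarrow> real \<Rightarrow> real" where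
  "clique_cis_bound n h k r N q u \<beta> \<theta> =
     Suc N * (1 + 2 * real n ^ h * \<bar>\<theta>\<bar>) ^ N
       * exp (- (p * (1 - p) * (\<bar>\<theta>\<bar> * \<beta>)\<^sup>2 / 4)) ^ ((u choose 2) - N * h\<^sup>2)
     + 6 * (\<bar>\<theta>\<bar> * (q * real n ^ (k - 1) / n * q)) ^ Suc N
     + 2 ^ u * (1 - (p * (1 - p)) ^ r / 2) ^ q"

text \<open>The edges are split into fixed ones \<omega>, the stars \<open>X\<close> from
  \<open>C\<close> to \<open>A\<close>, and those inside \<open>A\<close>. The clique indicator of
  each T factors accordingly, so decoupling over \<open>X\<close> starts with U = A and the
  indicator of the fixed edges as weight, and ends in an almost linear phase inside
  \<open>A\<close>.\<close>

lemma norm_avg_stars_cis_clique_count_le: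
  fixes n h k N u :: nat and A C :: "nat set" and \<omega> :: "nat set set" and \<beta> \<theta> :: real
  defines "\<T> \<equiv> {T. T \<subseteq> {1..n} \<and> card T = h}" and "X \<equiv> \<Union>c\<in>C. star c A"
  assumes AC: "A \<subseteq> {1..n}" "C \<subseteq> {1..n}" "C \<inter> A = {}"
    and h: "h = card C + k + 1" "1 \<le> k"
    and \<omega>: "\<omega> \<inter> (pairs A \<union> X) = {}" and \<beta>: "0 \<le> \<beta>" and u: "2 \<le> u"
    and low: "\<And>e. e \<in> pairs A \<Longrightarrow>
      \<beta> \<le> card {T \<in> \<T>. T \<inter> A = e \<and> C \<subseteq> T \<and> pairs T - pairs A - X \<subseteq> \<omega>}"
    and \<theta>: "\<bar>\<theta>\<bar> * real n ^ (k - 1) \<le> 1"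
  shows "norm (avg X (\<lambda>x. avg (pairs A) (\<lambda>y. cis (\<theta> * clique_count h n (\<omega> \<union> x \<union> y))))) ^ (2 ^ card C)
    \<le> clique_cis_bound n h k (card C) N (card A) u \<beta> \<theta>"
proof -
  have fin: "finite A" "finite C" "finite \<T>"
    using AC by (auto intro: finite_subset simp: \<T>_def)
  then have "finite X" by (simp add: X_def)
  note fin = fin this
  have XA: "X \<inter> pairs A = {}" using AC by (auto simp: X_def star_def pairs_def)
  define B where "B T = (\<Union>c\<in>C. if c \<in> T then star c (T \<inter> A) else {})" for T
  define \<Omega> where "\<Omega> T \<longleftrightarrow> pairs T - pairs A - X \<subseteq> \<omega>" for T
  define \<eta> where "\<eta> = Suc N * (1 + 2 * real n ^ h * \<bar>\<theta>\<bar>) ^ N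
       * exp (- (p * (1 - p) * (\<bar>\<theta>\<bar> * \<beta>)\<^sup>2 / 4)) ^ ((u choose 2) - N * h\<^sup>2)
     + 6 * (\<bar>\<theta>\<bar> * (card A * real n ^ (k - 1) / n * card A)) ^ Suc N"
  have \<eta>0: "0 \<le> \<eta>" by (simp add: \<eta>_def)
  have count: "real (clique_count h n (\<omega> \<union> x \<union> y))
      = (\<Sum>T\<in>\<T>. of_bool (\<Omega> T) * of_bool (B T \<subseteq> x) * of_bool (pairs (T \<inter> A) \<subseteq> y))"
    if "x \<subseteq> X" "y \<subseteq> pairs A" for x y
  proof -
    have eq: "pairs T \<subseteq> \<omega> \<union> x \<union> y \<longleftrightarrow> \<Omega> T \<and> B T \<subseteq> x \<and> pairs (T \<inter> A) \<subseteq> y" for T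
    proof -
      have "B T = pairs T \<inter> X" unfolding B_def X_def star_Int_pairs_Union[OF AC(3)] ..
      moreover have "pairs (T \<inter> A) = pairs T \<inter> pairs A" by (auto simp: pairs_def)
      ultimately show ?thesis using that \<omega> XA unfolding \<Omega>_def by blast
    qed
    have "real (clique_count h n (\<omega> \<union> x \<union> y)) = (\<Sum>T\<in>\<T>. of_bool (pairs T \<subseteq> \<omega> \<union> x \<union> y))"
      unfolding clique_count_eq using fin by (simp add: \<T>_def Int_def)
    then show ?thesis by (simp add: eq of_bool_conj mult.assoc)
  qed
  have "avg X (\<lambda>x. avg (pairs A) (\<lambda>y. cis (\<theta> * clique_count h n (\<omega> \<union> x \<union> y))))
    = avg (\<Union>c\<in>C. star c A) (\<lambda>x. avg (pairs A) (\<lambda>y. cis (\<theta> * (\<Sum>T\<in>\<T>.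
        of_bool (\<Omega> T) * of_bool ((\<Union>c\<in>C. if c \<in> T then star c (T \<inter> A) else {}) \<subseteq> x)
        * of_bool (pairs (T \<inter> A) \<subseteq> y)))))"
    unfolding X_def[symmetric] B_def[symmetric] by (intro avg_cong refl) (simp add: count)
  also have "norm \<dots> ^ (2 ^ card C) \<le> \<eta> + 2 ^ u * (1 - (p * (1 - p)) ^ card C / 2) ^ card A"
  proof (rule norm_avg_stars_power_le)
    show "decoupled \<T> A \<Omega> {} A (\<lambda>T. of_bool (\<Omega> T))" by (auto simp: decoupled_def)
  next
    fix U :: "nat set" and v :: "nat set \<Rightarrow> real"
    assume U: "U \<subseteq> A" and dec: "decoupled \<T> A \<Omega> C U v"
    have finU: "finite U" using U fin finite_subset by auto
    show "norm (avg (pairs A) (\<lambda>y. cis (\<theta> * (\<Sum>T\<in>\<T>. v T * of_bool (pairs (T \<inter> A) \<subseteq> y)))))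
      \<le> \<eta> + 2 ^ u * (1 / 2) ^ card U" (is "?lhs \<le> _")
    \<comment> \<open>A final \<open>U\<close> with fewer than u vertices gets only the trivial
      bound 1, which is at most 2^u (1/2)^(card U); hence K = 2^u.\<close>
    proof (cases "u \<le> card U")
      case False
      have "?lhs \<le> 1"
        using fin by (intro order.trans[OF norm_avg_le] avg_le_const) auto
      also have "(1 :: real) \<le> 2 ^ u * (1 / 2) ^ card U"
        using False by (simp add: power_divide)
      finally show ?thesis using \<eta>0 by linarith
    next
      case True
      have chU: "u choose 2 \<le> card (pairs U)" using True finU by (simp add: card_pairs binomial_right_mono)
      have "0 < u choose 2" using u by simp
      then have neU: "pairs U \<noteq> {}" using chU by auto
      have chA: "card (pairs U) \<le> card A ^ 2"
      proof -
        have "card U \<le> card A" using U fin by (simp add: card_mono)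
        have "card (pairs U) \<le> card U ^ 2"
          unfolding card_pairs[OF finU] using True u by (intro binomial_le_pow) auto
        also have "\<dots> \<le> card A ^ 2" using \<open>card U \<le> card A\<close> by (rule power_mono) simp
        finally show ?thesis .
      qed
      have "?lhs \<le> Suc N * (1 + 2 * real (card {1..n}) ^ h * \<bar>\<theta>\<bar>) ^ N
          * exp (- (p * (1 - p) * (\<bar>\<theta>\<bar> * \<beta>)\<^sup>2 / 4)) ^ (card (pairs U) - N * h\<^sup>2)
        + 6 * (\<bar>\<theta>\<bar> * (card A * real (card {1..n}) ^ (k - 1) / card {1..n} * sqrt (card (pairs U)))) ^ Suc N"
        unfolding \<T>_def
      proof (rule norm_avg_cis_supersets_le)
        fix T assume T: "T \<in> {T. T \<subseteq> {1..n} \<and> card T = h}" "T \<inter> U \<noteq> {}"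
        then show "v T = 0 \<or> v T = 1" using dec by (auto simp: decoupled_def \<T>_def)
        show "v T \<noteq> 0 \<Longrightarrow> C \<subseteq> T" using T dec by (simp add: decoupled_def \<T>_def)
      next
        fix e assume e: "e \<in> pairs U"
        then have eA: "e \<in> pairs A" using U pairs_mono by blast
        have "\<beta> \<le> card {T \<in> \<T>. T \<inter> A = e \<and> C \<subseteq> T \<and> pairs T - pairs A - X \<subseteq> \<omega>}" by (rule low) fact
        also have "\<dots> \<le> card {T \<in> \<T>. T \<inter> A = e \<and> v T = 1}"
        proof (intro of_nat_mono card_mono subsetI)
          fix T assume T: "T \<in> {T \<in> \<T>. T \<inter> A = e \<and> C \<subseteq> T \<and> pairs T - pairs A - X \<subseteq> \<omega>}"
          then have "T \<inter> A \<noteq> {}" "T \<inter> A \<subseteq> U" using e by (auto simp: pairs_def)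
          then have "v T = of_bool (\<Omega> T)" using dec T by (auto simp: decoupled_def)
          then show "T \<in> {T \<in> \<T>. T \<inter> A = e \<and> v T = 1}" using T by (simp add: \<Omega>_def)
        qed (use fin in auto)
        finally show "\<beta> \<le> card {T \<in> {T. T \<subseteq> {1..n} \<and> card T = h}. T \<inter> A = e \<and> v T = 1}"
          by (simp add: \<T>_def)
      qed (use AC U h \<beta> \<theta> neU in auto)
      also have "\<dots> \<le> \<eta>"
        unfolding \<eta>_def card_atLeastAtMost diff_Suc_1
      proof (intro add_mono mult_left_mono power_mono power_decreasing)
        have "sqrt (card (pairs U)) \<le> sqrt (real (card A ^ 2))"
          using chA by (intro real_sqrt_le_mono of_nat_mono)
        then show "sqrt (card (pairs U)) \<le> card A" by simp
        show "(u choose 2) - N * h\<^sup>2 \<le> card (pairs U) - N * h\<^sup>2" using chU by simp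
      qed (use p_pos p_less_1 in auto)
      finally show ?thesis by (smt (verit) mult_nonneg_nonneg zero_le_power zero_le_divide_1_iff)
    qed
  qed (use fin AC in auto)
  finally show ?thesis by (simp add: clique_cis_bound_def \<eta>_def)
qed

text \<open>Edges inside \<open>R\<close> are exposed first. Unless they already show the bad event,
  they contain a clique \<open>C\<close> of size r, which thus depends on them alone. All other
  edges outside the stars from \<open>C\<close> and outside \<open>A\<close> are exposed next, and
  the decoupling bound is applied to the rest. Bad exposures cost their probability.\<close>

lemma norm_avg_cis_clique_count_le:
  fixes n h k r N u :: nat and A :: "nat set" and t \<epsilon> \<theta> :: real
  defines "V \<equiv> {1..n}" and "R \<equiv> {1..n} - A"
  assumes A: "A \<subseteq> {1..n}" and h: "h = r + k + 1" "1 \<le> k" and t: "0 < t" and u: "2 \<le> u"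
    and \<theta>: "\<bar>\<theta>\<bar> * real n ^ (k - 1) \<le> 1"
    and \<epsilon>: "clique_cis_bound n h k r N (card A) u (t ^ (k - 1) / fact (k - 1)) \<theta> \<le> \<epsilon> ^ (2 ^ r)" "0 \<le> \<epsilon>"
  shows "norm (avg (pairs V) (\<lambda>G. cis (\<theta> * clique_count h n G)))
    \<le> avg (pairs V) (\<lambda>G. of_bool (\<exists>S\<subseteq>V. card S \<le> h \<and> card (common_nbrs G R S) < t)) + \<epsilon>"
proof -
  define bad where "bad G \<longleftrightarrow> (\<exists>S\<subseteq>V. card S \<le> h \<and> card (common_nbrs G R S) < t)" for G
  define M where "M = pairs V - pairs R"
  define \<phi> where "\<phi> G = cis (\<theta> * clique_count h n G)" for G
  have fin: "finite V" "finite R" "finite A" "finite M"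
    using A by (auto simp: V_def R_def M_def intro: finite_subset)
  have RV: "R \<subseteq> V" "A \<subseteq> V" "R \<inter> A = {}" "V = R \<union> A" using A by (auto simp: R_def V_def)
  have pRV: "pairs R \<subseteq> pairs V" "pairs A \<subseteq> pairs V" using RV by (auto intro!: pairs_mono)
  have split: "avg (pairs V) g = avg (pairs R) (\<lambda>\<omega>. avg M (\<lambda>F. g (\<omega> \<union> F)))" for g :: "nat set set \<Rightarrow> 'b::real_normed_vector"
  proof -
    have "avg (pairs V) g = avg (pairs R \<union> M) g" using pRV by (intro avg_cong) (auto simp: M_def)
    also have "\<dots> = avg (pairs R) (\<lambda>\<omega>. avg M (\<lambda>F. g (\<omega> \<union> F)))"
      using fin by (intro avg_Un) (auto simp: M_def)
    finally show ?thesis .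
  qed
  have phi1: "norm (\<phi> G) = 1" for G by (simp add: \<phi>_def)
  have main: "norm (avg M (\<lambda>F. \<phi> (\<omega> \<union> F))) \<le> avg M (\<lambda>F. of_bool (bad (\<omega> \<union> F))) + \<epsilon>"
    if \<omega>: "\<omega> \<subseteq> pairs R" for \<omega>
  \<comment> \<open>Common neighbourhoods within \<open>R\<close> of sets in \<open>R\<close> are
    decided by \<omega>. A failure here makes every completion bad, and the bound is
    trivial.\<close>
  proof (cases "\<exists>S\<subseteq>R. card S \<le> h \<and> card (common_nbrs \<omega> R S) < t")
    case True
    then obtain S where S: "S \<subseteq> R" "card S \<le> h" "card (common_nbrs \<omega> R S) < t" by auto
    have "common_nbrs (\<omega> \<union> F) R S = common_nbrs \<omega> R S" if "F \<subseteq> M" for F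
    proof -
      have "star z S \<subseteq> pairs R" if "z \<in> R - S" for z
        using that S by (auto simp: star_def pairs_def card_2_iff)
      then have "star z S \<subseteq> \<omega> \<union> F \<longleftrightarrow> star z S \<subseteq> \<omega>" if "z \<in> R - S" for z
        using that \<open>F \<subseteq> M\<close> \<omega> unfolding M_def by blast
      then show ?thesis by (auto simp: common_nbrs_def)
    qed
    then have "avg M (\<lambda>F. of_bool (bad (\<omega> \<union> F)) :: real) = avg M (\<lambda>F. 1)"
      using S RV by (intro avg_cong) (auto simp: bad_def intro!: exI[of _ S])
    then have "avg M (\<lambda>F. of_bool (bad (\<omega> \<union> F)) :: real) = 1" using fin by simp
    moreover have "norm (avg M (\<lambda>F. \<phi> (\<omega> \<union> F))) \<le> 1"
      by (intro order.trans[OF norm_avg_le] avg_le_const fin) (simp add: phi1)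
    ultimately show ?thesis using \<epsilon> by linarith
  next
    case False
    \<comment> \<open>Greedy extension from the empty set; only positivity of the count is used, to
      obtain one clique.\<close>
    have "t ^ r / fact r \<le> card {Z. Z \<subseteq> R - {} \<and> card Z = r \<and> pairs Z \<subseteq> \<omega> \<and> (\<forall>z\<in>Z. star z {} \<subseteq> \<omega>)}"
    proof (rule card_cliques_ge)
      fix S :: "nat set"
      assume "S \<subseteq> {} \<union> R" "card S < card ({} :: nat set) + r"
      then show "t \<le> card (common_nbrs \<omega> R S)" using False h by (force simp: not_less)
    qed (use fin t in auto)
    moreover have "0 < t ^ r / fact r" using t by simp
    ultimately have "0 < real (card {Z. Z \<subseteq> R - {} \<and> card Z = r \<and> pairs Z \<subseteq> \<omega> \<and> (\<forall>z\<in>Z. star z {} \<subseteq> \<omega>)})"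
      by (rule less_le_trans[rotated])
    then have "{Z. Z \<subseteq> R - {} \<and> card Z = r \<and> pairs Z \<subseteq> \<omega> \<and> (\<forall>z\<in>Z. star z {} \<subseteq> \<omega>)} \<noteq> {}"
      by (metis card.empty less_irrefl of_nat_0)
    then obtain C where C: "C \<subseteq> R" "card C = r" "pairs C \<subseteq> \<omega>" by auto
    have finC: "finite C" using C fin finite_subset by auto
    have CA: "C \<inter> A = {}" using C RV by auto
    define X where "X = (\<Union>c\<in>C. star c A)"
    define M' where "M' = M - (X \<union> pairs A)"
    have XM: "X \<subseteq> M"
    proof
      fix e assume "e \<in> X"
      then obtain c a where "c \<in> C" "a \<in> A" "e = {c, a}" by (auto simp: X_def star_def)
      moreover from this have "c \<noteq> a" using CA by auto
      ultimately show "e \<in> M" using C RV by (auto simp: M_def pairs_def)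
    qed
    have AM: "pairs A \<subseteq> M"
    proof
      fix e assume "e \<in> pairs A"
      then have "e \<subseteq> A" "e \<noteq> {}" "e \<in> pairs V" using pRV by (auto simp: pairs_def)
      then show "e \<in> M" using RV by (auto simp: M_def pairs_def)
    qed
    have finX: "finite X" "finite M'" using fin finC by (auto simp: X_def M'_def)
    have XA: "X \<inter> pairs A = {}" using CA by (auto simp: X_def star_def pairs_def)
    \<comment> \<open>Restricting to sets S containing \<open>C\<close> makes the event independent
      of the edges to be averaged: a candidate z outside S is not in \<open>C\<close>, so its edges
      to S lie neither in \<open>X\<close> nor inside \<open>A\<close>.\<close>
    define badC where "badC G \<longleftrightarrow> (\<exists>S\<subseteq>V. C \<subseteq> S \<and> card S \<le> h \<and> card (common_nbrs G R S) < t)" for G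
    have badC: "badC (\<omega> \<union> F) \<longleftrightarrow> badC (\<omega> \<union> (F \<inter> M'))" if F: "F \<subseteq> M" for F
    proof -
      have "common_nbrs (\<omega> \<union> F) R S = common_nbrs (\<omega> \<union> (F \<inter> M')) R S" if "C \<subseteq> S" "S \<subseteq> V" for S
      proof -
        have "star z S \<inter> (X \<union> pairs A) = {}" if "z \<in> R - S" for z
          using that \<open>C \<subseteq> S\<close> RV C by (fastforce simp: X_def star_def pairs_def doubleton_eq_iff)
        then have "star z S \<subseteq> \<omega> \<union> F \<longleftrightarrow> star z S \<subseteq> \<omega> \<union> (F \<inter> M')" if "z \<in> R - S" for z
          using that F unfolding M'_def by blast
        then show ?thesis by (auto simp: common_nbrs_def)
      qed
      then show ?thesis unfolding badC_def by metis
    qed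
    have split': "avg M g = avg M' (\<lambda>F. avg X (\<lambda>x. avg (pairs A) (\<lambda>y. g (F \<union> x \<union> y))))"
      for g :: "nat set set \<Rightarrow> complex"
    proof -
      have "avg M g = avg (M' \<union> (X \<union> pairs A)) g" using XM AM by (intro avg_cong) (auto simp: M'_def)
      also have "\<dots> = avg M' (\<lambda>F. avg (X \<union> pairs A) (\<lambda>z. g (F \<union> z)))"
        using fin finX by (intro avg_Un) (auto simp: M'_def)
      also have "\<dots> = avg M' (\<lambda>F. avg X (\<lambda>x. avg (pairs A) (\<lambda>y. g (F \<union> (x \<union> y)))))"
        using fin finX XA by (intro avg_cong refl avg_Un) auto
      finally show ?thesis by (simp add: Un_assoc)
    qed
    have inner: "norm (avg X (\<lambda>x. avg (pairs A) (\<lambda>y. \<phi> (\<omega> \<union> (F \<union> x \<union> y)))))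
        \<le> of_bool (badC (\<omega> \<union> F)) + \<epsilon>" (is "?lhs \<le> _") if F: "F \<subseteq> M'" for F
    proof (cases "badC (\<omega> \<union> F)")
      case True
      have "?lhs \<le> avg X (\<lambda>x. norm (avg (pairs A) (\<lambda>y. \<phi> (\<omega> \<union> (F \<union> x \<union> y)))))" by (rule norm_avg_le)
      also have "\<dots> \<le> 1"
        using fin finX by (intro avg_le_const order.trans[OF norm_avg_le]) (auto simp: phi1)
      finally show ?thesis using True \<epsilon> by simp
    next
      case False
      have "?lhs ^ (2 ^ card C) \<le> clique_cis_bound n h k (card C) N (card A) u (t ^ (k - 1) / fact (k - 1)) \<theta>"
        unfolding \<phi>_def Un_assoc[symmetric] unfolding X_def
      proof (rule norm_avg_stars_cis_clique_count_le)
        show "(\<omega> \<union> F) \<inter> (pairs A \<union> (\<Union>c\<in>C. star c A)) = {}"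
          using \<omega> F AM XM unfolding X_def[symmetric] M'_def M_def by blast
      next
        fix e assume e: "e \<in> pairs A"
        have e2: "e \<subseteq> A" "card e = 2" using e by (auto simp: pairs_def)
        have fine: "finite e" using e2 fin finite_subset by auto
        \<comment> \<open>Completing C and the edge e by k - 1 vertices of \<open>R\<close> gives h
          vertices, as r + 2 + (k - 1) = h. Common neighbours of sets containing \<open>C\<close>
          suffice for this.\<close>
        define S0 where "S0 = C \<union> e"
        have S0: "finite S0" "card S0 = r + 2" "S0 \<subseteq> V"
        proof -
          have "C \<inter> e = {}" using CA e2 by auto
          then show "card S0 = r + 2" using fine finC C e2 by (simp add: S0_def card_Un_disjoint)
        qed (use fine finC C e2 RV in \<open>auto simp: S0_def\<close>)
        have "t ^ (k - 1) / fact (k - 1)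
            \<le> card {Z. Z \<subseteq> R - S0 \<and> card Z = k - 1 \<and> pairs Z \<subseteq> \<omega> \<union> F \<and> (\<forall>z\<in>Z. star z S0 \<subseteq> \<omega> \<union> F)}"
        proof (rule card_cliques_ge)
          fix S assume S: "S0 \<subseteq> S" "S \<subseteq> S0 \<union> R" "card S < card S0 + (k - 1)"
          then have "S \<subseteq> V" "C \<subseteq> S" "card S \<le> h" using S0 RV h by (auto simp: S0_def)
          then show "t \<le> card (common_nbrs (\<omega> \<union> F) R S)" using False by (force simp: badC_def not_less)
        qed (use S0 fin t in auto)
        also have "\<dots> \<le> card {T \<in> {T. T \<subseteq> {1..n} \<and> card T = h}. T \<inter> A = e \<and> C \<subseteq> T
            \<and> pairs T - pairs A - (\<Union>c\<in>C. star c A) \<subseteq> \<omega> \<union> F}"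
        proof (intro of_nat_mono card_inj_on_le[where f = "\<lambda>Z. S0 \<union> Z"])
          show "inj_on (\<lambda>Z. S0 \<union> Z) {Z. Z \<subseteq> R - S0 \<and> card Z = k - 1 \<and> pairs Z \<subseteq> \<omega> \<union> F \<and> (\<forall>z\<in>Z. star z S0 \<subseteq> \<omega> \<union> F)}"
            by (intro inj_onI) blast
          show "(\<lambda>Z. S0 \<union> Z) ` {Z. Z \<subseteq> R - S0 \<and> card Z = k - 1 \<and> pairs Z \<subseteq> \<omega> \<union> F \<and> (\<forall>z\<in>Z. star z S0 \<subseteq> \<omega> \<union> F)}
            \<subseteq> {T \<in> {T. T \<subseteq> {1..n} \<and> card T = h}. T \<inter> A = e \<and> C \<subseteq> T
            \<and> pairs T - pairs A - (\<Union>c\<in>C. star c A) \<subseteq> \<omega> \<union> F}"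
          proof (intro image_subsetI CollectI conjI)
            fix Z assume Z: "Z \<in> {Z. Z \<subseteq> R - S0 \<and> card Z = k - 1 \<and> pairs Z \<subseteq> \<omega> \<union> F \<and> (\<forall>z\<in>Z. star z S0 \<subseteq> \<omega> \<union> F)}"
            have finZ: "finite Z" using Z fin by (auto intro: finite_subset)
            show "S0 \<union> Z \<subseteq> {1..n}" using Z S0 RV by (auto simp: V_def)
            show "card (S0 \<union> Z) = h"
              using Z S0 finZ h by (subst card_Un_disjoint) auto
            show "(S0 \<union> Z) \<inter> A = e" using Z C RV e2 by (auto simp: S0_def)
            show "C \<subseteq> S0 \<union> Z" by (auto simp: S0_def)
            show "pairs (S0 \<union> Z) - pairs A - (\<Union>c\<in>C. star c A) \<subseteq> \<omega> \<union> F"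
            proof
              fix d assume d: "d \<in> pairs (S0 \<union> Z) - pairs A - (\<Union>c\<in>C. star c A)"
              then obtain x y where xy: "d = {x, y}" "x \<noteq> y" "x \<in> S0 \<union> Z" "y \<in> S0 \<union> Z"
                by (auto simp: pairs_def card_2_iff)
              have sym: "{a, b} = {b, a}" for a b :: nat by auto
              \<comment> \<open>Pairs touching Z are supplied by the extension and pairs in C by the
                clique; the remaining types are excluded, being inside \<open>A\<close> or in a
                star.\<close>
              consider "x \<in> Z" "y \<in> Z" | "x \<in> Z" "y \<in> S0" | "y \<in> Z" "x \<in> S0" | "x \<in> C" "y \<in> C"
                | "x \<in> e" "y \<in> e" | "x \<in> C" "y \<in> e" | "x \<in> e" "y \<in> C"
                using xy by (auto simp: S0_def)
              then show "d \<in> \<omega> \<union> F"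
              proof cases
                case 1
                then have "d \<in> pairs Z" using xy by (auto simp: pairs_def)
                then show ?thesis using Z by blast
              next
                case 2
                then have "d \<in> star x S0" using xy by (auto simp: star_def)
                then show ?thesis using Z 2 by blast
              next
                case 3
                then have "d \<in> star y S0" using xy sym[of x y] by (auto simp: star_def)
                then show ?thesis using Z 3 by blast
              next
                case 4
                then have "d \<in> pairs C" using xy by (auto simp: pairs_def)
                then show ?thesis using C by auto
              next
                case 5
                then have "d \<in> pairs A" using xy e2 by (auto simp: pairs_def)
                then show ?thesis using d by auto
              next
                case 6 then show ?thesis using d xy e2 by (auto simp: star_def)
              next
                case 7 then show ?thesis using d xy sym[of x y] e2 by (auto simp: star_def)
              qed
            qed
          qed
        qed auto
        finally show "t ^ (k - 1) / fact (k - 1)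
          \<le> card {T \<in> {T. T \<subseteq> {1..n} \<and> card T = h}. T \<inter> A = e \<and> C \<subseteq> T
            \<and> pairs T - pairs A - (\<Union>c\<in>C. star c A) \<subseteq> \<omega> \<union> F}" .
      qed (use A C CA h t u \<theta> RV in \<open>auto simp: V_def\<close>)
      then have "?lhs ^ (2 ^ r) \<le> \<epsilon> ^ (2 ^ r)"
        unfolding C(2) by (rule order.trans[OF _ \<epsilon>(1)])
      then have "?lhs \<le> \<epsilon>" using \<epsilon> by (subst (asm) power_mono_iff) auto
      then show ?thesis by simp
    qed
    have "norm (avg M (\<lambda>F. \<phi> (\<omega> \<union> F)))
        = norm (avg M' (\<lambda>F. avg X (\<lambda>x. avg (pairs A) (\<lambda>y. \<phi> (\<omega> \<union> (F \<union> x \<union> y))))))"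
      by (simp only: split')
    also have "\<dots> \<le> avg M' (\<lambda>F. of_bool (badC (\<omega> \<union> F)) + \<epsilon>)"
      by (rule order.trans[OF norm_avg_le], rule avg_mono, rule inner)
    also have "\<dots> = avg M' (\<lambda>F. of_bool (badC (\<omega> \<union> F))) + \<epsilon>"
      using finX by (simp add: avg_add)
    also have "avg M' (\<lambda>F. of_bool (badC (\<omega> \<union> F)) :: real) = avg M (\<lambda>F. of_bool (badC (\<omega> \<union> F)))"
      using fin badC by (intro avg_restrict[symmetric]) (auto simp: M'_def)
    also have "\<dots> \<le> avg M (\<lambda>F. of_bool (bad (\<omega> \<union> F)))"
      by (intro avg_mono) (auto simp: bad_def badC_def)
    finally show ?thesis by simp
  qed
  have "norm (avg (pairs V) \<phi>) \<le> avg (pairs R) (\<lambda>\<omega>. norm (avg M (\<lambda>F. \<phi> (\<omega> \<union> F))))"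
    unfolding split by (rule norm_avg_le)
  also have "\<dots> \<le> avg (pairs R) (\<lambda>\<omega>. avg M (\<lambda>F. of_bool (bad (\<omega> \<union> F))) + \<epsilon>)"
    by (intro avg_mono main)
  also have "\<dots> = avg (pairs V) (\<lambda>G. of_bool (bad G)) + \<epsilon>"
    unfolding split using fin by (simp add: avg_add)
  finally show ?thesis by (simp add: \<phi>_def[abs_def] bad_def)
qed

end

section \<open>Asymptotic comparisons and choice of parameters\<close>

lemma eventually_powr_exp_le:
  fixes C M c a K D :: real
  assumes "0 < c" "0 < a" "0 < K"
  shows "\<forall>\<^sub>F n :: nat in sequentially. C * real n powr M * exp (- c * real n powr a) \<le> K * real n powr (- D)"
proof -
  have "((\<lambda>n :: nat. C * real n powr (M + D) * exp (- c * real n powr a)) \<longlongrightarrow> 0) sequentially"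
    using assms by real_asymp
  then have "\<forall>\<^sub>F n :: nat in sequentially. C * real n powr (M + D) * exp (- c * real n powr a) < K"
    using assms(3) by (rule order_tendstoD)
  then show ?thesis using eventually_gt_at_top[of 0]
  proof eventually_elim
    case (elim n)
    then have "(C * real n powr (M + D) * exp (- c * real n powr a)) * real n powr (- D) \<le> K * real n powr (- D)"
      by (intro mult_right_mono) auto
    moreover have "(C * real n powr (M + D) * exp (- c * real n powr a)) * real n powr (- D)
        = C * (real n powr (M + D) * real n powr (- D)) * exp (- c * real n powr a)"
      by (simp only: mult_ac)
    moreover have "real n powr (M + D) * real n powr (- D) = real n powr M" by (simp flip: powr_add)
    ultimately show ?case by metis
  qed
qed

lemma eventually_powr_le:
  fixes C K M D :: real
  assumes "D < M" "0 < K"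
  shows "\<forall>\<^sub>F n :: nat in sequentially. C * real n powr (- M) \<le> K * real n powr (- D)"
proof -
  have "((\<lambda>n :: nat. C * real n powr (D - M)) \<longlongrightarrow> 0) sequentially"
    using assms by real_asymp
  then have "\<forall>\<^sub>F n :: nat in sequentially. C * real n powr (D - M) < K"
    using assms by (intro order_tendstoD) auto
  then show ?thesis using eventually_gt_at_top[of 0]
  proof eventually_elim
    case (elim n)
    then have "(C * real n powr (D - M)) * real n powr (- D) \<le> K * real n powr (- D)"
      by (intro mult_right_mono) auto
    moreover have "real n powr (D - M) * real n powr (- D) = real n powr (- M)" by (simp flip: powr_add)
    ultimately show ?case by (simp add: mult.assoc)
  qed
qed

context bernoulli_param
begin

text \<open>\<open>A\<close> is taken to be {1..q}, with q depending on \<theta>. All comparisons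
  required of n are stated before \<theta> is fixed, so that one threshold serves the whole
  range.\<close>

lemma eventually_norm_avg_cis_clique_count_le:
  fixes e D :: real
  assumes k: "1 \<le> k" "k < h" and e: "0 < e" "e \<le> 1"
  shows "\<forall>\<^sub>F n in sequentially. \<forall>\<theta>. real n powr (e - real k) \<le> \<bar>\<theta>\<bar> \<longrightarrow>
    \<bar>\<theta>\<bar> \<le> real n powr (1 - real k - e) \<longrightarrow>
    norm (avg (pairs {1..n}) (\<lambda>G. cis (\<theta> * clique_count h n G))) \<le> real n powr (- D)"
proof -
  define r where "r = h - k - 1"
  have h: "h = r + k + 1" using k by (simp add: r_def)
  define \<rho> where "\<rho> = (p * (1 - p)) ^ r"
  have pp: "0 < p * (1 - p)" "p * (1 - p) \<le> 1"
    using p_pos p_less_1 mult_mono[of p 1 "1 - p" 1] by auto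
  then have \<rho>: "0 < \<rho>" "\<rho> \<le> 1" by (auto simp: \<rho>_def intro: power_le_one)
  define c1 where "c1 = (p ^ h / 16) ^ (k - 1) / fact (k - 1)"
  have c1: "0 < c1" using p_pos by (simp add: c1_def)
  \<comment> \<open>2048 = 4 * 256 * 2: the 4 from the decay of one edge, 256 from \<open>m\<close>
    \<ge> \<rho>^2 q^2 / 256, and 2 because at most half of these edges are lost to the Taylor
    monomials.\<close>
  define c2 where "c2 = p * (1 - p) * c1\<^sup>2 * \<rho>\<^sup>2 / 2048"
  have c2: "0 < c2" using pp c1 \<rho> by (simp add: c2_def)
  \<comment> \<open>Decoupling bounds the power 2^r, so this larger exponent is needed before taking
    roots.\<close>
  define D' where "D' = D * 2 ^ r"
  \<comment> \<open>The Taylor remainder is of order n^(-(N+1) e/2) and must be smaller than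
    n^(-D').\<close>
  define N where "N = nat \<lceil>2 * (\<bar>D'\<bar> + 1) / e\<rceil>"
  have N: "D' < Suc N * (e / 2)"
  proof -
    have "2 * (\<bar>D'\<bar> + 1) / e \<le> Suc N" unfolding N_def by linarith
    then have "\<bar>D'\<bar> + 1 \<le> Suc N * (e / 2)" using e by (simp add: field_simps)
    then show ?thesis by linarith
  qed
  \<comment> \<open>Each of the three summands of \<open>clique_cis_bound\<close> gets a third of
    (n^(-D) / 2)^(2^r); the other half of n^(-D) is left for the bad event.\<close>
  define K where "K = (1 / 2) ^ (2 ^ r) / (3 :: real)"
  have K: "0 < K" by (simp add: K_def)
  have "\<forall>\<^sub>F n :: nat in sequentially. 8 \<le> \<rho> * real n powr (5 * e / 4)"
    using \<rho> e by real_asymp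
  moreover have "\<forall>\<^sub>F n :: nat in sequentially. 2 * real n powr (1 - 3 * e / 4) \<le> real n / 2"
    using e by real_asymp
  moreover have "\<forall>\<^sub>F n :: nat in sequentially. 2 * (real N * real h ^ 2) \<le> \<rho>\<^sup>2 * real n powr (5 * e / 2) / 256"
    using \<rho> e by real_asymp
  moreover have "\<forall>\<^sub>F n :: nat in sequentially.
      (real (Suc N) * 3 ^ N) * real n powr (real h * N) * exp (- c2 * real n powr (e / 2)) \<le> K * real n powr (- D')"
    using c2 e K by (intro eventually_powr_exp_le) auto
  moreover have "\<forall>\<^sub>F n :: nat in sequentially. (6 * 4 ^ Suc N) * real n powr (- (Suc N * (e / 2))) \<le> K * real n powr (- D')"
    using N K by (intro eventually_powr_le) auto
  moreover have "\<forall>\<^sub>F n :: nat in sequentially. 1 * real n powr 0 * exp (- (\<rho> / 4) * real n powr e) \<le> K * real n powr (- D')"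
    using \<rho> e K by (intro eventually_powr_exp_le) auto
  moreover have "\<forall>\<^sub>F n :: nat in sequentially.
      ((real h + 1) * 2 ^ h * exp h) * real n powr h * exp (- (p ^ h / 8) * real n powr 1) \<le> (1 / 2) * real n powr (- D)"
    using p_pos by (intro eventually_powr_exp_le) auto
  ultimately show ?thesis using eventually_gt_at_top[of 0]
  proof eventually_elim
    case (elim n)
    note F = elim(1-3) and E = elim(4-7)
    have n: "0 < real n" "1 \<le> real n" using elim(8) by auto
    show ?case
    proof (intro allI impI)
      fix \<theta> assume \<theta>: "real n powr (e - real k) \<le> \<bar>\<theta>\<bar>" "\<bar>\<theta>\<bar> \<le> real n powr (1 - real k - e)"
      define a where "a = \<bar>\<theta>\<bar> * real n ^ (k - 1)"
      have nk: "real n ^ (k - 1) = real n powr (real k - 1)"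
        using n k by (simp add: of_nat_diff flip: powr_realpow)
      have a: "real n powr (e - 1) \<le> a" "a \<le> real n powr (- e)"
      proof -
        have "real n powr (e - 1) = real n powr (e - real k) * real n powr (real k - 1)"
          by (simp flip: powr_add)
        also have "\<dots> \<le> a" unfolding a_def nk using \<theta> by (intro mult_right_mono) auto
        finally show "real n powr (e - 1) \<le> a" .
        have "a \<le> real n powr (1 - real k - e) * real n powr (real k - 1)"
          unfolding a_def nk using \<theta> by (intro mult_right_mono) auto
        also have "\<dots> = real n powr (- e)" by (simp flip: powr_add)
        finally show "a \<le> real n powr (- e)" .
      qed
      have a0: "0 < a" using a(1) n by (smt (verit) powr_gt_zero)
      have a1: "a \<le> 1"
      proof -
        have "real n powr (- e) \<le> real n powr 0" using n e by (intro powr_mono) auto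
        then show ?thesis using a n by simp
      qed
      have \<theta>1: "\<bar>\<theta>\<bar> \<le> 1"
      proof -
        have "real n powr (1 - real k - e) \<le> real n powr 0" using n e k by (intro powr_mono) auto
        then show ?thesis using \<theta> n by simp
      qed
      \<comment> \<open>The size of \<open>A\<close> up to rounding, chosen so that a q is of order
        n^(e/4): large enough for the linear part, yet a q^2 / n is only of order n^(-e/2).\<close>
      define x where "x = real n powr (e / 4) / a"
      have x: "real n powr (5 * e / 4) \<le> x" "x \<le> real n powr (1 - 3 * e / 4)"
      proof -
        have "real n powr (5 * e / 4) = real n powr (e / 4) / real n powr (- e)"
          by (simp flip: powr_diff)
        also have "\<dots> \<le> x" unfolding x_def using a a0 n by (intro divide_left_mono) auto
        finally show "real n powr (5 * e / 4) \<le> x" .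
        have "x \<le> real n powr (e / 4) / real n powr (e - 1)"
          unfolding x_def using a a0 n by (intro divide_left_mono) auto
        also have "\<dots> = real n powr (1 - 3 * e / 4)" by (simp flip: powr_diff)
        finally show "x \<le> real n powr (1 - 3 * e / 4)" .
      qed
      have "real n powr 0 \<le> real n powr (5 * e / 4)" using n e by (intro powr_mono) auto
      then have x1: "1 \<le> x" using x n by simp
      define q where "q = nat \<lceil>x\<rceil>"
      have q: "x \<le> q" "q \<le> 2 * x" unfolding q_def using x1 by linarith+
      have qn: "real q \<le> real n / 2" using q x F(2) by linarith
      have aq: "real n powr (e / 4) \<le> a * q" "a * q \<le> 2 * real n powr (e / 4)"
        using q a0 by (auto simp: x_def field_simps)
      \<comment> \<open>About \<rho> q vertices are expected to survive the r rounds. At a quarter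
        of this, 2^u (1 - \<rho>/2)^q is at most exp (-\<rho> q / 4).\<close>
      define u where "u = nat \<lfloor>\<rho> * q / 4\<rfloor>"
      have \<rho>q: "8 \<le> \<rho> * q"
      proof -
        have "\<rho> * real n powr (5 * e / 4) \<le> \<rho> * q" using \<rho> x q by (intro mult_left_mono) auto
        then show ?thesis using F(1) by linarith
      qed
      have u: "real u \<le> \<rho> * q / 4" "\<rho> * q / 8 \<le> u" unfolding u_def using \<rho>q by linarith+
      have u2: "2 \<le> u" unfolding u_def using \<rho>q by linarith
      define m where "m = u choose 2"
      have m: "\<rho>\<^sup>2 * (real q)\<^sup>2 / 256 \<le> m"
      proof -
        have "real m = real u * (real u - 1) / 2"
          unfolding m_def using u2 by (simp add: choose_two real_of_nat_div of_nat_diff)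
        moreover have "real u * (real u / 2) \<le> real u * (real u - 1)" using u2 by (intro mult_left_mono) auto
        ultimately have "real u * real u / 4 \<le> real m" by simp
        moreover have "(\<rho> * q / 8) * (\<rho> * q / 8) \<le> real u * real u" using u \<rho> by (intro mult_mono) auto
        ultimately have "(\<rho> * q) * (\<rho> * q) / 256 \<le> real m" by simp
        then show ?thesis by (simp add: power2_eq_square mult_ac)
      qed
      have q2: "real n powr (5 * e / 2) \<le> (real q)\<^sup>2"
      proof -
        have "real n powr (5 * e / 2) = (real n powr (5 * e / 4))\<^sup>2"
          by (simp add: power2_eq_square flip: powr_add)
        also have "\<dots> \<le> (real q)\<^sup>2" using x q by (intro power_mono) auto
        finally show ?thesis .
      qed
      have m2: "2 * (real N * real h ^ 2) \<le> m"
      proof -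
        have "\<rho>\<^sup>2 * real n powr (5 * e / 2) / 256 \<le> \<rho>\<^sup>2 * (real q)\<^sup>2 / 256"
          using q2 by (intro divide_right_mono mult_left_mono) auto
        then show ?thesis using F(3) m by linarith
      qed
      have mN: "real m / 2 \<le> real (m - N * h\<^sup>2)"
      proof -
        have "real m - real (N * h\<^sup>2) \<le> real (m - N * h\<^sup>2)" by linarith
        then show ?thesis using m2 by simp
      qed
      \<comment> \<open>Since \<open>R\<close> has at least n/2 vertices, the Chernoff exponent is
        about p^h n / 4; subtracting t still leaves more than p^h n / 8, up to a constant.\<close>
      define t where "t = p ^ h / 16 * n"
      have t: "0 < t" using p_pos n by (simp add: t_def)
      define \<beta> where "\<beta> = t ^ (k - 1) / fact (k - 1)"
      have \<beta>: "\<bar>\<theta>\<bar> * \<beta> = c1 * a"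
        by (simp only: \<beta>_def t_def c1_def a_def power_mult_distrib) (simp add: mult_ac)
      have B1: "Suc N * (1 + 2 * real n ^ h * \<bar>\<theta>\<bar>) ^ N
          * exp (- (p * (1 - p) * (\<bar>\<theta>\<bar> * \<beta>)\<^sup>2 / 4)) ^ (m - N * h\<^sup>2) \<le> K * real n powr (- D')"
      proof -
        have "exp (- (p * (1 - p) * (\<bar>\<theta>\<bar> * \<beta>)\<^sup>2 / 4)) ^ (m - N * h\<^sup>2)
            = exp (- (p * (1 - p) * (c1 * a)\<^sup>2 / 4 * real (m - N * h\<^sup>2)))"
          unfolding \<beta> by (simp add: mult_ac flip: exp_of_nat_mult)
        also have "\<dots> \<le> exp (- c2 * real n powr (e / 2))"
        proof -
          have "c2 * real n powr (e / 2) \<le> c2 * (a * q)\<^sup>2"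
          proof -
            have "real n powr (e / 2) = (real n powr (e / 4))\<^sup>2"
              by (simp add: power2_eq_square flip: powr_add)
            also have "\<dots> \<le> (a * q)\<^sup>2" using aq by (intro power_mono) auto
            finally show ?thesis using c2 by (intro mult_left_mono) auto
          qed
          also have "\<dots> = p * (1 - p) * (c1 * a)\<^sup>2 / 4 * (\<rho>\<^sup>2 * (real q)\<^sup>2 / 256 / 2)"
            by (simp add: c2_def power_mult_distrib)
          also have "\<dots> \<le> p * (1 - p) * (c1 * a)\<^sup>2 / 4 * real (m - N * h\<^sup>2)"
            using pp m mN by (intro mult_left_mono) auto
          finally show ?thesis by simp
        qed
        finally have ex: "exp (- (p * (1 - p) * (\<bar>\<theta>\<bar> * \<beta>)\<^sup>2 / 4)) ^ (m - N * h\<^sup>2)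
            \<le> exp (- c2 * real n powr (e / 2))" .
        have "(1 + 2 * real n ^ h * \<bar>\<theta>\<bar>) ^ N \<le> (3 * real n ^ h) ^ N"
        proof (rule power_mono)
          have "1 \<le> real n ^ h" using n by simp
          moreover have "real n ^ h * \<bar>\<theta>\<bar> \<le> real n ^ h * 1" using \<theta>1 by (intro mult_left_mono) auto
          ultimately show "1 + 2 * real n ^ h * \<bar>\<theta>\<bar> \<le> 3 * real n ^ h" by linarith
        qed simp
        also have "\<dots> = 3 ^ N * real n powr (real h * N)"
          using n by (simp add: power_mult_distrib powr_powr flip: powr_realpow)
        finally have "Suc N * (1 + 2 * real n ^ h * \<bar>\<theta>\<bar>) ^ N
          * exp (- (p * (1 - p) * (\<bar>\<theta>\<bar> * \<beta>)\<^sup>2 / 4)) ^ (m - N * h\<^sup>2)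
          \<le> Suc N * (3 ^ N * real n powr (real h * N)) * exp (- c2 * real n powr (e / 2))"
          using ex by (intro mult_mono mult_left_mono) auto
        also have "\<dots> \<le> K * real n powr (- D')" using E(1) by (simp only: mult.assoc)
        finally show ?thesis .
      qed
      have B2: "6 * (\<bar>\<theta>\<bar> * (q * real n ^ (k - 1) / n * q)) ^ Suc N \<le> K * real n powr (- D')"
      proof -
        have "\<bar>\<theta>\<bar> * (q * real n ^ (k - 1) / n * q) = (a * q) * (q / n)" by (simp add: a_def)
        also have "\<dots> \<le> (2 * real n powr (e / 4)) * (2 * real n powr (- (3 * e / 4)))"
        proof (rule mult_mono[OF aq(2)])
          have "real q \<le> 2 * real n powr (1 - 3 * e / 4)" using q x by linarith
          also have "\<dots> = 2 * real n powr (- (3 * e / 4)) * n"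
            using n powr_add[of "real n" "- (3 * e / 4)" 1] by simp
          finally show "real q / n \<le> 2 * real n powr (- (3 * e / 4))" using n by (simp add: field_simps)
        qed auto
        also have "\<dots> = 4 * real n powr (- (e / 2))" by (simp flip: powr_add)
        finally have "(\<bar>\<theta>\<bar> * (q * real n ^ (k - 1) / n * q)) ^ Suc N \<le> (4 * real n powr (- (e / 2))) ^ Suc N"
          by (rule power_mono) auto
        also have "\<dots> = 4 ^ Suc N * real n powr (- (Suc N * (e / 2)))"
          using n by (simp only: power_mult_distrib powr_power) (simp add: algebra_simps)
        finally show ?thesis using E(2) by linarith
      qed
      have B3: "2 ^ u * (1 - (p * (1 - p)) ^ r / 2) ^ q \<le> K * real n powr (- D')"
      proof -
        have "(2 :: real) ^ u \<le> exp 1 ^ u" using exp_ge_add_one_self[of 1] by (intro power_mono) auto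
        moreover have "(1 - (p * (1 - p)) ^ r / 2) ^ q \<le> exp (- (\<rho> / 2)) ^ q"
          using exp_ge_add_one_self[of "- (\<rho> / 2)"] \<rho> unfolding \<rho>_def[symmetric] by (intro power_mono) auto
        ultimately have "2 ^ u * (1 - (p * (1 - p)) ^ r / 2) ^ q \<le> exp 1 ^ u * exp (- (\<rho> / 2)) ^ q"
          using \<rho> unfolding \<rho>_def[symmetric] by (intro mult_mono) auto
        also have "\<dots> = exp (u - \<rho> / 2 * q)"
          unfolding exp_of_nat_mult[symmetric] exp_add[symmetric] by (simp add: algebra_simps)
        also have "\<dots> \<le> exp (- (\<rho> / 4) * real n powr e)"
        proof -
          have "real n powr e \<le> real n powr (5 * e / 4)" using n e by (intro powr_mono) auto
          then have "real n powr e \<le> q" using x q by linarith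
          then have "\<rho> / 4 * real n powr e \<le> \<rho> / 4 * q" using \<rho> by (intro mult_left_mono) auto
          then show ?thesis using u by simp
        qed
        also have "\<dots> \<le> K * real n powr (- D')" using E(3) n by simp
        finally show ?thesis .
      qed
      have "clique_cis_bound n h k r N q u \<beta> \<theta> \<le> 3 * (K * real n powr (- D'))"
        unfolding clique_cis_bound_def m_def[symmetric] using B1 B2 B3 by linarith
      also have "\<dots> = (1 / 2 * real n powr (- D)) ^ (2 ^ r)"
        unfolding K_def D'_def power_mult_distrib using n by (simp add: powr_power mult.commute)
      finally have bound: "clique_cis_bound n h k r N q u \<beta> \<theta> \<le> (1 / 2 * real n powr (- D)) ^ (2 ^ r)" .
      have "norm (avg (pairs {1..n}) (\<lambda>G. cis (\<theta> * clique_count h n G)))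
        \<le> avg (pairs {1..n}) (\<lambda>G. of_bool (\<exists>S\<subseteq>{1..n}. card S \<le> h \<and> card (common_nbrs G ({1..n} - {1..q}) S) < t))
          + 1 / 2 * real n powr (- D)"
      proof (rule norm_avg_cis_clique_count_le)
        show "{1..q} \<subseteq> {1..n}" using qn by auto
        show "clique_cis_bound n h k r N (card {1..q}) u (t ^ (k - 1) / fact (k - 1)) \<theta>
          \<le> (1 / 2 * real n powr (- D)) ^ (2 ^ r)" using bound by (simp add: \<beta>_def)
      qed (use h k t u2 a1 in \<open>auto simp: a_def\<close>)
      also have "avg (pairs {1..n}) (\<lambda>G. of_bool (\<exists>S\<subseteq>{1..n}. card S \<le> h \<and> card (common_nbrs G ({1..n} - {1..q}) S) < t))
          \<le> (real h + 1) * (real (card {1..n}) + 1) ^ h * exp (t - p ^ h * (real (card ({1..n} - {1..q})) - real h) / 2)"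
        by (rule avg_ex_few_common_nbrs_le) auto
      also have "\<dots> \<le> (real h + 1) * (2 ^ h * real n powr h) * (exp h * exp (- (p ^ h / 8) * real n powr 1))"
      proof (intro mult_mono)
        have "(real (card {1..n}) + 1) ^ h \<le> (2 * real n) ^ h" using n by (intro power_mono) auto
        also have "\<dots> = 2 ^ h * real n powr h" using n by (simp add: power_mult_distrib powr_realpow)
        finally show "(real (card {1..n}) + 1) ^ h \<le> 2 ^ h * real n powr h" .
        have "card ({1..n} - {1..q}) = n - q"
          using qn by (subst card_Diff_subset) auto
        then have "real n / 2 \<le> real (card ({1..n} - {1..q}))" using qn by simp
        then have "p ^ h * (real n / 2 - real h) \<le> p ^ h * (real (card ({1..n} - {1..q})) - real h)"
          using p_pos by (intro mult_left_mono) auto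
        moreover have "p ^ h * real h \<le> 1 * real h" using p_pos p_less_1 by (intro mult_right_mono power_le_one) auto
        moreover have "0 \<le> p ^ h * real n" using p_pos by simp
        moreover have "yn / 16 - (yc - yh) / 2 \<le> h - yn / 8"
          if "yn / 2 - yh \<le> yc - yh" "yh \<le> h" "0 \<le> yn" for yn yh yc :: real
          using that of_nat_0_le_iff[of h, where ?'a = real] by (simp add: field_simps)
        ultimately have "p ^ h * n / 16 - (p ^ h * real (card ({1..n} - {1..q})) - p ^ h * h) / 2 \<le> h - p ^ h * n / 8"
          by (simp add: right_diff_distrib)
        then have "t - p ^ h * (real (card ({1..n} - {1..q})) - real h) / 2 \<le> h + - (p ^ h / 8) * real n"
          by (simp add: t_def right_diff_distrib)
        then show "exp (t - p ^ h * (real (card ({1..n} - {1..q})) - real h) / 2)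
            \<le> exp h * exp (- (p ^ h / 8) * real n powr 1)"
          using n by (simp flip: exp_add)
      qed auto
      also have "\<dots> \<le> (1 / 2) * real n powr (- D)" using E(4) by (simp only: mult_ac)
      finally show "norm (avg (pairs {1..n}) (\<lambda>G. cis (\<theta> * clique_count h n G))) \<le> real n powr (- D)"
        by simp
    qed
  qed
qed

end

section \<open>Window probabilities\<close>

text \<open>Characteristic function of the uniform distribution on {0..<L}, a normalised Dirichlet
  kernel.\<close>

definition uniform_cis :: "nat \<Rightarrow> real \<Rightarrow> complex" where
  "uniform_cis L \<theta> = (\<Sum>u<L. cis (\<theta> * real u)) / of_nat L"

lemma continuous_on_uniform_cis [continuous_intros]:
  "continuous_on S (uniform_cis L)"
  unfolding uniform_cis_def[abs_def] cis_conv_exp divide_inverse by (intro continuous_intros)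

lemma norm_uniform_cis_le_1: "norm (uniform_cis L \<theta>) \<le> 1"
proof -
  have "norm (\<Sum>u<L. cis (\<theta> * real u)) \<le> (\<Sum>u<L. 1)"
    by (intro order.trans[OF norm_sum] sum_mono) simp
  then show ?thesis by (cases "L = 0") (auto simp: uniform_cis_def norm_divide)
qed

lemma norm_one_minus_cis_le: "norm (1 - cis x) \<le> \<bar>x\<bar>"
  using iexp_approx1[of x 0] by (simp add: cis_conv_exp norm_minus_commute)

lemma norm_one_minus_uniform_cis_le:
  assumes "0 < L"
  shows "norm (1 - uniform_cis L \<theta>) \<le> L * \<bar>\<theta>\<bar>"
proof -
  have "1 - uniform_cis L \<theta> = (\<Sum>u<L. 1 - cis (\<theta> * real u)) / of_nat L"
    using assms by (simp add: uniform_cis_def sum_subtractf diff_divide_distrib)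
  also have "norm \<dots> = norm (\<Sum>u<L. 1 - cis (\<theta> * real u)) / L"
    by (simp add: norm_divide)
  also have "\<dots> \<le> (\<Sum>u<L. L * \<bar>\<theta>\<bar>) / L"
  proof (intro divide_right_mono order.trans[OF norm_sum] sum_mono)
    fix u assume "u \<in> {..<L}"
    then have "\<bar>\<theta>\<bar> * u \<le> \<bar>\<theta>\<bar> * L" by (intro mult_left_mono) auto
    then show "norm (1 - cis (\<theta> * real u)) \<le> L * \<bar>\<theta>\<bar>"
      using norm_one_minus_cis_le[of "\<theta> * u"] by (simp add: abs_mult mult.commute)
  qed simp
  also have "\<dots> = L * \<bar>\<theta>\<bar>" using assms by simp
  finally show ?thesis .
qed

lemma norm_one_minus_cis_ge:
  assumes "\<bar>x\<bar> \<le> pi"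
  shows "\<bar>x\<bar> / 6 \<le> norm (1 - cis x)"
proof -
  have "x\<^sup>2 / 64 \<le> 1 - cos x"
  proof (cases "\<bar>x\<bar> \<le> 1")
    case True
    show ?thesis by (rule order.trans[OF _ one_minus_cos_ge[OF True]]) simp
  next
    case False
    have "cos \<bar>x\<bar> \<le> cos 1" using False assms by (intro cos_monotone_0_pi_le) auto
    moreover have "1 / 4 \<le> 1 - cos (1 :: real)" using one_minus_cos_ge[of 1] by simp
    moreover have "x\<^sup>2 \<le> 4\<^sup>2" using assms pi_less_4 by (intro power2_le_iff_abs_le[THEN iffD2]) auto
    ultimately show ?thesis by simp
  qed
  then have "2 * (x\<^sup>2 / 64) \<le> 2 * (1 - cos x)" by (rule mult_left_mono) simp
  moreover have "x\<^sup>2 / 36 \<le> 2 * (x\<^sup>2 / 64)" by simp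
  ultimately have "x\<^sup>2 / 36 \<le> 2 * (1 - cos x)" by (rule order.trans[rotated])
  also have "2 * (1 - cos x) = (1 - cos x)\<^sup>2 + (sin x)\<^sup>2"
    using sin_cos_squared_add2[of x] by (simp add: power2_eq_square algebra_simps)
  also have "\<dots> = (norm (1 - cis x))\<^sup>2" by (simp add: cmod_power2)
  finally have "(\<bar>x\<bar> / 6)\<^sup>2 \<le> (norm (1 - cis x))\<^sup>2" by (simp add: power_divide)
  then show ?thesis by (rule power2_le_imp_le) simp
qed

text \<open>A geometric sum: the numerator has modulus at most 2, and |1 - cis \<theta>| \<ge>
  |\<theta>| / 6 gives 12 = 2 * 6.\<close>

lemma norm_uniform_cis_le:
  assumes "0 < L" "\<theta> \<noteq> 0" "\<bar>\<theta>\<bar> \<le> pi"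
  shows "norm (uniform_cis L \<theta>) \<le> 12 / (L * \<bar>\<theta>\<bar>)"
proof -
  have pos: "0 < norm (1 - cis \<theta>)"
    using norm_one_minus_cis_ge[OF assms(3)] assms(2) by (smt (verit) divide_pos_pos zero_less_abs_iff)
  have "(\<Sum>u<L. cis (\<theta> * real u)) = (\<Sum>u<L. cis \<theta> ^ u)"
    by (intro sum.cong refl) (simp only: Complex.DeMoivre mult.commute[of \<theta>])
  then have "(1 - cis \<theta>) * (\<Sum>u<L. cis (\<theta> * real u)) = 1 - cis \<theta> ^ L"
    using one_diff_power_eq[of "cis \<theta>" L] by simp
  then have "norm (1 - cis \<theta>) * norm (\<Sum>u<L. cis (\<theta> * real u)) = norm (1 - cis \<theta> ^ L)"
    by (metis norm_mult)
  also have "\<dots> \<le> 2" using norm_triangle_ineq4[of 1 "cis \<theta> ^ L"] by (simp add: norm_power)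
  finally have "norm (\<Sum>u<L. cis (\<theta> * real u)) \<le> 2 / norm (1 - cis \<theta>)"
    using pos by (simp add: field_simps)
  also have "\<dots> \<le> 2 / (\<bar>\<theta>\<bar> / 6)"
    using norm_one_minus_cis_ge[OF assms(3)] assms pos by (intro divide_left_mono) auto
  finally have "norm (\<Sum>u<L. cis (\<theta> * real u)) / L \<le> 12 / \<bar>\<theta>\<bar> / L"
    by (intro divide_right_mono) auto
  then show ?thesis by (simp add: uniform_cis_def norm_divide mult.commute)
qed

text \<open>Orthogonality of characters, which yields Fourier inversion at integers.\<close>

lemma integral_cis_int:
  "integral {-pi..pi} (\<lambda>\<theta>. cis (\<theta> * of_int m)) = (if m = 0 then 2 * pi else 0)"
proof (cases "m = 0")
  case False
  have "((\<lambda>\<theta>. cis (\<theta> * of_int m)) has_integral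
      (cis (pi * of_int m) / (\<i> * of_int m) - cis (- pi * of_int m) / (\<i> * of_int m))) {-pi..pi}"
  proof (rule fundamental_theorem_of_calculus)
    fix x :: real
    have der: "((\<lambda>z. exp (\<i> * (z * of_int m)) / (\<i> * of_int m)) has_field_derivative
        exp (\<i> * (of_real x * of_int m))) (at (of_real x))"
      using False by (auto intro!: derivative_eq_intros simp: mult_ac)
    show "((\<lambda>\<theta>. cis (\<theta> * of_int m) / (\<i> * of_int m)) has_vector_derivative cis (x * of_int m)) (at x within {-pi..pi})"
      using has_vector_derivative_real_field[OF der] by (simp add: cis_conv_exp)
  qed simp
  moreover have "cis (pi * of_int m) = cis (- pi * of_int m)"
    by (simp add: complex_eq_iff sin_int_times_real)
  ultimately show ?thesis using False by (simp add: integral_unique)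
qed (simp add: scaleR_conv_of_real)

text \<open>The uniform distributions on \<open>{0..<L\<^sub>1}\<close> and \<open>{0..<L\<^sub>2}\<close> have transforms \<open>D\<^sub>1\<close> and \<open>D\<^sub>2\<close>.
  Convolving with \<open>D\<^sub>1 ^ K\<close> costs only a bounded factor on windows of length \<open>L\<^sub>1\<close>. In
  \<open>1 = (1 - D\<^sub>2) ^ J + D\<^sub>2 * (\<Sum>i<J. (1 - D\<^sub>2) ^ i)\<close> the first summand kills the low frequencies and
  the second one is a bounded combination of convolutions with windows of length \<open>L\<^sub>2\<close>.\<close>

lemma window_sum_le:
  fixes a :: "int \<Rightarrow> real" and \<eta> B :: real and S :: "int set" and L1 L2 J K :: nat and y :: int
  defines "\<phi> \<equiv> \<lambda>\<theta>. \<Sum>s\<in>S. a s * cis (\<theta> * of_int s)"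
  assumes fin: "finite S" and a: "\<And>s. 0 \<le> a s" "\<And>s. s \<notin> S \<Longrightarrow> a s = 0"
    and L: "0 < L1" "0 < L2"
    and B: "\<And>y. (\<Sum>u<L2. a (y + int u)) \<le> B"
    and \<eta>: "\<And>\<theta>. \<bar>\<theta>\<bar> \<le> pi \<Longrightarrow>
      norm (\<phi> \<theta>) * norm (uniform_cis L1 \<theta>) ^ K * norm (1 - uniform_cis L2 \<theta>) ^ J \<le> \<eta>"
  shows "(\<Sum>u<L1. a (y + int u)) \<le> real (K + 1) * L1 * (\<eta> + 2 ^ J * (B / L2))"
proof -
  \<comment> \<open>The z-th Fourier coefficient of \<phi> m, that is, the mass \<open>a\<close>
    after applying the multiplier m. With m = 1 it is \<open>a z\<close>.\<close>
  define A where "A m z = integral {-pi..pi} (\<lambda>\<theta>. \<phi> \<theta> * m \<theta> * cis (- \<theta> * of_int z)) / (2 * pi)"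
    for m :: "real \<Rightarrow> complex" and z :: int
  define D where "D = uniform_cis"
  let ?cont = "continuous_on {-pi..pi}"
  have cis_cont: "?cont (\<lambda>\<theta>. cis (\<theta> * c))" "?cont (\<lambda>\<theta>. cis (- \<theta> * c))" for c
    unfolding cis_conv_exp by (intro continuous_intros)+
  have \<phi>_cont: "?cont \<phi>" unfolding \<phi>_def by (intro continuous_intros cis_cont)
  have D_cont: "?cont (D L)" for L unfolding D_def by (rule continuous_on_uniform_cis)
  note conts = \<phi>_cont D_cont cis_cont
  have int: "(\<lambda>\<theta>. \<phi> \<theta> * m \<theta> * cis (- \<theta> * of_int z)) integrable_on {-pi..pi}" if "?cont m" for m z
    by (intro integrable_continuous_interval continuous_intros that conts)
  have A_one: "A (\<lambda>_. 1) z = of_real (a z)" for z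
  proof -
    have "integral {-pi..pi} (\<lambda>\<theta>. \<phi> \<theta> * 1 * cis (- \<theta> * of_int z))
        = integral {-pi..pi} (\<lambda>\<theta>. \<Sum>s\<in>S. a s * cis (\<theta> * of_int (s - z)))"
      by (intro integral_cong)
         (simp add: \<phi>_def sum_distrib_right mult.assoc cis_mult right_diff_distrib)
    also have "\<dots> = (\<Sum>s\<in>S. integral {-pi..pi} (\<lambda>\<theta>. a s * cis (\<theta> * of_int (s - z))))"
      by (rule integral_sum[OF fin]) (intro integrable_continuous_interval continuous_intros cis_cont)
    also have "\<dots> = (\<Sum>s\<in>S. if s = z then complex_of_real (a s * (2 * pi)) else 0)"
      by (intro sum.cong refl) (simp only: integral_mult_right integral_cis_int, simp)
    also have "\<dots> = a z * (2 * pi)"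
      using fin a(2)[of z] by auto
    finally show ?thesis by (simp add: A_def)
  qed
  have A_add: "A (\<lambda>\<theta>. m \<theta> + m' \<theta>) z = A m z + A m' z" if "?cont m" "?cont m'" for m m' z
  proof -
    have "(\<lambda>\<theta>. \<phi> \<theta> * (m \<theta> + m' \<theta>) * cis (- \<theta> * of_int z))
        = (\<lambda>\<theta>. \<phi> \<theta> * m \<theta> * cis (- \<theta> * of_int z) + \<phi> \<theta> * m' \<theta> * cis (- \<theta> * of_int z))"
      by (simp add: algebra_simps)
    then show ?thesis
      using integral_add[OF int[OF that(1)] int[OF that(2)]] by (simp add: A_def add_divide_distrib)
  qed
  have A_sum: "A (\<lambda>\<theta>. \<Sum>i<(n::nat). m i \<theta>) z = (\<Sum>i<n. A (m i) z)" if "\<And>i. ?cont (m i)" for m n z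
  proof (induction n)
    case (Suc n)
    then show ?case using that by (simp add: A_add continuous_intros)
  qed (simp add: A_def)
  have A_diff: "A (\<lambda>\<theta>. m \<theta> - m' \<theta>) z = A m z - A m' z" if "?cont m" "?cont m'" for m m' z
    using A_add[of "\<lambda>\<theta>. m \<theta> - m' \<theta>" m' z] that by (simp add: continuous_intros)
  \<comment> \<open>Multiplication by \<open>D L\<close> averages the coefficients over a window of
    length L ending at z. Hence it does not increase their supremum, and multiplication by 1 -
    \<open>D L\<close> at most doubles it.\<close>
  have A_D: "A (\<lambda>\<theta>. m \<theta> * D L \<theta>) z = (\<Sum>u<L. A m (z - int u)) / L" if "?cont m" for m L z
  proof -
    have "integral {-pi..pi} (\<lambda>\<theta>. \<phi> \<theta> * (m \<theta> * D L \<theta>) * cis (- \<theta> * of_int z))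
        = integral {-pi..pi} (\<lambda>\<theta>. (\<Sum>u<L. \<phi> \<theta> * m \<theta> * cis (- \<theta> * of_int (z - int u))) * (1 / L))"
    proof (intro integral_cong)
      fix \<theta> :: real
      have "cis (\<theta> * real u) * cis (- \<theta> * of_int z) = cis (- \<theta> * of_int (z - int u))" for u
        by (simp add: cis_mult algebra_simps)
      then have "(\<Sum>u<L. \<phi> \<theta> * m \<theta> * cis (- \<theta> * of_int (z - int u)))
          = \<phi> \<theta> * m \<theta> * ((\<Sum>u<L. cis (\<theta> * real u)) * cis (- \<theta> * of_int z))"
        by (simp add: sum_distrib_left sum_distrib_right)
      then show "\<phi> \<theta> * (m \<theta> * D L \<theta>) * cis (- \<theta> * of_int z)
          = (\<Sum>u<L. \<phi> \<theta> * m \<theta> * cis (- \<theta> * of_int (z - int u))) * (1 / L)"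
        by (simp add: D_def uniform_cis_def mult_ac)
    qed
    also have "\<dots> = (\<Sum>u<L. integral {-pi..pi} (\<lambda>\<theta>. \<phi> \<theta> * m \<theta> * cis (- \<theta> * of_int (z - int u)))) * (1 / L)"
      by (simp only: integral_mult_left integral_sum[OF finite_lessThan int[OF that]])
    finally show ?thesis by (simp add: A_def sum_divide_distrib mult.commute)
  qed
  have A_norm: "norm (A m z) \<le> b" if "?cont m" "\<And>\<theta>. \<bar>\<theta>\<bar> \<le> pi \<Longrightarrow> norm (\<phi> \<theta> * m \<theta>) \<le> b" for m z b
  proof -
    have b: "0 \<le> b" using order.trans[OF norm_ge_zero that(2)[of 0]] by simp
    have "norm (integral {-pi..pi} (\<lambda>\<theta>. \<phi> \<theta> * m \<theta> * cis (- \<theta> * of_int z))) \<le> b * (pi - (- pi))"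
    proof (rule integral_bound)
      fix t assume "t \<in> {- pi..pi}"
      then have "norm (\<phi> t * m t) \<le> b" by (intro that(2)) auto
      then show "norm (\<phi> t * m t * cis (- t * of_int z)) \<le> b" by (simp add: norm_mult)
    qed (auto intro!: continuous_intros conts that)
    then show ?thesis by (simp add: A_def norm_divide field_simps)
  qed
  have A_D_norm: "norm (A (\<lambda>\<theta>. m \<theta> * D L \<theta>) z) \<le> b" if "?cont m" "\<And>z. norm (A m z) \<le> b" "0 < L" for m L z b
  proof -
    have "norm (\<Sum>u<L. A m (z - int u)) \<le> (\<Sum>u<L. b)"
      by (intro order.trans[OF norm_sum] sum_mono that)
    then show ?thesis using that(3) by (simp add: A_D[OF that(1)] norm_divide field_simps)
  qed
  have A_1D_norm: "norm (A (\<lambda>\<theta>. m \<theta> * (1 - D L \<theta>)) z) \<le> 2 * b"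
    if "?cont m" "\<And>z. norm (A m z) \<le> b" "0 < L" for m L z b
  proof -
    have "A (\<lambda>\<theta>. m \<theta> * (1 - D L \<theta>)) z = A m z - A (\<lambda>\<theta>. m \<theta> * D L \<theta>) z"
      using that by (subst A_diff[symmetric]) (auto intro!: continuous_intros conts simp: algebra_simps)
    then show ?thesis
      using norm_triangle_ineq4[of "A m z" "A (\<lambda>\<theta>. m \<theta> * D L \<theta>) z"] that(2)[of z] A_D_norm[OF that, of z] by simp
  qed
  define b0 where "b0 = B / L2"
  \<comment> \<open>The only use of the hypothesis on long windows: the coefficient is a sum over
    one of them, divided by its length.\<close>
  have low1: "norm (A (\<lambda>\<theta>. 1 * D L2 \<theta>) z) \<le> b0" for z
  proof -
    have "A (\<lambda>\<theta>. 1 * D L2 \<theta>) z = of_real ((\<Sum>u<L2. a (z - int u)) / L2)"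
      by (subst A_D) (auto simp: A_one)
    moreover have "(\<Sum>u<L2. a (z - int u)) = (\<Sum>u<L2. a (z - int (L2 - 1) + int u))"
      by (rule sum.reindex_bij_witness[where i = "\<lambda>u. L2 - 1 - u" and j = "\<lambda>u. L2 - 1 - u"])
         (auto simp: of_nat_diff algebra_simps)
    moreover have "0 \<le> (\<Sum>u<L2. a (z - int u))" by (intro sum_nonneg a)
    ultimately show ?thesis
      using B[of "z - int (L2 - 1)"] by (simp add: b0_def divide_right_mono del: of_real_divide)
  qed
  have low2: "norm (A (\<lambda>\<theta>. D L2 \<theta> * (1 - D L2 \<theta>) ^ i) z) \<le> 2 ^ i * b0" for i z
  proof (induction i arbitrary: z)
    case (Suc i)
    have "norm (A (\<lambda>\<theta>. (D L2 \<theta> * (1 - D L2 \<theta>) ^ i) * (1 - D L2 \<theta>)) z) \<le> 2 * (2 ^ i * b0)"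
      by (intro A_1D_norm Suc L continuous_intros conts)
    then show ?case by (simp add: mult_ac)
  qed (use low1 in simp)
  have low3: "norm (A (\<lambda>\<theta>. (D L2 \<theta> * (1 - D L2 \<theta>) ^ i) * D L1 \<theta> ^ k) z) \<le> 2 ^ i * b0" for i k z
  proof (induction k arbitrary: z)
    case (Suc k)
    have "norm (A (\<lambda>\<theta>. ((D L2 \<theta> * (1 - D L2 \<theta>) ^ i) * D L1 \<theta> ^ k) * D L1 \<theta>) z) \<le> 2 ^ i * b0"
      by (intro A_D_norm Suc L continuous_intros conts)
    then show ?case by (simp add: mult_ac)
  qed (use low2 in simp)
  have high: "norm (A (\<lambda>\<theta>. (1 - D L2 \<theta>) ^ J * D L1 \<theta> ^ K) z) \<le> \<eta>" for z
  proof (rule A_norm)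
    fix \<theta> :: real assume "\<bar>\<theta>\<bar> \<le> pi"
    from \<eta>[OF this] show "norm (\<phi> \<theta> * ((1 - D L2 \<theta>) ^ J * D L1 \<theta> ^ K)) \<le> \<eta>"
      by (simp add: D_def norm_mult norm_power mult_ac)
  qed (intro continuous_intros conts)
  have b0: "0 \<le> b0" using order.trans[OF norm_ge_zero low1] .
  have total: "norm (A (\<lambda>\<theta>. D L1 \<theta> ^ K) z) \<le> \<eta> + 2 ^ J * b0" for z
  proof -
    have "D L1 \<theta> ^ K = (1 - D L2 \<theta>) ^ J * D L1 \<theta> ^ K + (\<Sum>i<J. (D L2 \<theta> * (1 - D L2 \<theta>) ^ i) * D L1 \<theta> ^ K)" for \<theta>
    proof -
      have "1 - (1 - D L2 \<theta>) ^ J = D L2 \<theta> * (\<Sum>i<J. (1 - D L2 \<theta>) ^ i)"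
        using one_diff_power_eq[of "1 - D L2 \<theta>" J] by simp
      then have "1 = (1 - D L2 \<theta>) ^ J + (\<Sum>i<J. D L2 \<theta> * (1 - D L2 \<theta>) ^ i)"
        by (simp add: sum_distrib_left algebra_simps)
      then have "1 * D L1 \<theta> ^ K = ((1 - D L2 \<theta>) ^ J + (\<Sum>i<J. D L2 \<theta> * (1 - D L2 \<theta>) ^ i)) * D L1 \<theta> ^ K"
        by (rule arg_cong)
      then show ?thesis by (simp add: distrib_right sum_distrib_right)
    qed
    then have "(\<lambda>\<theta>. D L1 \<theta> ^ K) = (\<lambda>\<theta>. (1 - D L2 \<theta>) ^ J * D L1 \<theta> ^ K
        + (\<Sum>i<J. (D L2 \<theta> * (1 - D L2 \<theta>) ^ i) * D L1 \<theta> ^ K))" by (rule ext)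
    then have "A (\<lambda>\<theta>. D L1 \<theta> ^ K) z = A (\<lambda>\<theta>. (1 - D L2 \<theta>) ^ J * D L1 \<theta> ^ K
        + (\<Sum>i<J. (D L2 \<theta> * (1 - D L2 \<theta>) ^ i) * D L1 \<theta> ^ K)) z" by simp
    also have "\<dots> = A (\<lambda>\<theta>. (1 - D L2 \<theta>) ^ J * D L1 \<theta> ^ K) z
        + (\<Sum>i<J. A (\<lambda>\<theta>. (D L2 \<theta> * (1 - D L2 \<theta>) ^ i) * D L1 \<theta> ^ K) z)"
    proof -
      have c1: "?cont (\<lambda>\<theta>. (1 - D L2 \<theta>) ^ J * D L1 \<theta> ^ K)"
        and c2: "?cont (\<lambda>\<theta>. \<Sum>i<J. (D L2 \<theta> * (1 - D L2 \<theta>) ^ i) * D L1 \<theta> ^ K)"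
        and c3: "\<And>i. ?cont (\<lambda>\<theta>. (D L2 \<theta> * (1 - D L2 \<theta>) ^ i) * D L1 \<theta> ^ K)"
        by (intro continuous_intros conts)+
      show ?thesis by (simp only: A_add[OF c1 c2] A_sum[OF c3])
    qed
    also have "norm \<dots> \<le> \<eta> + (\<Sum>i<J. 2 ^ i * b0)"
      by (intro order.trans[OF norm_triangle_ineq] add_mono high order.trans[OF norm_sum] sum_mono low3)
    also have "(\<Sum>i<J. 2 ^ i * b0) = (2 ^ J - 1) * b0"
      unfolding sum_distrib_right[symmetric] using sum_gp_strict[of "2 :: real" J] by simp
    also have "\<eta> + (2 ^ J - 1) * b0 \<le> \<eta> + 2 ^ J * b0"
      using b0 by (intro add_left_mono mult_right_mono) auto
    finally show ?thesis by simp
  qed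
  \<comment> \<open>The averaging operator that corresponds to multiplication by \<open>D L1\<close>
    on the Fourier side.\<close>
  define T where "T f z = (\<Sum>u<L1. f (z - int u)) / real L1" for f :: "int \<Rightarrow> real" and z
  have T_nonneg: "0 \<le> (T ^^ k) a z" for k z
    by (induction k arbitrary: z) (auto simp: a T_def intro!: sum_nonneg divide_nonneg_nonneg)
  have A_T: "A (\<lambda>\<theta>. D L1 \<theta> ^ k) z = of_real ((T ^^ k) a z)" for k z
  proof (induction k arbitrary: z)
    case (Suc k)
    have "A (\<lambda>\<theta>. D L1 \<theta> ^ k * D L1 \<theta>) z = (\<Sum>u<L1. A (\<lambda>\<theta>. D L1 \<theta> ^ k) (z - int u)) / L1"
      by (intro A_D continuous_intros conts)
    then show ?case by (simp add: Suc T_def mult.commute)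
  qed (simp add: A_one)
  \<comment> \<open>Averaging moves mass forward by less than L1, so lengthening the window by L1
    loses none of it. After K rounds the window has length (K + 1) L1.\<close>
  have spread: "(\<Sum>z\<in>{y..<y + w}. f z) \<le> (\<Sum>z\<in>{y..<y + w + int L1}. T f z)" if f: "\<And>z. 0 \<le> f z" for f w
  proof -
    have "(\<Sum>z\<in>{y..<y + w + int L1}. \<Sum>u<L1. f (z - int u)) = (\<Sum>u<L1. \<Sum>z\<in>{y..<y + w + int L1}. f (z - int u))"
      by (rule sum.swap)
    also have "\<dots> = (\<Sum>u<L1. \<Sum>z\<in>{y - int u..<y + w + int L1 - int u}. f z)"
      by (intro sum.cong refl sum.reindex_bij_witness[where i = "\<lambda>z. z + int u" and j = "\<lambda>z. z - int u" for u]) auto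
    also have "\<dots> \<ge> (\<Sum>u<L1. \<Sum>z\<in>{y..<y + w}. f z)"
      by (intro sum_mono sum_mono2) (auto simp: f)
    finally have "L1 * (\<Sum>z\<in>{y..<y + w}. f z) \<le> (\<Sum>z\<in>{y..<y + w + int L1}. \<Sum>u<L1. f (z - int u))" by simp
    then show ?thesis
      using L by (simp add: T_def field_simps flip: sum_divide_distrib)
  qed
  have spread': "(\<Sum>z\<in>{y..<y + int L1}. a z) \<le> (\<Sum>z\<in>{y..<y + int (Suc k * L1)}. (T ^^ k) a z)" for k
  proof (induction k)
    case (Suc k)
    have "(\<Sum>z\<in>{y..<y + int (Suc k * L1)}. (T ^^ k) a z)
        \<le> (\<Sum>z\<in>{y..<y + int (Suc k * L1) + int L1}. T ((T ^^ k) a) z)"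
      by (rule spread) (rule T_nonneg)
    with Suc show ?case by (simp add: algebra_simps)
  qed simp
  have "(\<Sum>u<L1. a (y + int u)) = (\<Sum>z\<in>{y..<y + int L1}. a z)"
    by (rule sum.reindex_bij_witness[where i = "\<lambda>z. nat (z - y)" and j = "\<lambda>u. y + int u"]) auto
  also have "\<dots> \<le> (\<Sum>z\<in>{y..<y + int (Suc K * L1)}. (T ^^ K) a z)" by (rule spread')
  also have "\<dots> \<le> (\<Sum>z\<in>{y..<y + int (Suc K * L1)}. \<eta> + 2 ^ J * b0)"
  proof (rule sum_mono)
    fix z
    show "(T ^^ K) a z \<le> \<eta> + 2 ^ J * b0"
      using total[of z] T_nonneg[of K z] by (simp add: A_T)
  qed
  also have "\<dots> = real (Suc K * L1) * (\<eta> + 2 ^ J * b0)" by simp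
  finally show ?thesis by (simp add: b0_def algebra_simps)
qed

section \<open>Point probabilities of the clique count\<close>

lemma pairs_eq_vertex_pairs: "pairs {1..n} = vertex_pairs n"
  by (simp add: pairs_def vertex_pairs_def)

section \<open>From the pmf to averages, and the descent through window lengths\<close>

context bernoulli_param
begin

text \<open>Both sides obey the same recursion on inserting one Bernoulli coordinate; P is
  generalised because that coordinate is absorbed into it.\<close>

lemma prob_Pi_pmf_eq_avg:
  assumes "finite M"
  shows "measure_pmf.prob (Pi_pmf M False (\<lambda>_. bernoulli_pmf p)) {f. P {e \<in> M. f e}} = avg M (\<lambda>G. of_bool (P G))"
  using assms
proof (induction M arbitrary: P rule: finite_induct)
  case empty
  show ?case by simp
next
  case (insert e M)
  let ?Q = "Pi_pmf M False (\<lambda>_. bernoulli_pmf p)"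
  let ?A = "{f. P {e' \<in> insert e M. f e'}}"
  have part: "measure_pmf.prob (map_pmf (\<lambda>f. f(e := y)) ?Q) ?A
      = avg M (\<lambda>G. of_bool (P (if y then insert e G else G)))" for y
  proof -
    have "{e' \<in> insert e M. (f(e := y)) e'} = (if y then insert e {e' \<in> M. f e'} else {e' \<in> M. f e'})" for f
      using insert.hyps by auto
    then have "(\<lambda>f. f(e := y)) -` ?A = {f. P (if y then insert e {e' \<in> M. f e'} else {e' \<in> M. f e'})}" by auto
    then show ?thesis using insert.IH[of "\<lambda>G. P (if y then insert e G else G)"] by simp
  qed
  have "Pi_pmf (insert e M) False (\<lambda>_. bernoulli_pmf p) = bind_pmf (bernoulli_pmf p) (\<lambda>y. map_pmf (\<lambda>f. f(e := y)) ?Q)"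
    using insert.hyps by (simp add: Pi_pmf_insert' map_pmf_def)
  then have "ennreal (measure_pmf.prob (Pi_pmf (insert e M) False (\<lambda>_. bernoulli_pmf p)) ?A)
      = ennreal (measure_pmf.prob (map_pmf (\<lambda>f. f(e := True)) ?Q) ?A) * ennreal p
        + ennreal (measure_pmf.prob (map_pmf (\<lambda>f. f(e := False)) ?Q) ?A) * ennreal (1 - p)"
    using p_pos p_less_1
    by (simp only: measure_pmf.emeasure_eq_measure[symmetric] emeasure_bind_pmf)
       (subst nn_integral_bernoulli_pmf, auto)
  also have "\<dots> = ennreal (measure_pmf.prob (map_pmf (\<lambda>f. f(e := True)) ?Q) ?A * p
        + measure_pmf.prob (map_pmf (\<lambda>f. f(e := False)) ?Q) ?A * (1 - p))"
    using p_pos p_less_1 by (simp add: ennreal_mult ennreal_plus)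
  finally have "measure_pmf.prob (Pi_pmf (insert e M) False (\<lambda>_. bernoulli_pmf p)) ?A
      = measure_pmf.prob (map_pmf (\<lambda>f. f(e := True)) ?Q) ?A * p
        + measure_pmf.prob (map_pmf (\<lambda>f. f(e := False)) ?Q) ?A * (1 - p)"
    using p_pos p_less_1 by (subst (asm) ennreal_inj) auto
  then show ?case
    unfolding part using insert.hyps by (simp add: avg_insert mult.commute)
qed

lemma prob_random_graph_eq_avg:
  "measure_pmf.prob (random_graph n p) {G. P G} = avg (pairs {1..n}) (\<lambda>G. of_bool (P G))"
proof -
  have "finite (vertex_pairs n)" unfolding pairs_eq_vertex_pairs[symmetric] by simp
  from prob_Pi_pmf_eq_avg[OF this, of P] show ?thesis
    unfolding pairs_eq_vertex_pairs random_graph_def by (simp add: vimage_def)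
qed

text \<open>Indexed by integers, since windows are shifted in both directions.\<close>

definition count_mass :: "nat \<Rightarrow> nat \<Rightarrow> int \<Rightarrow> real" where
  "count_mass h n z = avg (pairs {1..n}) (\<lambda>G. of_bool (int (clique_count h n G) = z))"

lemma count_mass_nonneg: "0 \<le> count_mass h n z"
  unfolding count_mass_def by (rule avg_nonneg) simp

lemma count_mass_window_le_1: "(\<Sum>u<L. count_mass h n (y + int u)) \<le> 1"
proof -
  have "(\<Sum>u<L. count_mass h n (y + int u))
      = avg (pairs {1..n}) (\<lambda>G. \<Sum>u<L. of_bool (int (clique_count h n G) = y + int u))"
    unfolding count_mass_def by (rule avg_sum[symmetric])
  also have "\<dots> \<le> 1"
  proof (rule avg_le_const)
    fix G
    let ?c = "int (clique_count h n G)"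
    have "(\<Sum>u<L. of_bool (?c = y + int u) :: real) = card {u \<in> {..<L}. ?c = y + int u}"
      by (simp add: Int_def)
    also have "card {u \<in> {..<L}. ?c = y + int u} \<le> card {nat (?c - y)}"
      by (rule card_mono) auto
    finally show "(\<Sum>u<L. of_bool (?c = y + int u) :: real) \<le> 1" by simp
  qed simp
  finally show ?thesis .
qed

text \<open>The decay of the characteristic function is only known for \<open>\<bar>\<theta>\<bar>\<close> between
  \<open>n powr (e - k)\<close> and \<open>n powr (1 - k - e)\<close>. Each step passes from windows of length
  \<open>n powr (k - 2 * e)\<close> to windows of length \<open>n powr (k - 1 + 2 * e)\<close>; the gaps between these
  ranges are bridged by the monotonicity of window probabilities, at a cost of \<open>n powr (4 * e)\<close>.\<close>

lemma eventually_window_le: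
  fixes e :: real
  assumes e: "0 < e" "e \<le> 1 / 4" and "j < h"
  shows "\<exists>C>0. \<forall>\<^sub>F n in sequentially. \<forall>y.
    (\<Sum>u<nat \<lceil>real n powr (real (h - j) - 1 + 2 * e)\<rceil>. count_mass h n (y + int u))
      \<le> C * real n powr (- (real j * (1 - 4 * e)))"
  using assms(3)
proof (induction j)
  case 0
  have "\<forall>\<^sub>F n in sequentially. \<forall>y.
      (\<Sum>u<nat \<lceil>real n powr (real (h - 0) - 1 + 2 * e)\<rceil>. count_mass h n (y + int u))
      \<le> 1 * real n powr (- (real 0 * (1 - 4 * e)))"
    using eventually_gt_at_top[of 0] by eventually_elim (simp add: count_mass_window_le_1)
  then show ?case using zero_less_one by blast
next
  case (Suc j)
  define k where "k = h - Suc j"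
  have k: "1 \<le> k" "k < h" "h - j = Suc k" "h - Suc j = k" using Suc.prems by (auto simp: k_def)
  from Suc obtain C where C: "0 < C" and IH: "\<forall>\<^sub>F n in sequentially. \<forall>y.
      (\<Sum>u<nat \<lceil>real n powr (real (h - j) - 1 + 2 * e)\<rceil>. count_mass h n (y + int u))
      \<le> C * real n powr (- (real j * (1 - 4 * e)))" by auto
  \<comment> \<open>Large enough that the windows' length times n^(-D) stays below n^(-h), hence
    below every bound claimed.\<close>
  define D where "D = 2 * real h"
  \<comment> \<open>One exponent serves both multipliers: (24 n^(-e))^J \<le> n^(-D) covers the low
    and the high frequencies.\<close>
  define J where "J = nat \<lceil>(D + 1) / e\<rceil>"
  have J: "D < e * J"
  proof -
    have "(D + 1) / e \<le> J" unfolding J_def by linarith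
    then show ?thesis using e by (simp add: field_simps)
  qed
  have "\<forall>\<^sub>F n :: nat in sequentially. 24 ^ J * real n powr (- (e * J)) \<le> 1 * real n powr (- D)"
    using J by (intro eventually_powr_le) auto
  moreover have "\<forall>\<^sub>F n in sequentially. \<forall>\<theta>. real n powr (e - real k) \<le> \<bar>\<theta>\<bar> \<longrightarrow>
    \<bar>\<theta>\<bar> \<le> real n powr (1 - real k - e) \<longrightarrow>
    norm (avg (pairs {1..n}) (\<lambda>G. cis (\<theta> * clique_count h n G))) \<le> real n powr (- D)"
    using k e by (intro eventually_norm_avg_cis_clique_count_le) auto
  ultimately have "\<forall>\<^sub>F n in sequentially. \<forall>y.
      (\<Sum>u<nat \<lceil>real n powr (real (h - Suc j) - 1 + 2 * e)\<rceil>. count_mass h n (y + int u))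
      \<le> ((J + 1) * 2 ^ (J + 1) * (1 + C)) * real n powr (- (real (Suc j) * (1 - 4 * e)))"
    using IH eventually_gt_at_top[of 0]
  proof eventually_elim
    case (elim n)
    note tail = elim(1) and decay = elim(2) and win = elim(3)
    have n: "0 < real n" "1 \<le> real n" using elim(4) by auto
    define x1 where "x1 = real n powr (real k - 1 + 2 * e)"
    define x2 where "x2 = real n powr (real k - 2 * e)"
    define L1 where "L1 = nat \<lceil>x1\<rceil>"
    define L2 where "L2 = nat \<lceil>x2\<rceil>"
    have "1 \<le> x1" "1 \<le> x2" unfolding x1_def x2_def using n k e by (auto intro!: ge_one_powr_ge_zero)
    then have L1: "x1 \<le> L1" "L1 \<le> 2 * x1" and L2: "x2 \<le> L2" "L2 \<le> 2 * x2" and pos: "0 < L1" "0 < L2"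
      unfolding L1_def L2_def by linarith+
    define B where "B = C * real n powr (- (real j * (1 - 4 * e)))"
    \<comment> \<open>The factor 2^J pays for |1 - D\<theta>|^J in the middle range, where that
      modulus, with D\<theta> the transform of length \<open>L2\<close>, is only known to be at most
      2.\<close>
    define \<eta> where "\<eta> = 2 ^ J * real n powr (- D)"
    define S where "S = (\<lambda>G. int (clique_count h n G)) ` Pow (pairs {1..n})"
    have finS: "finite S" by (simp add: S_def)
    have \<phi>: "(\<Sum>s\<in>S. count_mass h n s * cis (\<theta> * of_int s))
        = avg (pairs {1..n}) (\<lambda>G. cis (\<theta> * clique_count h n G))" for \<theta> :: real
    proof -
      have "(\<Sum>s\<in>S. count_mass h n s * cis (\<theta> * of_int s))
          = avg (pairs {1..n}) (\<lambda>G. \<Sum>s\<in>S. of_bool (int (clique_count h n G) = s) * cis (\<theta> * of_int s))"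
      proof -
        have "complex_of_real (count_mass h n s) = avg (pairs {1..n}) (\<lambda>G. of_bool (int (clique_count h n G) = s))" for s
          unfolding count_mass_def avg_of_real[symmetric] by (simp add: of_bool_def if_distrib cong: if_cong)
        then show ?thesis by (simp add: avg_sum avg_mult_right)
      qed
      also have "\<dots> = avg (pairs {1..n}) (\<lambda>G. cis (\<theta> * clique_count h n G))"
      proof (intro avg_cong refl)
        fix G assume "G \<subseteq> pairs {1..n}"
        then have "int (clique_count h n G) \<in> S" by (auto simp: S_def)
        then have "(\<Sum>s\<in>S. if s = int (clique_count h n G) then cis (\<theta> * of_int s) else 0)
            = cis (\<theta> * of_int (int (clique_count h n G)))"
          using finS by simp
        moreover have "(\<Sum>s\<in>S. of_bool (int (clique_count h n G) = s) * cis (\<theta> * of_int s))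
            = (\<Sum>s\<in>S. if s = int (clique_count h n G) then cis (\<theta> * of_int s) else 0)"
          by (intro sum.cong) auto
        ultimately show "(\<Sum>s\<in>S. of_bool (int (clique_count h n G) = s) * cis (\<theta> * of_int s))
            = cis (\<theta> * clique_count h n G)" by simp
      qed
      finally show ?thesis .
    qed
    show ?case
    proof
      fix y
      have "(\<Sum>u<L1. count_mass h n (y + int u)) \<le> real (J + 1) * L1 * (\<eta> + 2 ^ J * (B / L2))"
      proof (rule window_sum_le[OF finS])
        fix s assume "s \<notin> S"
        then have "count_mass h n s = avg (pairs {1..n}) (\<lambda>_. 0)"
          unfolding count_mass_def by (intro avg_cong) (auto simp: S_def)
        then show "count_mass h n s = 0" by simp
      next
        fix y
        have "x2 \<le> real n powr (real (h - j) - 1 + 2 * e)"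
          unfolding x2_def k(3) using n e by (intro powr_mono) auto
        then have "L2 \<le> nat \<lceil>real n powr (real (h - j) - 1 + 2 * e)\<rceil>"
          unfolding L2_def by (intro nat_mono ceiling_mono)
        then have "(\<Sum>u<L2. count_mass h n (y + int u))
            \<le> (\<Sum>u<nat \<lceil>real n powr (real (h - j) - 1 + 2 * e)\<rceil>. count_mass h n (y + int u))"
          by (intro sum_mono2) (auto simp: count_mass_nonneg)
        also have "\<dots> \<le> B" unfolding B_def using win by blast
        finally show "(\<Sum>u<L2. count_mass h n (y + int u)) \<le> B" .
      next
        fix \<theta> :: real assume \<theta>: "\<bar>\<theta>\<bar> \<le> pi"
        define \<phi>n where "\<phi>n = norm (\<Sum>s\<in>S. count_mass h n s * cis (\<theta> * of_int s))"
        define d1 where "d1 = norm (uniform_cis L1 \<theta>)"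
        define d2 where "d2 = norm (1 - uniform_cis L2 \<theta>)"
        have \<phi>1: "0 \<le> \<phi>n" "\<phi>n \<le> 1"
          unfolding \<phi>n_def \<phi> by (auto intro!: order.trans[OF norm_avg_le] avg_le_const)
        have d1: "0 \<le> d1" "d1 \<le> 1" by (auto simp: d1_def norm_uniform_cis_le_1)
        have d2: "0 \<le> d2" "d2 \<le> 2"
          using norm_triangle_ineq4[of 1 "uniform_cis L2 \<theta>"] norm_uniform_cis_le_1[of L2 \<theta>]
          by (auto simp: d2_def)
        have tail': "c ^ J * real n powr (- (e * J)) \<le> real n powr (- D)" if "0 \<le> c" "c \<le> 24" for c
        proof -
          have "c ^ J * real n powr (- (e * J)) \<le> 24 ^ J * real n powr (- (e * J))"
            using that by (intro mult_right_mono power_mono) auto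
          then show ?thesis using tail by simp
        qed
        have \<eta>_ge: "real n powr (- D) \<le> \<eta>"
          unfolding \<eta>_def by (simp add: mult_le_cancel_right1)
        have powJ: "(c * real n powr (- e)) ^ J = c ^ J * real n powr (- (e * J))" for c
          using n by (simp add: power_mult_distrib powr_power mult.commute)
        show "norm (\<Sum>s\<in>S. count_mass h n s * cis (\<theta> * of_int s)) * norm (uniform_cis L1 \<theta>) ^ J
            * norm (1 - uniform_cis L2 \<theta>) ^ J \<le> \<eta>"
          unfolding \<phi>n_def[symmetric] d1_def[symmetric] d2_def[symmetric]
        proof -
          \<comment> \<open>Low frequencies: L2 |\<theta>| is at most 2 n^(-e), so the factor built
            from \<open>L2\<close> is small. Middle: the characteristic function decays. High: L1
            |\<theta>| is at least n^e, so the transform of length \<open>L1\<close> is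
            small.\<close>
          consider "\<bar>\<theta>\<bar> < real n powr (e - real k)"
            | "real n powr (e - real k) \<le> \<bar>\<theta>\<bar>" "\<bar>\<theta>\<bar> \<le> real n powr (1 - real k - e)"
            | "real n powr (1 - real k - e) < \<bar>\<theta>\<bar>" by linarith
          then show "\<phi>n * d1 ^ J * d2 ^ J \<le> \<eta>"
          proof cases
            case 1
            have "d2 \<le> L2 * \<bar>\<theta>\<bar>" unfolding d2_def using pos by (intro norm_one_minus_uniform_cis_le)
            also have "\<dots> \<le> (2 * x2) * real n powr (e - real k)"
              using 1 L2 by (intro mult_mono) auto
            also have "\<dots> = 2 * real n powr (- e)" by (simp add: x2_def flip: powr_add)
            finally have "d2 ^ J \<le> (2 * real n powr (- e)) ^ J" using d2 by (intro power_mono)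
            also have "\<dots> \<le> \<eta>" unfolding powJ using tail'[of 2] \<eta>_ge by simp
            finally have "d2 ^ J \<le> \<eta>" .
            moreover have "\<phi>n * d1 ^ J * d2 ^ J \<le> 1 * 1 * d2 ^ J"
              using \<phi>1 d1 d2 by (intro mult_right_mono mult_mono power_le_one) auto
            ultimately show ?thesis by simp
          next
            case 2
            then have "\<phi>n \<le> real n powr (- D)" unfolding \<phi>n_def \<phi> using decay by blast
            then have "\<phi>n * d1 ^ J * d2 ^ J \<le> real n powr (- D) * 1 * 2 ^ J"
              using \<phi>1 d1 d2 by (intro mult_mono power_le_one power_mono) auto
            then show ?thesis by (simp add: \<eta>_def mult.commute)
          next
            case 3
            then have "\<theta> \<noteq> 0" using powr_ge_zero[of "real n" "1 - real k - e"] by auto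
            have "d1 \<le> 12 / (L1 * \<bar>\<theta>\<bar>)"
              unfolding d1_def using pos \<theta> \<open>\<theta> \<noteq> 0\<close> by (intro norm_uniform_cis_le)
            also have "\<dots> \<le> 12 / (x1 * real n powr (1 - real k - e))"
              using 3 L1 n pos \<open>\<theta> \<noteq> 0\<close> by (intro divide_left_mono mult_mono mult_pos_pos) (auto simp: x1_def)
            also have "\<dots> = 12 * real n powr (- e)"
              by (simp add: x1_def powr_minus field_simps flip: powr_add)
            finally have "d1 \<le> 12 * real n powr (- e)" .
            then have "\<phi>n * d1 ^ J * d2 ^ J \<le> 1 * (12 * real n powr (- e)) ^ J * 2 ^ J"
              using \<phi>1 d1 d2 by (intro mult_mono power_mono) auto
            also have "\<dots> = 24 ^ J * real n powr (- (e * J))"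
              unfolding powJ using power_mult_distrib[of 12 "2 :: real" J] by simp
            also have "\<dots> \<le> \<eta>" using tail'[of 24] \<eta>_ge by simp
            finally show ?thesis .
          qed
        qed
      qed (use pos count_mass_nonneg in auto)
      also have "\<dots> \<le> real (J + 1) * (2 * x1) * (2 ^ J * real n powr (- D) + 2 ^ J * (B / x2))"
      proof (intro mult_mono add_mono)
        show "\<eta> \<le> 2 ^ J * real n powr (- D)" by (simp add: \<eta>_def)
        show "B / L2 \<le> B / x2"
          using L2 pos C n by (intro divide_left_mono) (auto simp: B_def x2_def)
      qed (use L1 C in \<open>auto simp: \<eta>_def B_def x1_def\<close>)
      also have "\<dots> = (real (J + 1) * 2 ^ (J + 1)) * (x1 * real n powr (- D) + x1 * (B / x2))"
        by (simp add: algebra_simps)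
      also have "\<dots> \<le> (real (J + 1) * 2 ^ (J + 1)) *
          (real n powr (- (real (Suc j) * (1 - 4 * e))) + C * real n powr (- (real (Suc j) * (1 - 4 * e))))"
      proof (intro mult_left_mono add_mono)
        have "real (Suc j) * (1 - 4 * e) \<le> real h * 1" using Suc.prems e by (intro mult_mono) auto
        moreover have "real k - 1 + 2 * e - D \<le> - real h" using k e by (simp add: D_def)
        ultimately have "real k - 1 + 2 * e - D \<le> - (real (Suc j) * (1 - 4 * e))" by linarith
        then have "real n powr (real k - 1 + 2 * e - D) \<le> real n powr (- (real (Suc j) * (1 - 4 * e)))"
          using n by (intro powr_mono)
        then show "x1 * real n powr (- D) \<le> real n powr (- (real (Suc j) * (1 - 4 * e)))"
          by (simp add: x1_def flip: powr_add)
        have "x1 * (B / x2) = C * (x1 / x2 * real n powr (- (real j * (1 - 4 * e))))"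
          by (simp add: B_def)
        \<comment> \<open>The gain of one step: a factor 1/n up to n^(4 e).\<close>
        also have "x1 / x2 = real n powr (- (1 - 4 * e))"
          by (simp add: x1_def x2_def flip: powr_diff)
        also have "real n powr (- (1 - 4 * e)) * real n powr (- (real j * (1 - 4 * e)))
            = real n powr (- (real (Suc j) * (1 - 4 * e)))"
          unfolding powr_add[symmetric] by (simp add: algebra_simps)
        finally show "x1 * (B / x2) \<le> C * real n powr (- (real (Suc j) * (1 - 4 * e)))" by simp
      qed auto
      finally show "(\<Sum>u<nat \<lceil>real n powr (real (h - Suc j) - 1 + 2 * e)\<rceil>. count_mass h n (y + int u))
          \<le> ((J + 1) * 2 ^ (J + 1) * (1 + C)) * real n powr (- (real (Suc j) * (1 - 4 * e)))"
        unfolding L1_def x1_def k(4) by (simp add: algebra_simps)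
    qed
  qed
  moreover have "0 < real ((J + 1) * 2 ^ (J + 1)) * (1 + C)"
    using C by (intro mult_pos_pos of_nat_0_less_iff[THEN iffD2]) auto
  ultimately show ?case by (intro exI[of _ "real ((J + 1) * 2 ^ (J + 1)) * (1 + C)"] conjI)
qed

lemma eventually_prob_clique_count_le:
  fixes \<epsilon> :: real
  assumes "0 < \<epsilon>"
  shows "\<forall>\<^sub>F n in sequentially. \<forall>x.
    measure_pmf.prob (random_graph n p) {G. clique_count h n G = x} \<le> real n powr (\<epsilon> + 1 - real h)"
proof (cases "h = 0")
  case True
  show ?thesis
    using eventually_gt_at_top[of 0]
  proof eventually_elim
    case (elim n)
    have "1 \<le> real n powr (\<epsilon> + 1 - real h)" using elim assms True by (intro ge_one_powr_ge_zero) auto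
    then show ?case using measure_pmf.prob_le_1 order.trans by blast
  qed
next
  case False
  \<comment> \<open>The h - 1 steps lose n^(4 e (h - 1)), at most n^(\<epsilon>/2); the other half
    of \<epsilon> absorbs the constant C.\<close>
  define e where "e = min (1 / 4) (\<epsilon> / (8 * real h))"
  have e: "0 < e" "e \<le> 1 / 4" using assms False by (auto simp: e_def)
  have "e * (8 * real h) \<le> \<epsilon>"
    using False unfolding e_def by (simp add: min_mult_distrib_right min_le_iff_disj)
  moreover have "e * real (h - 1) \<le> e * real h" using e by (intro mult_left_mono) auto
  ultimately have "4 * e * real (h - 1) \<le> \<epsilon> / 2" by (simp add: mult_ac)
  then have ex: "real h - 1 - \<epsilon> / 2 \<le> real (h - 1) * (1 - 4 * e)"
    using False by (simp add: of_nat_diff algebra_simps)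
  obtain C where C: "0 < C" and win: "\<forall>\<^sub>F n in sequentially. \<forall>y.
    (\<Sum>u<nat \<lceil>real n powr (real (h - (h - 1)) - 1 + 2 * e)\<rceil>. count_mass h n (y + int u))
      \<le> C * real n powr (- (real (h - 1) * (1 - 4 * e)))"
    using eventually_window_le[OF e, of "h - 1" h] False by auto
  have "\<forall>\<^sub>F n :: nat in sequentially. C * real n powr (- (real h - 1 - \<epsilon> / 2)) \<le> 1 * real n powr (- (real h - 1 - \<epsilon>))"
    using assms by (intro eventually_powr_le) auto
  then show ?thesis
    using win eventually_gt_at_top[of 0]
  proof eventually_elim
    case (elim n)
    have n: "0 < real n" "1 \<le> real n" using elim(3) by auto
    define L where "L = nat \<lceil>real n powr (real (h - (h - 1)) - 1 + 2 * e)\<rceil>"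
    have "0 < real n powr (real (h - (h - 1)) - 1 + 2 * e)" using n by simp
    then have "0 < L" unfolding L_def by linarith
    show ?case
    proof
      fix x
      have "measure_pmf.prob (random_graph n p) {G. clique_count h n G = x} = count_mass h n (int x + int 0)"
        by (simp add: prob_random_graph_eq_avg count_mass_def)
      also have "\<dots> \<le> (\<Sum>u<L. count_mass h n (int x + int u))"
        using \<open>0 < L\<close> by (intro member_le_sum[where f = "\<lambda>u. count_mass h n (int x + int u)"])
          (auto simp: count_mass_nonneg)
      also have "\<dots> \<le> C * real n powr (- (real (h - 1) * (1 - 4 * e)))" unfolding L_def using elim(2) by blast
      also have "\<dots> \<le> C * real n powr (- (real h - 1 - \<epsilon> / 2))"
        using C ex n by (intro mult_left_mono powr_mono) auto
      also have "\<dots> \<le> real n powr (\<epsilon> + 1 - real h)"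
        using elim(1) by (simp add: algebra_simps)
      finally show "measure_pmf.prob (random_graph n p) {G. clique_count h n G = x} \<le> real n powr (\<epsilon> + 1 - real h)" .
    qed
  qed
qed

end

text \<open>Passes from "for every \<epsilon>, eventually" to one null sequence by taking nearly the
  least admissible exponent for each n. The range starts at 1 because \<open>0 powr y\<close> is 0
  in HOL, whereas for n = 0 the count is deterministic.\<close>

theorem theorem1p14:
  fixes p :: real and h :: nat
  assumes "0 < p" and "p < 1"
  shows "\<exists>\<alpha> :: nat \<Rightarrow> real. \<alpha> \<longlonglongrightarrow> 0 \<and>
    (\<forall>n \<ge> 1. \<forall>x :: nat.
      measure_pmf.prob (random_graph n p) {G. clique_count h n G = x}
        \<le> real n powr (\<alpha> n + 1 - real h))"
proof -
  interpret bernoulli_param p by unfold_locales fact+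
  define A where "A n = {a. 0 \<le> a \<and> (\<forall>x. measure_pmf.prob (random_graph n p) {G. clique_count h n G = x}
    \<le> real n powr (a + 1 - real h))}" for n
  \<comment> \<open>The added 1/n yields an admissible exponent strictly below
    \<open>\<alpha> n\<close>, so the infimum need not be attained.\<close>
  define \<alpha> where "\<alpha> n = Inf (A n) + 1 / real n" for n
  have bdd: "bdd_below (A n)" for n by (intro bdd_belowI[of _ 0]) (simp add: A_def)
  have lim: "\<alpha> \<longlonglongrightarrow> 0"
  proof (rule order_tendstoI)
    fix l :: real assume l: "l < 0"
    have "\<forall>\<^sub>F n in sequentially. A n \<noteq> {}"
      using eventually_prob_clique_count_le[OF zero_less_one, of h] by eventually_elim (auto simp: A_def intro!: exI[of _ 1])
    then show "\<forall>\<^sub>F n in sequentially. l < \<alpha> n"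
    proof eventually_elim
      case (elim n)
      then have "0 \<le> Inf (A n)" by (intro cInf_greatest) (auto simp: A_def)
      then have "0 \<le> \<alpha> n" by (simp add: \<alpha>_def)
      then show ?case using l by linarith
    qed
  next
    fix u :: real assume u: "0 < u"
    have "\<forall>\<^sub>F n in sequentially. u / 2 \<in> A n"
      using eventually_prob_clique_count_le[of "u / 2" h] u by (simp add: A_def)
    moreover have "\<forall>\<^sub>F n :: nat in sequentially. 1 / real n < u / 2"
      using u by real_asymp
    ultimately show "\<forall>\<^sub>F n in sequentially. \<alpha> n < u"
    proof eventually_elim
      case (elim n)
      then show ?case using cInf_lower[OF elim(1) bdd] by (simp add: \<alpha>_def)
    qed
  qed
  have bound: "measure_pmf.prob (random_graph n p) {G. clique_count h n G = x} \<le> real n powr (\<alpha> n + 1 - real h)"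
    if n: "1 \<le> n" for n x
  proof -
    \<comment> \<open>With exponent h the bound is n \<ge> 1, so \<open>A n\<close> is nonempty for
      every n from 1 on, not just eventually.\<close>
    have "real h \<in> A n"
    proof -
      have "1 \<le> real n powr (real h + 1 - real h)" using n by simp
      then show ?thesis by (auto simp: A_def intro!: order.trans[OF measure_pmf.prob_le_1])
    qed
    then have "A n \<noteq> {}" by auto
    moreover have "Inf (A n) < \<alpha> n" using n by (simp add: \<alpha>_def)
    ultimately obtain a where a: "a \<in> A n" "a < \<alpha> n" using cInf_lessD by blast
    have "measure_pmf.prob (random_graph n p) {G. clique_count h n G = x} \<le> real n powr (a + 1 - real h)"
      using a by (simp add: A_def)
    also have "\<dots> \<le> real n powr (\<alpha> n + 1 - real h)" using a n by (intro powr_mono) auto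
    finally show ?thesis .
  qed
  show ?thesis by (rule exI[of _ \<alpha>], intro conjI allI impI lim bound)
qed

end
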